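(* Let $W$ be a restricted $\tau$-module. Then there exists a $V(T,0)$-module structure $Y_W$ on $W$ which is uniquely determined by $Y_W(\mathfrak{c};x_0,\mathbf{x})=\mathfrak{c}(\mathbf{x})$ and $Y_W(a;x_0,\mathbf{x})=a(x_0,\mathbf{x})$ for $a\in\mathfrak{g}$. Conversely, if $(W,Y_W)$ is a $V(T,0)$-module, then $W$ becomes a restricted $\tau$-module with $\mathfrak{c}(\mathbf{x})=Y_W(\mathfrak{c};x_0,\mathbf{x})$ and $a(x_0,\mathbf{x})=Y_W(a;x_0,\mathbf{x})$ for $a\in\mathfrak{g}$. Furthermore, the category of restricted $\tau$-modules is isomorphic to the category of $V(T,0)$-modules.
   Context: Fix a positive integer $r$; $\mathbf{x}=(x_1,\dots,x_r)$, $\mathbf{x}^{\mathbf{m}}=\prod x_i^{m_i}$. A toroidal vertex algebra is a vector space $V$ with a linear map $Y(\cdot;x_0,\mathbf{x}):V\to\mathrm{Hom}(V,V[[x_1^{\pm1},\dots,x_r^{\pm1}]]((x_0)))$, $v\mapsto\sum v_{m_0,\mathbf{m}}x_0^{-m_0-1}\mathbf{x}^{-\mathbf{m}}$, and a vector $\mathbf{1}$ with $Y(\mathbf{1};x_0,\mathbf{x})v=v$, $Y(v;x_0,\mathbf{x})\mathbf{1}\in V[[x_0,x_1^{\pm1},\dots,x_r^{\pm1}]]$, and the Jacobi identity $z_0^{-1}\delta(\frac{x_0-y_0}{z_0})Y(u;x_0,\mathbf{z}\mathbf{y})Y(v;y_0,\mathbf{y})-z_0^{-1}\delta(\frac{y_0-x_0}{-z_0})Y(v;y_0,\mathbf{y})Y(u;x_0,\mathbf{z}\mathbf{y})=y_0^{-1}\delta(\frac{x_0-z_0}{y_0})Y(Y(u;z_0,\mathbf{z})v;y_0,\mathbf{y})$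 ($\mathbf{z}\mathbf{y}=(z_iy_i)$, $Y(u;x_0,\mathbf{z}\mathbf{y})=\sum u_{m_0,\mathbf{m}}x_0^{-m_0-1}\mathbf{z}^{-\mathbf{m}}\mathbf{y}^{-\mathbf{m}}$). A module is a vector space $W$ with linear $Y_W:V\to\mathrm{Hom}(W,W[[x_1^{\pm1},\dots,x_r^{\pm1}]]((x_0)))$, $Y_W(\mathbf{1};x_0,\mathbf{x})=1_W$, satisfying the Jacobi identity with $Y_W$ in the three outer operator places. Let $\mathfrak{g}$ be a finite-dimensional simple Lie algebra over $\mathbb{C}$ with normalized Killing form $\langle\cdot,\cdot\rangle$; $\hat{\mathfrak{g}}=\mathfrak{g}\otimes\mathbb{C}[t_0^{\pm1}]\oplus\mathbb{C}\mathfrak{c}$ with $\mathfrak{c}$ central and $[a\otimes t_0^m,b\otimes t_0^n]=[a,b]\otimes t_0^{m+n}+m\langle a,b\rangle\delta_{m+n,0}\mathfrak{c}$; $L_r=\mathbb{C}[t_1^{\pm1},\dots,t_r^{\pm1}]$; $\tau=\hat{\mathfrak{g}}\otimes L_r$ with $[u\otimes\mathbf{t}^{\mathbf{m}},v\otimes\mathbf{t}^{\mathbf{n}}]=[u,v]\otimes\mathbf{t}^{\mathbf{m}+\mathbf{n}}$. For $a\in\mathfrak{g}$, $a(x_0,\mathbf{x})=\sum(a\otimes t_0^{m_0}\mathbf{t}^{\mathbf{m}})x_0^{-m_0-1}\mathbf{x}^{-\mathbf{m}}$, $\mathfrak{c}(\mathbf{x})=\sum(\mathfrak{c}\otimes\mathbf{t}^{\mathbf{m}})\mathbf{x}^{-\mathbf{m}}$.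 A $\tau$-module $W$ is restricted if $a(x_0,\mathbf{x})\in\mathrm{Hom}(W,W[[x_1^{\pm1},\dots,x_r^{\pm1}]]((x_0)))$ for all $a\in\mathfrak{g}$. $\mathfrak{b}=\mathfrak{g}\otimes\mathbb{C}[t_0]$, $L_r(\mathfrak{b})=\mathfrak{b}\otimes L_r$. $T=\mathfrak{g}\oplus\mathbb{C}\mathfrak{c}\oplus\mathbb{C}$ is the $L_r(\mathfrak{b})$-module with $(a\otimes t_0^k\mathbf{t}^{\mathbf{m}})\cdot b=[a,b]$ ($k=0$), $\langle a,b\rangle\mathfrak{c}$ ($k=1$), $0$ ($k\ge2$), and $L_r(\mathfrak{b})\cdot(\mathbb{C}\mathfrak{c}+\mathbb{C})=0$. $V(T,0)=U(\tau)\otimes_{U(L_r(\mathfrak{b}))}T$ carries the unique toroidal vertex algebra structure with vacuum $\mathbf{1}=1\otimes1$, $Y(\mathfrak{c};x_0,\mathbf{x})=\mathfrak{c}(\mathbf{x})$ and $Y(a;x_0,\mathbf{x})=a(x_0,\mathbf{x})$ for $a\in\mathfrak{g}$ (with $T\subset V(T,0)$). *)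

theory Defs
  imports "HOL-Analysis.Analysis" "HOL-Library.Poly_Mapping"
begin

text \<open>The Lie algebra g is a type carrying a complex scalar multiplication, a bracket and a
  symmetric bilinear form (the form will be required to be the normalized Killing form).
  These are class parameters only so that the induced module V(T,0) below can be a type.\<close>

class lie_data = ab_group_add +
  fixes lscale :: "complex \<Rightarrow> 'a \<Rightarrow> 'a"
    and lbr :: "'a \<Rightarrow> 'a \<Rightarrow> 'a"
    and lform :: "'a \<Rightarrow> 'a \<Rightarrow> complex"

definition fin_dim_lie_algebra :: "'a::lie_data itself \<Rightarrow> bool" where
  "fin_dim_lie_algebra _ \<longleftrightarrow>
     (\<exists>B. finite_dimensional_vector_space (lscale :: complex \<Rightarrow> 'a \<Rightarrow> 'a) B) \<and>
     (\<forall>a b c :: 'a. lbr (a + b) c = lbr a c + lbr b c) \<and>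
     (\<forall>k (a::'a) b. lbr (lscale k a) b = lscale k (lbr a b)) \<and>
     (\<forall>a::'a. lbr a a = 0) \<and>
     (\<forall>a b c :: 'a. lbr a (lbr b c) + lbr b (lbr c a) + lbr c (lbr a b) = 0)"

definition lie_ideal :: "'a::lie_data set \<Rightarrow> bool" where
  "lie_ideal I \<longleftrightarrow> module.subspace (lscale :: complex \<Rightarrow> 'a \<Rightarrow> 'a) I \<and>
     (\<forall>a b. b \<in> I \<longrightarrow> lbr a b \<in> I)"

definition simple_lie_algebra :: "'a::lie_data itself \<Rightarrow> bool" where
  "simple_lie_algebra T \<longleftrightarrow> fin_dim_lie_algebra T \<and>
     (\<exists>a b :: 'a. lbr a b \<noteq> 0) \<and>
     (\<forall>I :: 'a set. lie_ideal I \<longrightarrow> I = {0} \<or> I = UNIV)"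

text \<open>Killing form: trace of ad a \<circ> ad b, computed in some basis (the trace is
  basis independent).\<close>
definition killing :: "'a::lie_data \<Rightarrow> 'a \<Rightarrow> complex" where
  "killing a b = (let B = (SOME B. finite_dimensional_vector_space (lscale :: complex \<Rightarrow> 'a \<Rightarrow> 'a) B)
     in \<Sum>e\<in>B. module.representation lscale B (lbr a (lbr b e)) e)"

definition sl2_triple :: "'a::lie_data \<Rightarrow> 'a \<Rightarrow> 'a \<Rightarrow> bool" where
  "sl2_triple e h f \<longleftrightarrow> h \<noteq> 0 \<and> lbr h e = lscale 2 e \<and> lbr h f = lscale (-2) f \<and> lbr e f = h"

text \<open>Normalized Killing form: the nonzero multiple of the Killing form for which
  long roots have square length 2.  Equivalently (Dynkin index): for every sl2-triple
  (e,h,f), the value of the form on (h,h) is 2 times a positive integer (the Dynkin index of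
  the sl2-subalgebra), and the value 2 is attained (by the sl2-triple of a long root).\<close>
definition normalized_killing_form :: "'a::lie_data itself \<Rightarrow> bool" where
  "normalized_killing_form _ \<longleftrightarrow>
     (\<exists>c. c \<noteq> 0 \<and> (\<forall>a b :: 'a. lform a b = c * killing a b)) \<and>
     (\<exists>e h f :: 'a. sl2_triple e h f \<and> lform h h = 2) \<and>
     (\<forall>e h f :: 'a. sl2_triple e h f \<longrightarrow> (\<exists>k::nat. k \<ge> 1 \<and> lform h h = 2 * of_nat k))"

text \<open>A tau-module structure on a complex vector space W (scalar multiplication scW) is
  given by the actions  act a m0 m  of  a \<otimes> t0^m0 t^m  and  cact m  of  c \<otimes> t^m
  (multi-indices m in Z^r are vectors int^'r), linear in a, satisfying the bracket
  relations of tau.\<close>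
definition tau_module ::
  "(complex \<Rightarrow> 'w::ab_group_add \<Rightarrow> 'w) \<Rightarrow> ('g::lie_data \<Rightarrow> int \<Rightarrow> int^'r::finite \<Rightarrow> 'w \<Rightarrow> 'w)
     \<Rightarrow> (int^'r \<Rightarrow> 'w \<Rightarrow> 'w) \<Rightarrow> bool" where
  "tau_module scW act cact \<longleftrightarrow> vector_space scW \<and>
     (\<forall>a m M. Vector_Spaces.linear scW scW (act a m M)) \<and>
     (\<forall>M. Vector_Spaces.linear scW scW (cact M)) \<and>
     (\<forall>a b m M w. act (a + b) m M w = act a m M w + act b m M w) \<and>
     (\<forall>k a m M w. act (lscale k a) m M w = scW k (act a m M w)) \<and>
     (\<forall>a b m n M N w. act a m M (act b n N w) - act b n N (act a m M w) =
        act (lbr a b) (m + n) (M + N) w +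
        (if m + n = 0 then scW (of_int m * lform a b) (cact (M + N) w) else 0)) \<and>
     (\<forall>M a n N w. cact M (act a n N w) = act a n N (cact M w)) \<and>
     (\<forall>M N w. cact M (cact N w) = cact N (cact M w))"

text \<open>Restricted: a(x0,x) w lies in W[[x^{\<plusminus>1}]]((x0)), i.e. the coefficient of
  x0^(-m0-1) vanishes for m0 large.\<close>
definition restricted :: "('g \<Rightarrow> int \<Rightarrow> int^'r::finite \<Rightarrow> 'w::zero \<Rightarrow> 'w) \<Rightarrow> bool" where
  "restricted act \<longleftrightarrow> (\<forall>a w. \<exists>N. \<forall>m\<ge>N. \<forall>M. act a m M w = 0)"

definition tau_hom ::
  "('g \<Rightarrow> int \<Rightarrow> int^'r::finite \<Rightarrow> 'w1 \<Rightarrow> 'w1) \<Rightarrow> (int^'r \<Rightarrow> 'w1 \<Rightarrow> 'w1)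
   \<Rightarrow> ('g \<Rightarrow> int \<Rightarrow> int^'r \<Rightarrow> 'w2 \<Rightarrow> 'w2) \<Rightarrow> (int^'r \<Rightarrow> 'w2 \<Rightarrow> 'w2) \<Rightarrow> ('w1 \<Rightarrow> 'w2) \<Rightarrow> bool" where
  "tau_hom act1 cact1 act2 cact2 f \<longleftrightarrow>
     (\<forall>a m M w. f (act1 a m M w) = act2 a m M (f w)) \<and> (\<forall>M w. f (cact1 M w) = cact2 M (f w))"

text \<open>A vertex operator Y(v;x0,x) = \<Sum> v_{m0,m} x0^(-m0-1) x^(-m) is represented by its
  modes:  Y v m0 m w = v_{m0,m} w.\<close>

definition fsum :: "(nat \<Rightarrow> 'w::comm_monoid_add) \<Rightarrow> 'w" where
  "fsum f = sum f {i. f i \<noteq> 0}"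

definition gbin :: "int \<Rightarrow> nat \<Rightarrow> complex" where
  "gbin n i = (of_int n :: complex) gchoose i"

text \<open>Jacobi identity, written coefficientwise: the coefficient of
  z0^(-n-1) x0^(-p-1) y0^(-q-1) z^(-M) y^(-K) of both sides (all sums are finite by
  truncation).  The left side expands the two delta functions in nonnegative powers of y0
  resp. x0; the right side gives \<Sum>_j (-1)^j binom(j-p-1,j) (u_{n+j,M} v)_{p+q-j,K}, and
  (-1)^j binom(j-p-1,j) = binom(p,j).\<close>
definition jacobi ::
  "('v \<Rightarrow> int \<Rightarrow> int^'r::finite \<Rightarrow> 'v \<Rightarrow> 'v) \<Rightarrow> (complex \<Rightarrow> 'w::ab_group_add \<Rightarrow> 'w)
    \<Rightarrow> ('v \<Rightarrow> int \<Rightarrow> int^'r \<Rightarrow> 'w \<Rightarrow> 'w) \<Rightarrow> bool" where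
  "jacobi Y scW YW \<longleftrightarrow> (\<forall>u v w p q n M K.
     fsum (\<lambda>j. scW (gbin p j) (YW (Y u (n + int j) M v) (p + q - int j) K w)) =
     fsum (\<lambda>i. scW ((-1) ^ i * gbin n i) (YW u (p + n - int i) M (YW v (q + int i) (K - M) w)))
     - scW ((-1) powi n)
         (fsum (\<lambda>i. scW ((-1) ^ i * gbin n i) (YW v (q + n - int i) (K - M) (YW u (p + int i) M w)))))"

definition vt_module ::
  "(complex \<Rightarrow> 'v::ab_group_add \<Rightarrow> 'v) \<Rightarrow> ('v \<Rightarrow> int \<Rightarrow> int^'r::finite \<Rightarrow> 'v \<Rightarrow> 'v) \<Rightarrow> 'v
    \<Rightarrow> (complex \<Rightarrow> 'w::ab_group_add \<Rightarrow> 'w) \<Rightarrow> ('v \<Rightarrow> int \<Rightarrow> int^'r \<Rightarrow> 'w \<Rightarrow> 'w) \<Rightarrow> bool" where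
  "vt_module scV Y vac scW YW \<longleftrightarrow> vector_space scW \<and>
     (\<forall>v m M. Vector_Spaces.linear scW scW (YW v m M)) \<and>
     (\<forall>u v m M w. YW (u + v) m M w = YW u m M w + YW v m M w) \<and>
     (\<forall>c v m M w. YW (scV c v) m M w = scW c (YW v m M w)) \<and>
     (\<forall>v w. \<exists>N. \<forall>m\<ge>N. \<forall>M. YW v m M w = 0) \<and>
     (\<forall>m M w. YW vac m M w = (if m = -1 \<and> M = 0 then w else 0)) \<and>
     jacobi Y scW YW"

definition toroidal_VA ::
  "(complex \<Rightarrow> 'v::ab_group_add \<Rightarrow> 'v) \<Rightarrow> ('v \<Rightarrow> int \<Rightarrow> int^'r::finite \<Rightarrow> 'v \<Rightarrow> 'v) \<Rightarrow> 'v \<Rightarrow> bool" where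
  "toroidal_VA scV Y vac \<longleftrightarrow> vector_space scV \<and> vt_module scV Y vac scV Y \<and>
     (\<forall>v m M. m \<ge> 0 \<longrightarrow> Y v m M vac = 0)"

definition vt_module_hom ::
  "('v \<Rightarrow> int \<Rightarrow> int^'r::finite \<Rightarrow> 'w1 \<Rightarrow> 'w1) \<Rightarrow> ('v \<Rightarrow> int \<Rightarrow> int^'r \<Rightarrow> 'w2 \<Rightarrow> 'w2)
    \<Rightarrow> ('w1 \<Rightarrow> 'w2) \<Rightarrow> bool" where
  "vt_module_hom YW1 YW2 f \<longleftrightarrow> (\<forall>v m M w. f (YW1 v m M w) = YW2 v m M (f w))"

section \<open>The induced module V(T,0) = U(tau) \<otimes>_{U(L_r(b))} T\<close>

text \<open>Spanning elements of tau: TG a m0 m = a \<otimes> t0^m0 t^m, TC m = c \<otimes> t^m.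
  Spanning elements of T = g \<oplus> C\<cc> \<oplus> C: Tg a, Tc (= \<cc>), T1 (= 1).\<close>
datatype ('g, 'r) tgen = TG 'g int "int^'r" | TC "int^'r"
datatype 'g tvec = Tg 'g | Tc | T1

text \<open>Free vector space on pairs (word x1...xk, t), standing for x1 \<cdot> ... \<cdot> xk \<otimes> t.\<close>
type_synonym ('g, 'r) vfree = "(('g, 'r) tgen list \<times> 'g tvec) \<Rightarrow>\<^sub>0 complex"

definition bv :: "('g, 'r::finite) tgen list \<Rightarrow> 'g tvec \<Rightarrow> ('g, 'r) vfree" where
  "bv w t = Poly_Mapping.single (w, t) 1"

definition fscale :: "complex \<Rightarrow> ('a \<Rightarrow>\<^sub>0 complex) \<Rightarrow> ('a \<Rightarrow>\<^sub>0 complex)" where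
  "fscale c p = Poly_Mapping.map (\<lambda>z. c * z) p"

text \<open>The subspace of relations: linearity of the spanning symbols, the commutation
  relations of U(tau), and the balancing relations  u x \<otimes> t = u \<otimes> x.t  for x in L_r(b).\<close>
inductive_set vrel :: "('g::lie_data, 'r::finite) vfree set" where
  zero: "0 \<in> vrel"
| add: "p \<in> vrel \<Longrightarrow> q \<in> vrel \<Longrightarrow> p + q \<in> vrel"
| neg: "p \<in> vrel \<Longrightarrow> - p \<in> vrel"
| scale: "p \<in> vrel \<Longrightarrow> fscale c p \<in> vrel"
| lin_add: "bv (u @ TG (a + b) m M # v) t - bv (u @ TG a m M # v) t - bv (u @ TG b m M # v) t \<in> vrel"
| lin_scale: "bv (u @ TG (lscale c a) m M # v) t - fscale c (bv (u @ TG a m M # v) t) \<in> vrel"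
| tlin_add: "bv w (Tg (a + b)) - bv w (Tg a) - bv w (Tg b) \<in> vrel"
| tlin_scale: "bv w (Tg (lscale c a)) - fscale c (bv w (Tg a)) \<in> vrel"
| comm_GG: "bv (u @ TG a m M # TG b n N # v) t - bv (u @ TG b n N # TG a m M # v) t
     - bv (u @ TG (lbr a b) (m + n) (M + N) # v) t
     - (if m + n = 0 then fscale (of_int m * lform a b) (bv (u @ TC (M + N) # v) t) else 0) \<in> vrel"
| comm_GC: "bv (u @ TG a m M # TC N # v) t - bv (u @ TC N # TG a m M # v) t \<in> vrel"
| comm_CC: "bv (u @ TC M # TC N # v) t - bv (u @ TC N # TC M # v) t \<in> vrel"
| ind_0: "bv (w @ [TG a 0 M]) (Tg b) - bv w (Tg (lbr a b)) \<in> vrel"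
| ind_1: "bv (w @ [TG a 1 M]) (Tg b) - fscale (lform a b) (bv w Tc) \<in> vrel"
| ind_ge2: "k \<ge> 2 \<Longrightarrow> bv (w @ [TG a k M]) (Tg b) \<in> vrel"
| ind_c: "k \<ge> 0 \<Longrightarrow> bv (w @ [TG a k M]) Tc \<in> vrel"
| ind_unit: "k \<ge> 0 \<Longrightarrow> bv (w @ [TG a k M]) T1 \<in> vrel"

quotient_type (overloaded) ('g, 'r) vt0 = "('g::lie_data, 'r::finite) vfree" / "\<lambda>p q. p - q \<in> vrel"
proof (rule equivpI)
  show "reflp (\<lambda>p q :: ('g, 'r) vfree. p - q \<in> vrel)"
    by (rule reflpI) (simp add: vrel.zero)
  show "symp (\<lambda>p q :: ('g, 'r) vfree. p - q \<in> vrel)"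
  proof (rule sympI)
    fix p q :: "('g, 'r) vfree"
    assume "p - q \<in> vrel"
    then have "- (p - q) \<in> vrel" by (rule vrel.neg)
    then show "q - p \<in> vrel" by simp
  qed
  show "transp (\<lambda>p q :: ('g, 'r) vfree. p - q \<in> vrel)"
  proof (rule transpI)
    fix p q r :: "('g, 'r) vfree"
    assume "p - q \<in> vrel" "q - r \<in> vrel"
    then have "(p - q) + (q - r) \<in> vrel" by (rule vrel.add)
    then show "p - r \<in> vrel" by simp
  qed
qed

instantiation vt0 :: (lie_data, finite) ab_group_add
begin
lift_definition zero_vt0 :: "('a, 'b) vt0" is "0 :: ('a, 'b) vfree" .
lift_definition plus_vt0 :: "('a, 'b) vt0 \<Rightarrow> ('a, 'b) vt0 \<Rightarrow> ('a, 'b) vt0" is "(+)"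
proof -
  fix p p' q q' :: "('a, 'b) vfree"
  assume "p - p' \<in> vrel" "q - q' \<in> vrel"
  then have "(p - p') + (q - q') \<in> vrel" by (rule vrel.add)
  then show "p + q - (p' + q') \<in> vrel" by (simp add: algebra_simps)
qed
lift_definition uminus_vt0 :: "('a, 'b) vt0 \<Rightarrow> ('a, 'b) vt0" is uminus
proof -
  fix p p' :: "('a, 'b) vfree"
  assume "p - p' \<in> vrel"
  then have "- (p - p') \<in> vrel" by (rule vrel.neg)
  then show "- p - - p' \<in> vrel" by (simp add: algebra_simps)
qed
lift_definition minus_vt0 :: "('a, 'b) vt0 \<Rightarrow> ('a, 'b) vt0 \<Rightarrow> ('a, 'b) vt0" is "(-)"
proof -
  fix p p' q q' :: "('a, 'b) vfree"
  assume "p - p' \<in> vrel" "q - q' \<in> vrel"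
  then have "(p - p') + - (q - q') \<in> vrel" by (intro vrel.add vrel.neg)
  then show "p - q - (p' - q') \<in> vrel" by (simp add: algebra_simps)
qed
instance
  by intro_classes (transfer; simp add: vrel.zero algebra_simps)+
end

text \<open>Scalar multiplication, the tau-action (left multiplication) on V(T,0), and the
  inclusion T \<subseteq> V(T,0), t \<mapsto> 1 \<otimes> t (all well defined on classes).\<close>
definition vscale :: "complex \<Rightarrow> ('g::lie_data, 'r::finite) vt0 \<Rightarrow> ('g, 'r) vt0" where
  "vscale c v = abs_vt0 (fscale c (rep_vt0 v))"

definition lmul :: "('g, 'r::finite) tgen \<Rightarrow> ('g, 'r) vfree \<Rightarrow> ('g, 'r) vfree" where
  "lmul x p = (\<Sum>k\<in>Poly_Mapping.keys p. Poly_Mapping.single (x # fst k, snd k) (Poly_Mapping.lookup p k))"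

definition vact :: "('g::lie_data, 'r::finite) tgen \<Rightarrow> ('g, 'r) vt0 \<Rightarrow> ('g, 'r) vt0" where
  "vact x v = abs_vt0 (lmul x (rep_vt0 v))"

definition tinc :: "'g::lie_data tvec \<Rightarrow> ('g, 'r::finite) vt0" where
  "tinc t = abs_vt0 (bv [] t)"

end

theory Submission
  imports Defs
begin

text \<open>The Jacobi identity with \<open>p = 0\<close> says that \<open>u\<^sub>n v\<close> acts on a module as the \<open>n\<close>-th product of
  the fields of \<open>u\<close> and \<open>v\<close>. As \<open>V(T,0)\<close> is generated from \<open>T\<close> by the modes of \<open>g\<close> and \<open>\<cc>\<close>, this
  determines a module structure, and module homomorphisms, by the fields of \<open>T\<close>. Conversely, the
  same formula defines, recursively on words, a field on a restricted module for each word. It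
  respects the relations of \<open>V(T,0)\<close> and satisfies the Jacobi identity because \<open>n\<close>-th products of
  mutually local fields satisfy the Borcherds identity and are again mutually local (Dong's lemma).

  For three mutually local fields both facts come down to comparing expansions, in different
  regions, of \<open>(x - y)^l (x - z)^m (y - z)^n\<close> applied to the six orderings of \<open>A(x) B(y) C(z) w\<close>.
  Since multiplication by \<open>x - y\<close> is injective on suitably truncated series, a family \<open>F\<^sub>n\<close> with
  \<open>(x - y) F\<^sub>n = F\<^sub>n\<^sub>+\<^sub>1\<close> is determined by any one of its members, which replaces explicit binomial
  manipulations. The Borcherds identity indexed by \<open>(p, q, n)\<close> propagates along
  \<open>x^(p+1) y^q (x-y)^n - x^p y^(q+1) (x-y)^n = x^p y^q (x-y)^(n+1)\<close>, so it suffices to have it for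
  large \<open>n\<close> (locality) and for one \<open>p\<close> (weak associativity).

  A module has \<open>\<cc>\<close> concentrated in mode \<open>-1\<close> because \<open>[h\<^sub>k, h\<^sub>0] = k \<langle>h, h\<rangle> \<cc>\<^sub>k\<^sub>-\<^sub>1\<close> while
  \<open>[h\<^sub>0, h\<^sub>k] = 0\<close>.\<close>

section \<open>Expansions of powers of a difference\<close>

text \<open>The torus variables are mere labels: at fixed degrees the Jacobi identity relates
  ordinary one-variable fields of degrees \<open>M\<close> and \<open>K - M\<close>, the product
  having degree \<open>K\<close>. So the calculus of fields is developed in one variable per field,
  and the degrees return only as parameters and in truncation bounds, which must be uniform in them.

  The obstacle is that formal delta functions are killed by \<open>x - y\<close>, and that a
  negative power of \<open>x - y\<close> can be applied only to series truncated in the matching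
  direction. Cancellation is therefore available only among terms expanded in a common region. This
  is why each triple product is cut into two parts, to which the uniqueness argument is applied
  separately with opposite directions. Passing from one ordering of operators to another is possible
  only after multiplication by a nonnegative power at least the common locality exponent
  \<open>N\<close>.

  The descent for the Borcherds identity starts at \<open>p = N\<close>: there the terms
  \<open>B\<^sub>Q (A\<^sub>P C)\<close> all have \<open>P \<ge> N\<close> and vanish by locality,
  so that only weak associativity remains to be proved.\<close>

definition zmul :: "int \<Rightarrow> 'i::ab_group_add \<Rightarrow> 'i" where
  "zmul n e = (\<Sum>_<nat n. e) - (\<Sum>_<nat (- n). e)"

lemma zmul_0 [simp]: "zmul 0 e = 0"
  by (simp add: zmul_def)

lemma zmul_add1: "zmul (n + 1) e = zmul n e + e"
proof (cases "n \<ge> 0")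
  case True
  then have "nat (n + 1) = Suc (nat n)" "nat (- (n + 1)) = 0" "nat (- n) = 0" by auto
  then show ?thesis by (simp add: zmul_def)
next
  case False
  then have "nat (- n) = Suc (nat (- (n + 1)))" "nat n = 0" "nat (n + 1) = 0" by auto
  then show ?thesis by (simp add: zmul_def)
qed

lemma zmul_Suc: "zmul (int (Suc i)) e = zmul (int i) e + e"
  using zmul_add1[of "int i" e] by (simp add: add.commute)

lemma zmul_zero [simp]: "zmul n 0 = 0"
  by (simp add: zmul_def)

lemma zmul_Pair: "zmul n (a, b) = (zmul n a, zmul n b)"
proof -
  have "(\<Sum>_<k. (a, b)) = ((\<Sum>_<k. a), (\<Sum>_<k. b))" for k :: nat
    by (induction k) (auto simp: zero_prod_def)
  then show ?thesis by (simp add: zmul_def)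
qed

lemma zmul_int: "zmul n (k::int) = n * k"
  by (simp add: zmul_def algebra_simps)

lemma gbin_0 [simp]: "gbin n 0 = 1"
  by (simp add: gbin_def)

lemma gbin_pascal: "gbin (n + 1) (Suc i) = gbin n i + gbin n (Suc i)"
  unfolding gbin_def by (simp add: gbinomial_Suc_Suc)

lemma gbin_zero_left: "gbin 0 (Suc i) = 0"
  by (simp add: gbin_def)

lemma gbin_1: "gbin n 1 = of_int n"
  by (simp add: gbin_def)

lemma fsum_eq_sum:
  assumes "\<And>i. i \<ge> k \<Longrightarrow> f i = 0"
  shows "fsum f = sum f {..<k}"
proof -
  have "{i. f i \<noteq> 0} \<subseteq> {..<k}" using assms by (auto simp: not_le[symmetric])
  then show ?thesis unfolding fsum_def
    by (intro sum.mono_neutral_left) auto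
qed

lemma fsum_zero [simp]: "fsum (\<lambda>_. 0) = 0"
  by (simp add: fsum_def)

lemma fsum_first:
  assumes "\<And>i. f (Suc i) = 0"
  shows "fsum f = f 0"
proof -
  have "f i = 0" if "i \<ge> 1" for i using assms[of "i - 1"] that by simp
  then show ?thesis using fsum_eq_sum[of 1 f] by simp
qed

lemma fsum_hom:
  assumes add: "\<And>a b. \<phi> (a + b) = \<phi> a + \<phi> b" and k: "\<And>i. i \<ge> k \<Longrightarrow> f i = 0"
  shows "\<phi> (fsum f :: 'a::comm_monoid_add) = fsum (\<lambda>i. \<phi> (f i) :: 'b::ab_group_add)"
proof -
  have z: "\<phi> 0 = 0" using add[of 0 0] by simp
  have "\<phi> (sum f {..<k}) = (\<Sum>i<k. \<phi> (f i))" for k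
    by (induction k) (auto simp: z add)
  moreover have "fsum (\<lambda>i. \<phi> (f i)) = (\<Sum>i<k. \<phi> (f i))"
    by (rule fsum_eq_sum) (simp add: k z)
  ultimately show ?thesis by (simp add: fsum_eq_sum[of k f] k)
qed

text \<open>A function \<open>f\<close> on a group of multi-indices is read as a coefficient family; shifting the index
  by \<open>a\<close> is multiplication by a variable \<open>x\<^sub>a\<close>, and \<open>shift_diff a b\<close> is multiplication by
  \<open>x\<^sub>a - x\<^sub>b\<close>.\<close>

definition shift_diff :: "'i::plus \<Rightarrow> 'i \<Rightarrow> ('i \<Rightarrow> 'w::minus) \<Rightarrow> 'i \<Rightarrow> 'w" where
  "shift_diff a b f = (\<lambda>v. f (v + a) - f (v + b))"

definition vanishes_along :: "'i::ab_group_add \<Rightarrow> ('i \<Rightarrow> 'w::zero) \<Rightarrow> bool" where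
  "vanishes_along d f \<longleftrightarrow> (\<forall>v. \<exists>k. \<forall>i\<ge>k. f (v + zmul (int i) d) = 0)"

lemma vanishes_along_shift:
  "vanishes_along d f \<Longrightarrow> vanishes_along d (\<lambda>v. f (v + e))"
  unfolding vanishes_along_def by (metis add.commute add.left_commute)

lemma vanishes_along_comb:
  assumes "vanishes_along d f" "vanishes_along d g" and z: "h 0 0 = 0"
  shows "vanishes_along d (\<lambda>v. h (f v) (g v))"
  unfolding vanishes_along_def
proof
  fix v
  obtain k l where "\<forall>i\<ge>k. f (v + zmul (int i) d) = 0" "\<forall>i\<ge>l. g (v + zmul (int i) d) = 0"
    using assms unfolding vanishes_along_def by meson
  then show "\<exists>k. \<forall>i\<ge>k. h (f (v + zmul (int i) d)) (g (v + zmul (int i) d)) = 0"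
    using z by (intro exI[of _ "max k l"]) auto
qed

lemma vanishes_along_diff:
  "vanishes_along d f \<Longrightarrow> vanishes_along d g \<Longrightarrow> vanishes_along d (\<lambda>v. f v - g v :: 'w::ab_group_add)"
  by (rule vanishes_along_comb[where h="(-)"]) auto

lemma vanishes_along_shift_diff:
  "vanishes_along d f \<Longrightarrow> vanishes_along d (shift_diff a b f :: _ \<Rightarrow> 'w::ab_group_add)"
  unfolding shift_diff_def by (intro vanishes_along_diff vanishes_along_shift)

lemma shift_diff_commute:
  fixes f :: "'i::ab_group_add \<Rightarrow> 'w::ab_group_add"
  shows "shift_diff a b (shift_diff c d f) = shift_diff c d (shift_diff a b f)"
  by (simp add: shift_diff_def fun_eq_iff algebra_simps)

lemma shift_diff_telescope:
  fixes f :: "'i::ab_group_add \<Rightarrow> 'w::ab_group_add"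
  shows "shift_diff a c f v = shift_diff a b f v + shift_diff b c f v"
  by (simp add: shift_diff_def)

lemma shift_diff_funpow_commute:
  fixes f :: "'i::ab_group_add \<Rightarrow> 'w::ab_group_add"
  shows "shift_diff a b ((shift_diff c d ^^ n) f) = (shift_diff c d ^^ n) (shift_diff a b f)"
  by (induction n) (auto simp: shift_diff_commute[of a b])

lemma shift_diff_minus:
  fixes f :: "'i::ab_group_add \<Rightarrow> 'w::ab_group_add"
  shows "shift_diff a b (\<lambda>v. f v - g v) = (\<lambda>v. shift_diff a b f v - shift_diff a b g v)"
  by (simp add: shift_diff_def fun_eq_iff)

lemma shift_diff_funpow_minus:
  fixes f :: "'i::ab_group_add \<Rightarrow> 'w::ab_group_add"
  shows "(shift_diff a b ^^ n) (\<lambda>v. f v - g v) = (\<lambda>v. (shift_diff a b ^^ n) f v - (shift_diff a b ^^ n) g v)"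
  by (induction n) (auto simp: shift_diff_minus)

text \<open>A series killed by \<open>x_a - x_b\<close> is constant along \<open>b - a\<close>, like
  a delta function; vanishing far out in that direction then forces it to be zero.\<close>

lemma shift_diff_inj:
  fixes f :: "'i::ab_group_add \<Rightarrow> 'w::ab_group_add"
  assumes d: "d = b - a \<or> d = a - b"
    and f: "vanishes_along d f" and z: "\<And>v. shift_diff a b f v = 0"
  shows "f v = 0"
proof -
  have "f (v + d) = f v" for v
    using z[of "v - a"] z[of "v - b"] d by (auto simp: shift_diff_def algebra_simps)
  then have "f (v + zmul (int i) d) = f v" for i
    by (induction i) (auto simp: zmul_Suc add.assoc[symmetric] simp del: of_nat_Suc)
  moreover obtain k where "\<forall>i\<ge>k. f (v + zmul (int i) d) = 0"
    using f unfolding vanishes_along_def by meson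
  ultimately show ?thesis by (metis order_refl)
qed

text \<open>Upwards the recursion determines each member; downwards injectivity of
  \<open>x_a - x_b\<close> does. The sign of \<open>d\<close> records the region in which the
  members are expanded.\<close>

lemma family_unique:
  fixes F G :: "int \<Rightarrow> 'i::ab_group_add \<Rightarrow> 'w::ab_group_add"
  assumes F: "\<And>n v. shift_diff a b (F n) v = F (n + 1) v"
    and G: "\<And>n v. shift_diff a b (G n) v = G (n + 1) v"
    and d: "d = b - a \<or> d = a - b"
    and vF: "\<And>n. vanishes_along d (F n)" and vG: "\<And>n. vanishes_along d (G n)"
    and FG: "\<And>v. F m v = G m v"
  shows "F n v = G n v"
proof -
  have "\<forall>v. F n v = G n v"
  proof (induction n rule: int_induct[where k = m])
    case base
    then show ?case using FG by simp
  next
    case (step1 i)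
    then show ?case using F[of i] G[of i] by (simp add: shift_diff_def)
  next
    case (step2 i)
    have "F (i - 1) v - G (i - 1) v = 0" for v
    proof (rule shift_diff_inj[OF d])
      show "vanishes_along d (\<lambda>v. F (i - 1) v - G (i - 1) v)" by (intro vanishes_along_diff vF vG)
      show "shift_diff a b (\<lambda>v. F (i - 1) v - G (i - 1) v) v = 0" for v
        using F[of "i - 1" v] G[of "i - 1" v] step2 by (simp add: shift_diff_minus)
    qed
    then show ?case by simp
  qed
  then show ?thesis by simp
qed

locale complex_vector_space = vector_space scale
  for scale :: "complex \<Rightarrow> 'w::ab_group_add \<Rightarrow> 'w"
begin

text \<open>Multiplication by \<open>(x\<^sub>a - x\<^sub>b)^n\<close>, expanded for \<open>\<bar>x\<^sub>a\<bar> > \<bar>x\<^sub>b\<bar>\<close> in \<open>expand\<close> and for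
  \<open>\<bar>x\<^sub>b\<bar> > \<bar>x\<^sub>a\<bar>\<close> in \<open>expand_op\<close>. It is meaningful only if \<open>f\<close> vanishes along \<open>b - a\<close>
  (resp. \<open>a - b\<close>), since \<open>fsum\<close> is junk on infinite supports.\<close>

definition expand :: "'i::ab_group_add \<Rightarrow> 'i \<Rightarrow> int \<Rightarrow> ('i \<Rightarrow> 'w) \<Rightarrow> 'i \<Rightarrow> 'w" where
  "expand a b n f v =
     fsum (\<lambda>i. scale ((-1) ^ i * gbin n i) (f (v + zmul n a + zmul (int i) (b - a))))"

definition expand_op :: "'i::ab_group_add \<Rightarrow> 'i \<Rightarrow> int \<Rightarrow> ('i \<Rightarrow> 'w) \<Rightarrow> 'i \<Rightarrow> 'w" where
  "expand_op a b n f v = scale ((-1) powi n) (expand b a n f v)"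

lemma expand_0: "expand a b 0 f v = f v"
  unfolding expand_def by (subst fsum_first) (auto simp: gbin_zero_left)

lemma expand_eq_sum:
  assumes "\<And>i. i \<ge> k \<Longrightarrow> f (v + zmul n a + zmul (int i) (b - a)) = 0"
  shows "expand a b n f v =
    (\<Sum>i<k. scale ((-1) ^ i * gbin n i) (f (v + zmul n a + zmul (int i) (b - a))))"
  unfolding expand_def using assms by (intro fsum_eq_sum) auto

lemma expand_bound:
  assumes "vanishes_along (b - a) f"
  obtains k where "\<And>i. i \<ge> k \<Longrightarrow> f (v + zmul n a + zmul (int i) (b - a)) = 0"
  using assms unfolding vanishes_along_def by meson

text \<open>This is Pascal's rule with alternating signs. Later arguments about
  \<open>expand\<close> mostly use this recursion in place of the coefficients.\<close>

lemma expand_succ: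
  assumes f: "vanishes_along (b - a) f"
  shows "shift_diff a b (expand a b n f) v = expand a b (n + 1) f v"
proof -
  let ?d = "b - a"
  obtain k where k: "\<And>i. i \<ge> k \<Longrightarrow> f (v + zmul (n + 1) a + zmul (int i) ?d) = 0"
    using expand_bound[OF f] by metis
  have e1: "v + a + zmul n a + zmul (int i) ?d = v + zmul (n + 1) a + zmul (int i) ?d" for i
    unfolding zmul_add1 by (simp add: algebra_simps)
  \<comment> \<open>Shifting by \<open>b\<close> in place of \<open>a\<close> moves the summation
    index by one; hence the sum at \<open>v + b\<close> has one term fewer.\<close>
  have e2: "v + b + zmul n a + zmul (int i) ?d = v + zmul (n + 1) a + zmul (int (Suc i)) ?d" for i
    unfolding zmul_Suc zmul_add1 by (simp add: algebra_simps)
  define g where "g i = f (v + zmul (n + 1) a + zmul (int i) ?d)" for i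
  have "expand a b (n + 1) f v = (\<Sum>i<Suc k. scale ((-1) ^ i * gbin (n + 1) i) (g i))"
    unfolding g_def by (rule expand_eq_sum) (simp add: k)
  moreover have "expand a b n f (v + a) = (\<Sum>i<Suc k. scale ((-1) ^ i * gbin n i) (g i))"
    unfolding g_def e1[symmetric] by (rule expand_eq_sum) (simp add: k e1)
  moreover have "expand a b n f (v + b) = (\<Sum>i<k. scale ((-1) ^ i * gbin n i) (g (Suc i)))"
    unfolding g_def e2[symmetric] by (rule expand_eq_sum) (simp only: e2, rule k, simp)
  moreover have "scale ((-1) ^ Suc i * gbin (n + 1) (Suc i)) x =
      scale ((-1) ^ Suc i * gbin n (Suc i)) x - scale ((-1) ^ i * gbin n i) x" for i x
    unfolding gbin_pascal by (simp add: scale_left_distrib algebra_simps)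
  ultimately show ?thesis
    by (simp only: shift_diff_def sum.lessThan_Suc_shift sum_subtractf gbin_0) simp
qed

lemma expand_shift: "expand a b n (\<lambda>v. f (v + e)) v = expand a b n f (v + e)"
  unfolding expand_def by (simp add: algebra_simps)

lemma expand_hom:
  assumes f: "vanishes_along (b - a) f" and add: "\<And>x y. \<phi> (x + y) = \<phi> x + \<phi> y"
    and sc: "\<And>c x. \<phi> (scale c x) = scale c (\<phi> x)"
  shows "\<phi> (expand a b n f v) = expand a b n (\<lambda>v. \<phi> (f v)) v"
proof -
  obtain k where k: "\<And>i. i \<ge> k \<Longrightarrow> f (v + zmul n a + zmul (int i) (b - a)) = 0"
    using expand_bound[OF f] by metis
  show ?thesis unfolding expand_def
    by (subst fsum_hom[where k = k and \<phi> = \<phi>]) (auto simp: add sc k)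
qed

lemma expand_diff:
  assumes f: "vanishes_along (b - a) f" and g: "vanishes_along (b - a) g"
  shows "expand a b n (\<lambda>v. f v - g v) v = expand a b n f v - expand a b n g v"
proof -
  obtain k l where "\<And>i. i \<ge> k \<Longrightarrow> f (v + zmul n a + zmul (int i) (b - a)) = 0"
      "\<And>i. i \<ge> l \<Longrightarrow> g (v + zmul n a + zmul (int i) (b - a)) = 0"
    using expand_bound[OF f] expand_bound[OF g] by metis
  then show ?thesis
    by (simp add: expand_eq_sum[of "max k l"] sum_subtractf scale_right_diff_distrib)
qed

lemma expand_shift_diff:
  assumes f: "vanishes_along (b - a) f"
  shows "expand a b n (shift_diff c d f) v = shift_diff c d (expand a b n f) v"
  unfolding shift_diff_def
  by (subst expand_diff) (auto intro: vanishes_along_shift f simp: expand_shift)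

lemma vanishes_along_shift_diff_funpow:
  "vanishes_along d f \<Longrightarrow> vanishes_along d ((shift_diff a b ^^ n) f :: _ \<Rightarrow> 'w)"
  by (induction n) (auto intro: vanishes_along_shift_diff)

lemma expand_shift_diff_funpow:
  assumes f: "vanishes_along (b - a) f"
  shows "expand a b n ((shift_diff c d ^^ m) f) v = (shift_diff c d ^^ m) (expand a b n f) v"
proof (induction m arbitrary: v)
  case (Suc m)
  show ?case
    by (simp add: expand_shift_diff vanishes_along_shift_diff_funpow f)
       (simp add: ext[OF Suc])
qed simp

lemma expand_zero: "expand a b n (\<lambda>_. 0) v = 0"
  by (simp add: expand_def)

text \<open>For a nonnegative exponent the expansion is polynomial and depends on no region.
  Together with \<open>expand_op_nat\<close> this is how locality identifies expansions of opposite
  orderings.\<close>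

lemma expand_nat:
  assumes f: "vanishes_along (b - a) f"
  shows "expand a b (int n) f v = (shift_diff a b ^^ n) f v"
proof (induction n arbitrary: v)
  case (Suc n)
  have "expand a b (int n + 1) f v = shift_diff a b (expand a b (int n) f) v"
    by (simp add: expand_succ f)
  then show ?case by (simp add: shift_diff_def Suc add.commute)
qed (simp add: expand_0)

lemma expand_op_0: "expand_op a b 0 f v = f v"
  by (simp add: expand_op_def expand_0)

lemma expand_op_succ:
  assumes f: "vanishes_along (a - b) f"
  shows "shift_diff a b (expand_op a b n f) v = expand_op a b (n + 1) f v"
proof -
  have "(-1 :: complex) powi (n + 1) = - ((-1) powi n)"
    by (simp add: power_int_add)
  moreover have "expand b a n f (v + a) - expand b a n f (v + b) = - expand b a (n + 1) f v"
    using expand_succ[OF f, of n v] by (simp add: shift_diff_def algebra_simps)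
  ultimately show ?thesis
    unfolding expand_op_def shift_diff_def
    by (simp add: scale_right_diff_distrib[symmetric])
qed

lemma expand_op_hom:
  assumes f: "vanishes_along (a - b) f" and add: "\<And>x y. \<phi> (x + y) = \<phi> x + \<phi> y"
    and sc: "\<And>c x. \<phi> (scale c x) = scale c (\<phi> x)"
  shows "\<phi> (expand_op a b n f v) = expand_op a b n (\<lambda>v. \<phi> (f v)) v"
  unfolding expand_op_def using expand_hom[of a b f \<phi> n v] assms by simp

lemma expand_op_diff:
  assumes f: "vanishes_along (a - b) f" and g: "vanishes_along (a - b) g"
  shows "expand_op a b n (\<lambda>v. f v - g v) v = expand_op a b n f v - expand_op a b n g v"
  unfolding expand_op_def by (simp add: expand_diff assms scale_right_diff_distrib)

lemma expand_op_shift_diff: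
  assumes f: "vanishes_along (a - b) f"
  shows "expand_op a b n (shift_diff c d f) v = shift_diff c d (expand_op a b n f) v"
  unfolding expand_op_def by (simp add: expand_shift_diff f)
    (simp add: shift_diff_def scale_right_diff_distrib)

lemma expand_op_shift_diff_funpow:
  assumes f: "vanishes_along (a - b) f"
  shows "expand_op a b n ((shift_diff c d ^^ m) f) v = (shift_diff c d ^^ m) (expand_op a b n f) v"
proof (induction m arbitrary: v)
  case (Suc m)
  show ?case
    by (simp add: expand_op_shift_diff vanishes_along_shift_diff_funpow f)
       (simp add: ext[OF Suc])
qed simp

lemma expand_op_zero: "expand_op a b n (\<lambda>_. 0) v = 0"
  by (simp add: expand_op_def expand_zero)

lemma expand_op_nat:
  assumes f: "vanishes_along (a - b) f"
  shows "expand_op a b (int n) f v = (shift_diff a b ^^ n) f v"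
proof (induction n arbitrary: v)
  case (Suc n)
  have "expand_op a b (int n + 1) f v = shift_diff a b (expand_op a b (int n) f) v"
    by (simp add: expand_op_succ f)
  then show ?case by (simp add: shift_diff_def Suc add.commute)
qed (simp add: expand_op_0)

end

text \<open>\<open>truncated y z\<close> is the support condition of \<open>A(x) B(y) C(z) w\<close>, where \<open>C\<close> acts first;
  \<open>weakly_truncated y z\<close> is shared by both orders of the operators indexed by \<open>y\<close> and \<open>z\<close>.\<close>

definition truncated :: "('i \<Rightarrow> int) \<Rightarrow> ('i \<Rightarrow> int) \<Rightarrow> ('i \<Rightarrow> 'w::zero) \<Rightarrow> bool" where
  "truncated y z f \<longleftrightarrow> (\<exists>S. \<forall>v. z v \<ge> S \<longrightarrow> f v = 0) \<and>
     (\<forall>s. \<exists>Q. \<forall>v. z v \<ge> s \<and> y v \<ge> Q \<longrightarrow> f v = 0)"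

definition weakly_truncated :: "('i \<Rightarrow> int) \<Rightarrow> ('i \<Rightarrow> int) \<Rightarrow> ('i \<Rightarrow> 'w::zero) \<Rightarrow> bool" where
  "weakly_truncated y z f \<longleftrightarrow> (\<forall>s. \<exists>Q. \<forall>v. z v \<ge> s \<and> y v \<ge> Q \<longrightarrow> f v = 0) \<and>
     (\<forall>q. \<exists>S. \<forall>v. y v \<ge> q \<and> z v \<ge> S \<longrightarrow> f v = 0)"

definition additive_coord :: "('i::ab_group_add \<Rightarrow> int) \<Rightarrow> bool" where
  "additive_coord y \<longleftrightarrow> (\<forall>u v. y (u + v) = y u + y v)"

lemma additive_coord_add: "additive_coord y \<Longrightarrow> y (u + v) = y u + y v"
  by (simp add: additive_coord_def)

lemma additive_coord_zmul:
  assumes y: "additive_coord y"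
  shows "y (zmul n e) = n * y e"
proof -
  have z: "y 0 = 0" using additive_coord_add[OF y, of 0 0] by simp
  have "y (\<Sum>_<k. e) = int k * y e" for k :: nat
    by (induction k) (auto simp: z additive_coord_add[OF y] algebra_simps)
  moreover have "y (u - v) = y u - y v" for u v
    using additive_coord_add[OF y, of "u - v" v] by simp
  ultimately show ?thesis by (simp add: zmul_def)
qed

lemma truncated_weakly:
  "truncated y z f \<Longrightarrow> weakly_truncated y z f"
  "truncated z y f \<Longrightarrow> weakly_truncated y z f"
  unfolding truncated_def weakly_truncated_def by meson+

lemma weakly_truncated_diff:
  assumes "weakly_truncated y z f" "weakly_truncated y z g"
  shows "weakly_truncated y z (\<lambda>v. f v - g v :: 'w::ab_group_add)"
proof -
  have *: "\<exists>Q. \<forall>v. a v \<ge> s \<and> b v \<ge> Q \<longrightarrow> f v - g v = 0"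
    if f: "\<exists>Q. \<forall>v. a v \<ge> s \<and> b v \<ge> Q \<longrightarrow> f v = 0" and g: "\<exists>Q. \<forall>v. a v \<ge> s \<and> b v \<ge> Q \<longrightarrow> g v = 0"
    for a b :: "_ \<Rightarrow> int" and s
  proof -
    obtain Q where "\<forall>v. a v \<ge> s \<and> b v \<ge> Q \<longrightarrow> f v = 0" using f ..
    moreover obtain Q' where "\<forall>v. a v \<ge> s \<and> b v \<ge> Q' \<longrightarrow> g v = 0" using g ..
    ultimately show ?thesis by (intro exI[of _ "max Q Q'"]) simp
  qed
  show ?thesis using assms unfolding weakly_truncated_def by (intro conjI allI *) blast+
qed

text \<open>A direction that raises the innermost coordinate \<open>z\<close> runs into the absolute
  bound on \<open>z\<close>; one that keeps \<open>z\<close> and raises \<open>y\<close> runs into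
  the bound on \<open>y\<close> for that value of \<open>z\<close>.\<close>

lemma truncated_vanishes:
  assumes y: "additive_coord y" and z: "additive_coord z"
    and d: "z d \<ge> 1 \<or> z d = 0 \<and> y d \<ge> 1" and f: "truncated y z f"
  shows "vanishes_along d f"
  unfolding vanishes_along_def
proof
  fix v
  note [simp] = additive_coord_add[OF y] additive_coord_add[OF z]
    additive_coord_zmul[OF y] additive_coord_zmul[OF z]
  show "\<exists>k. \<forall>i\<ge>k. f (v + zmul (int i) d) = 0"
  proof (cases "z d \<ge> 1")
    case True
    obtain S where S: "\<And>v. z v \<ge> S \<Longrightarrow> f v = 0" using f unfolding truncated_def by blast
    have "f (v + zmul (int i) d) = 0" if "i \<ge> nat (S - z v)" for i
    proof (rule S)
      have "int i * 1 \<le> int i * z d" using True by (intro mult_left_mono) auto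
      then show "S \<le> z (v + zmul (int i) d)" using that by simp
    qed
    then show ?thesis by blast
  next
    case False
    then have d: "z d = 0" "y d \<ge> 1" using d by auto
    obtain Q where Q: "\<And>u. z u \<ge> z v \<Longrightarrow> y u \<ge> Q \<Longrightarrow> f u = 0"
      using f unfolding truncated_def by blast
    have "f (v + zmul (int i) d) = 0" if "i \<ge> nat (Q - y v)" for i
    proof (rule Q)
      have "int i * 1 \<le> int i * y d" using d by (intro mult_left_mono) auto
      then show "Q \<le> y (v + zmul (int i) d)" using that by simp
    qed (simp add: d)
    then show ?thesis by blast
  qed
qed

lemma weakly_truncated_vanishes:
  assumes y: "additive_coord y" and z: "additive_coord z"
    and d: "y d \<ge> 0" "z d \<ge> 0" "y d + z d \<ge> 1" and f: "weakly_truncated y z f"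
  shows "vanishes_along d f"
  unfolding vanishes_along_def
proof
  fix v
  have *: "\<exists>k. \<forall>i\<ge>k. f (v + zmul (int i) d) = 0"
    if a: "additive_coord a" and b: "additive_coord b" and ab: "a d \<ge> 1" "b d \<ge> 0"
      and ex: "\<exists>Q. \<forall>u. b u \<ge> b v \<and> a u \<ge> Q \<longrightarrow> f u = 0" for a b
  proof -
    note [simp] = additive_coord_add[OF a] additive_coord_add[OF b]
      additive_coord_zmul[OF a] additive_coord_zmul[OF b]
    obtain Q where Q: "\<And>u. b u \<ge> b v \<Longrightarrow> a u \<ge> Q \<Longrightarrow> f u = 0" using ex by blast
    have "f (v + zmul (int i) d) = 0" if "i \<ge> nat (Q - a v)" for i
    proof (rule Q)
      have "int i * 1 \<le> int i * a d" using ab by (intro mult_left_mono) auto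
      then show "Q \<le> a (v + zmul (int i) d)" using that by simp
    qed (simp add: ab)
    then show ?thesis by blast
  qed
  have "y d \<ge> 1 \<or> z d \<ge> 1" using d by linarith
  then show "\<exists>k. \<forall>i\<ge>k. f (v + zmul (int i) d) = 0"
    using *[of y z] *[of z y] y z d f unfolding weakly_truncated_def by blast
qed

section \<open>Truncation under expansion, and commuting expansions\<close>

context complex_vector_space
begin

lemma truncated_scale: "truncated y z f \<Longrightarrow> truncated y z (\<lambda>v. scale c (f v))"
  unfolding truncated_def by (metis scale_zero_right)

lemma expand_eq_0:
  assumes "\<And>i. f (v + zmul n a + zmul (int i) (b - a)) = 0"
  shows "expand a b n f v = 0"
  unfolding expand_def using assms by simp

lemma truncated_expand:
  assumes y: "additive_coord y" and z: "additive_coord z"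
    and d: "z (b - a) \<ge> 1 \<or> z (b - a) = 0 \<and> y (b - a) \<ge> 0" and f: "truncated y z f"
  shows "truncated y z (expand a b n f)"
proof -
  let ?d = "b - a"
  note [simp] = additive_coord_add[OF y] additive_coord_add[OF z]
    additive_coord_zmul[OF y] additive_coord_zmul[OF z]
  obtain S where S: "\<And>v. z v \<ge> S \<Longrightarrow> f v = 0" using f unfolding truncated_def by blast
  have zd: "z ?d \<ge> 0" using d by linarith
  have "expand a b n f v = 0" if "z v \<ge> S - n * z a" for v
    by (rule expand_eq_0, rule S) (use that zd in \<open>simp add: add_increasing2\<close>)
  moreover have "\<exists>Q. \<forall>v. z v \<ge> s \<and> y v \<ge> Q \<longrightarrow> expand a b n f v = 0" for s
  proof -
    obtain Q where Q: "\<And>v. z v \<ge> s + n * z a \<Longrightarrow> y v \<ge> Q \<Longrightarrow> f v = 0"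
      using f unfolding truncated_def by blast
    show ?thesis
    proof (cases "z ?d \<ge> 1")
      case True
      \<comment> \<open>For indices \<open>i \<ge> K\<close> the innermost coordinate already
        exceeds \<open>S\<close>. The remaining terms shift the \<open>y\<close>-coordinate by at
        most \<open>K\<close> times the absolute value of \<open>y ?d\<close>, which the bound below
        absorbs.\<close>
      define K where "K = \<bar>S - s - n * z a\<bar>"
      have "expand a b n f v = 0" if v: "z v \<ge> s" "y v \<ge> Q - n * y a + K * \<bar>y ?d\<bar>" for v
      proof (rule expand_eq_0)
        fix i
        have i: "int i * 1 \<le> int i * z ?d" using True by (intro mult_left_mono) auto
        show "f (v + zmul n a + zmul (int i) ?d) = 0"
        proof (cases "int i \<ge> K")
          case True
          then show ?thesis using i v by (intro S) (simp add: K_def)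
        next
          case False
          have "- (int i * y ?d) \<le> int i * \<bar>y ?d\<bar>"
            by (metis abs_ge_minus_self abs_mult abs_of_nat)
          also have "\<dots> \<le> K * \<bar>y ?d\<bar>" using False by (intro mult_right_mono) auto
          finally show ?thesis using i v by (intro Q) simp_all
        qed
      qed
      then show ?thesis by blast
    next
      case False
      then have d: "z ?d = 0" "y ?d \<ge> 0" using d by auto
      have "expand a b n f v = 0" if v: "z v \<ge> s" "y v \<ge> Q - n * y a" for v
        by (rule expand_eq_0, rule Q) (use d v in \<open>simp_all add: add_increasing2\<close>)
      then show ?thesis by blast
    qed
  qed
  ultimately show ?thesis unfolding truncated_def by blast
qed

lemma truncated_expand_op:
  assumes "additive_coord y" "additive_coord z"
    and "z (a - b) \<ge> 1 \<or> z (a - b) = 0 \<and> y (a - b) \<ge> 0" and "truncated y z f"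
  shows "truncated y z (expand_op a b n f)"
  unfolding expand_op_def using assms by (intro truncated_scale truncated_expand)

lemma weakly_truncated_expand:
  assumes y: "additive_coord y" and z: "additive_coord z"
    and d: "y (b - a) \<ge> 0" "z (b - a) \<ge> 0" and f: "weakly_truncated y z f"
  shows "weakly_truncated y z (expand a b n f)"
proof -
  have *: "\<exists>Q. \<forall>v. a' v \<ge> s \<and> b' v \<ge> Q \<longrightarrow> expand a b n f v = 0"
    if a': "additive_coord a'" and b': "additive_coord b'"
      and ab: "a' (b - a) \<ge> 0" "b' (b - a) \<ge> 0"
      and ex: "\<forall>s. \<exists>Q. \<forall>v. a' v \<ge> s \<and> b' v \<ge> Q \<longrightarrow> f v = 0" for a' b' s
  proof -
    note [simp] = additive_coord_add[OF a'] additive_coord_add[OF b']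
      additive_coord_zmul[OF a'] additive_coord_zmul[OF b']
    obtain Q where Q: "\<And>v. a' v \<ge> s + n * a' a \<Longrightarrow> b' v \<ge> Q \<Longrightarrow> f v = 0" using ex by blast
    have "expand a b n f v = 0" if "a' v \<ge> s" "b' v \<ge> Q - n * b' a" for v
      by (rule expand_eq_0, rule Q) (use that ab in \<open>simp_all add: add_increasing2\<close>)
    then show ?thesis by blast
  qed
  show ?thesis using *[of z y] *[of y z] y z d f unfolding weakly_truncated_def by blast
qed

text \<open>Both sides are families in \<open>n\<close> obeying the same recursion, and at
  \<open>n = 0\<close> there is nothing to commute.\<close>

lemma expand_commute:
  assumes y: "additive_coord y" and z: "additive_coord z" and f: "truncated y z f"
    and ab: "z (b - a) \<ge> 1 \<or> z (b - a) = 0 \<and> y (b - a) \<ge> 1"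
    and cd: "z (d - c) \<ge> 1 \<or> z (d - c) = 0 \<and> y (d - c) \<ge> 1"
  shows "expand a b n (expand c d m f) v = expand c d m (expand a b n f) v"
proof (rule family_unique[where F = "\<lambda>n. expand a b n (expand c d m f)"
      and G = "\<lambda>n. expand c d m (expand a b n f)" and m = 0 and a = a and b = b and d = "b - a"])
  have t: "truncated y z (expand a b n f)" "truncated y z (expand c d m f)" for n m
    using ab cd by (auto intro!: truncated_expand y z f)
  have v1: "vanishes_along (b - a) g" if "truncated y z g" for g :: "_ \<Rightarrow> 'w"
    using truncated_vanishes[OF y z ab that] .
  have v2: "vanishes_along (d - c) g" if "truncated y z g" for g :: "_ \<Rightarrow> 'w"
    using truncated_vanishes[OF y z cd that] .
  show "shift_diff a b (expand a b n (expand c d m f)) v = expand a b (n + 1) (expand c d m f) v" for n v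
    by (rule expand_succ) (intro v1 t)
  have s: "shift_diff a b (expand a b n f) = expand a b (n + 1) f" for n
    using expand_succ[OF v1[OF f]] by blast
  show "shift_diff a b (expand c d m (expand a b n f)) v = expand c d m (expand a b (n + 1) f) v" for n v
    by (subst expand_shift_diff[symmetric]) (auto intro: v2 t simp: s)
  show "vanishes_along (b - a) (expand a b n (expand c d m f))" for n
    using ab by (intro v1 truncated_expand y z t) auto
  show "vanishes_along (b - a) (expand c d m (expand a b n f))" for n
    using cd by (intro v1 truncated_expand y z t) auto
  have "expand a b 0 g = g" for g :: "_ \<Rightarrow> 'w" by (auto simp: expand_0)
  then show "expand a b 0 (expand c d m f) v = expand c d m (expand a b 0 f) v" for v by simp
qed simp

lemma expand_scale:
  assumes f: "vanishes_along (b - a) f"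
  shows "expand a b n (\<lambda>v. scale c (f v)) v = scale c (expand a b n f v)"
  using expand_hom[OF f, of "scale c" n v]
  by (simp add: scale_right_distrib scale_left_commute)

lemma expand_expand_op_commute:
  assumes y: "additive_coord y" and z: "additive_coord z" and f: "truncated y z f"
    and ab: "z (b - a) \<ge> 1 \<or> z (b - a) = 0 \<and> y (b - a) \<ge> 1"
    and cd: "z (c - d) \<ge> 1 \<or> z (c - d) = 0 \<and> y (c - d) \<ge> 1"
  shows "expand a b n (expand_op c d m f) v = expand_op c d m (expand a b n f) v"
proof -
  have "vanishes_along (b - a) (expand d c m f)"
    using cd by (intro truncated_vanishes[OF y z ab] truncated_expand y z f) auto
  then show ?thesis
    unfolding expand_op_def using expand_commute[OF y z f ab cd] by (simp add: expand_scale)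
qed

lemma expand_op_commute:
  assumes y: "additive_coord y" and z: "additive_coord z" and f: "truncated y z f"
    and ab: "z (a - b) \<ge> 1 \<or> z (a - b) = 0 \<and> y (a - b) \<ge> 1"
    and cd: "z (c - d) \<ge> 1 \<or> z (c - d) = 0 \<and> y (c - d) \<ge> 1"
  shows "expand_op a b n (expand_op c d m f) v = expand_op c d m (expand_op a b n f) v"
proof -
  have *: "expand b a n (expand_op c d m f) = expand_op c d m (expand b a n f)"
    using expand_expand_op_commute[OF y z f ab cd] by blast
  have "vanishes_along (c - d) (expand b a n f)"
    using ab by (intro truncated_vanishes[OF y z cd] truncated_expand y z f) auto
  then show ?thesis
    unfolding expand_op_def[of a b] using expand_op_hom[of c d "expand b a n f" "scale ((-1) powi n)" m v]
    by (simp add: * scale_right_distrib scale_left_commute)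
qed

text \<open>The left side of the Borcherds identity, where \<open>H n r\<close> stands for the mode \<open>r\<close> of the
  \<open>n\<close>-th product.\<close>

definition iterate_sum :: "(int \<Rightarrow> int \<Rightarrow> 'w) \<Rightarrow> int \<Rightarrow> int \<Rightarrow> int \<Rightarrow> 'w" where
  "iterate_sum H p q n = fsum (\<lambda>j. scale (gbin p j) (H (n + int j) (p + q - int j)))"

lemma iterate_sum_zero_left: "iterate_sum H 0 q n = H n q"
  unfolding iterate_sum_def by (subst fsum_first) (auto simp: gbin_zero_left)

lemma iterate_sum_eq_0:
  assumes "\<And>n r. n \<ge> N \<Longrightarrow> H n r = 0" "n \<ge> N"
  shows "iterate_sum H p q n = 0"
  unfolding iterate_sum_def using assms by simp

text \<open>The same recursion that \<open>expand\<close> satisfies in its pair of indices, so that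
  both sides of the Borcherds identity can be compared by \<open>descent_zero\<close>. The bound
  \<open>N\<close> makes all sums finite.\<close>

lemma iterate_sum_pascal:
  assumes H: "\<And>n r. n \<ge> N \<Longrightarrow> H n r = 0"
  shows "iterate_sum H (p + 1) q n - iterate_sum H p (q + 1) n = iterate_sum H p q (n + 1)"
proof -
  define k where "k = nat (N - n)"
  define g where "g j = H (n + int j) (p + 1 + q - int j)" for j
  have g0: "g j = 0" if "j \<ge> k" for j unfolding g_def k_def using that k_def by (intro H) linarith
  have "iterate_sum H (p + 1) q n = (\<Sum>j<Suc k. scale (gbin (p + 1) j) (g j))"
    unfolding iterate_sum_def g_def[symmetric] by (rule fsum_eq_sum) (simp add: g0)
  moreover have "iterate_sum H p (q + 1) n = (\<Sum>j<Suc k. scale (gbin p j) (g j))"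
  proof -
    have e: "H (n + int j) (p + (q + 1) - int j) = g j" for j by (simp add: g_def algebra_simps)
    show ?thesis unfolding iterate_sum_def e by (rule fsum_eq_sum) (simp add: g0)
  qed
  moreover have "iterate_sum H p q (n + 1) = (\<Sum>j<k. scale (gbin p j) (g (Suc j)))"
  proof -
    have e: "H (n + 1 + int j) (p + q - int j) = g (Suc j)" for j by (simp add: g_def algebra_simps)
    show ?thesis unfolding iterate_sum_def e by (rule fsum_eq_sum) (simp add: g0)
  qed
  ultimately show ?thesis
    unfolding sum.lessThan_Suc_shift gbin_pascal
    by (simp add: scale_left_distrib sum.distrib)
qed

end

text \<open>The family \<open>K p q n\<close> stands for the coefficients of a formal series multiplied by
  \<open>x^p y^q (x - y)^n\<close>.\<close>

lemma descent_zero: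
  fixes K :: "int \<Rightarrow> int \<Rightarrow> int \<Rightarrow> 'w::ab_group_add"
  assumes rec: "\<And>p q n. K (p + 1) q n - K p (q + 1) n = K p q (n + 1)"
    and N: "\<And>p q n. n \<ge> N \<Longrightarrow> K p q n = 0" and p0: "\<And>q n. K p0 q n = 0"
  shows "K p q n = 0"
proof -
  have "\<forall>q n. K p q n = 0"
  proof (induction p rule: int_induct[where k = p0])
    case base
    then show ?case by (simp add: p0)
  next
    case (step1 i)
    then show ?case using rec[of i] by simp
  next
    case (step2 i)
    \<comment> \<open>With level \<open>i\<close> zero the recursion reads
      \<open>K (i - 1) (q + 1) n = - K (i - 1) q (n + 1)\<close>, so vanishing for large
      \<open>n\<close> descends to all \<open>n\<close>.\<close>
    have "\<forall>q. K (i - 1) q n = 0" if "n \<le> N" for n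
      using that
    proof (induction n rule: int_le_induct)
      case base
      then show ?case by (simp add: N)
    next
      case (step n)
      then show ?case using step2 rec[of "i - 1" "q - 1" "n - 1" for q] by simp
    qed
    then show ?case using N by (metis linear)
  qed
  then show ?thesis by simp
qed

section \<open>Triple products of mutually local fields\<close>

abbreviation "u1 \<equiv> (1, 0) :: int \<times> int"
abbreviation "u2 \<equiv> (0, 1) :: int \<times> int"
abbreviation "e1 \<equiv> (1, 0, 0) :: int \<times> int \<times> int"
abbreviation "e2 \<equiv> (0, 1, 0) :: int \<times> int \<times> int"
abbreviation "e3 \<equiv> (0, 0, 1) :: int \<times> int \<times> int"
abbreviation "cx \<equiv> (\<lambda>v. fst v) :: int \<times> int \<times> int \<Rightarrow> int"
abbreviation "cy \<equiv> (\<lambda>v. fst (snd v)) :: int \<times> int \<times> int \<Rightarrow> int"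
abbreviation "cz \<equiv> (\<lambda>v. snd (snd v)) :: int \<times> int \<times> int \<Rightarrow> int"

lemma diff_cross: "(a - a') - (b - b') = (a - b) - (a' - b' :: 'w::ab_group_add)"
  by (simp add: algebra_simps)

lemma additive_coords: "additive_coord cx" "additive_coord cy" "additive_coord cz"
  by (simp_all add: additive_coord_def)

lemma shift_diff_funpow_eq_0_mono:
  fixes f :: "'i::ab_group_add \<Rightarrow> 'w::ab_group_add"
  assumes "\<And>v. (shift_diff a b ^^ N) f v = 0" "n \<ge> N"
  shows "(shift_diff a b ^^ n) f v = 0"
proof -
  have "(shift_diff a b ^^ k) (\<lambda>_. 0 :: 'w) = (\<lambda>_. 0)" for k
    by (induction k) (auto simp: shift_diff_def)
  moreover have "(shift_diff a b ^^ n) f = (shift_diff a b ^^ (n - N)) ((shift_diff a b ^^ N) f)"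
    using assms(2) by (metis funpow_add o_apply le_add_diff_inverse2)
  moreover have "(shift_diff a b ^^ N) f = (\<lambda>_. 0)" using assms(1) by blast
  ultimately show ?thesis by simp
qed

lemma shift_diff_funpow_eq_mono:
  fixes f g :: "'i::ab_group_add \<Rightarrow> 'w::ab_group_add"
  assumes "\<And>v. (shift_diff a b ^^ N) f v = (shift_diff a b ^^ N) g v" "n \<ge> N"
  shows "(shift_diff a b ^^ n) f = (shift_diff a b ^^ n) g"
  using shift_diff_funpow_eq_0_mono[of N a b "\<lambda>v. f v - g v" n] assms
  by (auto simp: shift_diff_funpow_minus fun_eq_iff)

context complex_vector_space
begin

lemma expand_succ_fun:
  "vanishes_along (b - a) f \<Longrightarrow> shift_diff a b (expand a b n f) = expand a b (n + 1) f"
  by (auto simp: expand_succ)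

lemma expand_op_succ_fun:
  "vanishes_along (a - b) f \<Longrightarrow> shift_diff a b (expand_op a b n f) = expand_op a b (n + 1) f"
  by (auto simp: expand_op_succ)

lemma shift_diff_expand:
  "vanishes_along (b - a) f \<Longrightarrow> shift_diff c d (expand a b n f) = expand a b n (shift_diff c d f)"
  by (auto simp: expand_shift_diff)

lemma shift_diff_expand_op:
  "vanishes_along (a - b) f \<Longrightarrow> shift_diff c d (expand_op a b n f) = expand_op a b n (shift_diff c d f)"
  by (auto simp: expand_op_shift_diff)

lemma shift_diff_funpow_expand:
  "vanishes_along (b - a) f \<Longrightarrow>
    (shift_diff c d ^^ m) (expand a b n f) = expand a b n ((shift_diff c d ^^ m) f)"
  by (rule ext) (simp add: expand_shift_diff_funpow)

lemma shift_diff_funpow_expand_op: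
  "vanishes_along (a - b) f \<Longrightarrow>
    (shift_diff c d ^^ m) (expand_op a b n f) = expand_op a b n ((shift_diff c d ^^ m) f)"
  by (rule ext) (simp add: expand_op_shift_diff_funpow)

end

text \<open>For three fields \<open>A, B, C\<close> and a vector \<open>w\<close>, the function \<open>ABC\<close> is
  \<open>(p, q, s) \<mapsto> A p (B q (C s w))\<close>, and similarly for the other orders; the index of \<open>A\<close> always
  comes first, that of \<open>C\<close> last.\<close>

locale triple_products = complex_vector_space scale
  for scale :: "complex \<Rightarrow> 'w::ab_group_add \<Rightarrow> 'w" +
  fixes ABC ACB BAC BCA CAB CBA :: "int \<times> int \<times> int \<Rightarrow> 'w" and N :: nat
  assumes tABC: "truncated cy cz ABC" and tACB: "truncated cz cy ACB"
    and tBAC: "truncated cx cz BAC" and tBCA: "truncated cz cx BCA"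
    and tCAB: "truncated cx cy CAB" and tCBA: "truncated cy cx CBA"
    and AB_C: "\<And>v. (shift_diff e1 e2 ^^ N) ABC v = (shift_diff e1 e2 ^^ N) BAC v"
    and C_AB: "\<And>v. (shift_diff e1 e2 ^^ N) CAB v = (shift_diff e1 e2 ^^ N) CBA v"
    and A_BC: "\<And>v. (shift_diff e2 e3 ^^ N) ABC v = (shift_diff e2 e3 ^^ N) ACB v"
    and BC_A: "\<And>v. (shift_diff e2 e3 ^^ N) BCA v = (shift_diff e2 e3 ^^ N) CBA v"
    and AC_B: "\<And>v. (shift_diff e1 e3 ^^ N) ACB v = (shift_diff e1 e3 ^^ N) CAB v"
    and B_AC: "\<And>v. (shift_diff e1 e3 ^^ N) BAC v = (shift_diff e1 e3 ^^ N) BCA v"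
begin

abbreviation "exy \<equiv> expand e1 e2"
abbreviation "exz \<equiv> expand e1 e3"
abbreviation "eyz \<equiv> expand e2 e3"
abbreviation "fxy \<equiv> expand_op e1 e2"
abbreviation "fxz \<equiv> expand_op e1 e3"
abbreviation "fyz \<equiv> expand_op e2 e3"
abbreviation "Dxy \<equiv> shift_diff e1 e2 :: (_ \<Rightarrow> 'w) \<Rightarrow> _"
abbreviation "Dxz \<equiv> shift_diff e1 e3 :: (_ \<Rightarrow> 'w) \<Rightarrow> _"
abbreviation "Dyz \<equiv> shift_diff e2 e3 :: (_ \<Rightarrow> 'w) \<Rightarrow> _"

lemmas trunc = tABC tACB tBAC tBCA tCAB tCBA

text \<open>Each ordering is paired with the expansions of the region in which outer operators have
  the larger variable: for \<open>ABC\<close> it is x, y, z in decreasing size, for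
  \<open>CBA\<close> the reverse.\<close>

lemma truncated_closed:
  "truncated cy cz f \<Longrightarrow> truncated cy cz (exy n f)"
  "truncated cy cz f \<Longrightarrow> truncated cy cz (eyz n f)"
  "truncated cy cz f \<Longrightarrow> truncated cy cz (exz n f)"
  "truncated cz cy f \<Longrightarrow> truncated cz cy (exy n f)"
  "truncated cz cy f \<Longrightarrow> truncated cz cy (fyz n f)"
  "truncated cz cy f \<Longrightarrow> truncated cz cy (exz n f)"
  "truncated cx cz f \<Longrightarrow> truncated cx cz (fxy n f)"
  "truncated cx cz f \<Longrightarrow> truncated cx cz (eyz n f)"
  "truncated cx cz f \<Longrightarrow> truncated cx cz (exz n f)"
  "truncated cz cx f \<Longrightarrow> truncated cz cx (fxy n f)"
  "truncated cz cx f \<Longrightarrow> truncated cz cx (eyz n f)"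
  "truncated cz cx f \<Longrightarrow> truncated cz cx (fxz n f)"
  "truncated cx cy f \<Longrightarrow> truncated cx cy (exy n f)"
  "truncated cx cy f \<Longrightarrow> truncated cx cy (fyz n f)"
  "truncated cx cy f \<Longrightarrow> truncated cx cy (fxz n f)"
  "truncated cy cx f \<Longrightarrow> truncated cy cx (fxy n f)"
  "truncated cy cx f \<Longrightarrow> truncated cy cx (fyz n f)"
  "truncated cy cx f \<Longrightarrow> truncated cy cx (fxz n f)"
  by (auto intro!: truncated_expand truncated_expand_op additive_coords)

lemma truncated_vanish:
  "truncated cy cz f \<Longrightarrow> vanishes_along (e2 - e1) f"
  "truncated cy cz f \<Longrightarrow> vanishes_along (e3 - e1) f"
  "truncated cy cz f \<Longrightarrow> vanishes_along (e3 - e2) f"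
  "truncated cz cy f \<Longrightarrow> vanishes_along (e2 - e1) f"
  "truncated cz cy f \<Longrightarrow> vanishes_along (e3 - e1) f"
  "truncated cz cy f \<Longrightarrow> vanishes_along (e2 - e3) f"
  "truncated cx cz f \<Longrightarrow> vanishes_along (e1 - e2) f"
  "truncated cx cz f \<Longrightarrow> vanishes_along (e3 - e1) f"
  "truncated cx cz f \<Longrightarrow> vanishes_along (e3 - e2) f"
  "truncated cz cx f \<Longrightarrow> vanishes_along (e1 - e2) f"
  "truncated cz cx f \<Longrightarrow> vanishes_along (e1 - e3) f"
  "truncated cz cx f \<Longrightarrow> vanishes_along (e3 - e2) f"
  "truncated cx cy f \<Longrightarrow> vanishes_along (e2 - e1) f"
  "truncated cx cy f \<Longrightarrow> vanishes_along (e1 - e3) f"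
  "truncated cx cy f \<Longrightarrow> vanishes_along (e2 - e3) f"
  "truncated cy cx f \<Longrightarrow> vanishes_along (e1 - e2) f"
  "truncated cy cx f \<Longrightarrow> vanishes_along (e1 - e3) f"
  "truncated cy cx f \<Longrightarrow> vanishes_along (e2 - e3) f"
  by (auto elim!: truncated_vanishes[rotated 3] simp: additive_coords)

lemmas vanish_simps = truncated_vanish[simplified] truncated_closed trunc

text \<open>At the index \<open>(0, 0, s)\<close>, \<open>Theta n r\<close> is the mode \<open>s\<close> of \<open>(A\<^sub>n B)\<^sub>r C\<close> on \<open>w\<close>, \<open>Xi P Q\<close>
  that of \<open>A\<^sub>P (B\<^sub>Q C)\<close>, and \<open>Xi' P Q\<close> that of \<open>B\<^sub>Q (A\<^sub>P C)\<close>. The parts \<open>Th1\<close>, \<open>Xi1\<close> collect the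
  orders with \<open>x\<close> outside \<open>y\<close>, resp. outside \<open>z\<close>.\<close>

definition "Th1 n r v = eyz r (exy n ABC) v - fyz r (exy n CAB) v"
definition "Th2 n r v = eyz r (fxy n BAC) v - fyz r (fxy n CBA) v"
definition "Xi1 P Q v = exz P (\<lambda>v. eyz Q ABC v - fyz Q ACB v) v"
definition "Xi2 P Q v = fxz P (\<lambda>v. eyz Q BCA v - fyz Q CBA v) v"

definition Theta :: "int \<Rightarrow> int \<Rightarrow> int \<times> int \<times> int \<Rightarrow> 'w" where
  "Theta n r v = Th1 n r v - Th2 n r v"
definition Xi :: "int \<Rightarrow> int \<Rightarrow> int \<times> int \<times> int \<Rightarrow> 'w" where
  "Xi P Q v = Xi1 P Q v - Xi2 P Q v"
definition Xi' :: "int \<Rightarrow> int \<Rightarrow> int \<times> int \<times> int \<Rightarrow> 'w" where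
  "Xi' P Q v = (eyz Q (exz P BAC) v - eyz Q (fxz P BCA) v) - (fyz Q (exz P ACB) v - fyz Q (fxz P CAB) v)"

lemma Xi1_split: "Xi1 P Q v = exz P (eyz Q ABC) v - exz P (fyz Q ACB) v"
  unfolding Xi1_def by (rule expand_diff) (simp_all add: vanish_simps)

lemma Xi2_split: "Xi2 P Q v = fxz P (eyz Q BCA) v - fxz P (fyz Q CBA) v"
  unfolding Xi2_def by (rule expand_op_diff) (simp_all add: vanish_simps)

lemma Th_steps:
  "Dxy (Th1 n r) = Th1 (n + 1) r" "Dyz (Th1 n r) = Th1 n (r + 1)"
  "Dxy (Th2 n r) = Th2 (n + 1) r" "Dyz (Th2 n r) = Th2 n (r + 1)"
  unfolding Th1_def[abs_def] Th2_def[abs_def] shift_diff_minus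
  by (simp_all add: expand_succ_fun expand_op_succ_fun shift_diff_expand[where a = e2 and b = e3 and c = e1 and d = e2]
      shift_diff_expand_op[of e2 e3 _ e1 e2] vanish_simps)

lemma Xi1_steps: "Dxz (Xi1 P Q) = Xi1 (P + 1) Q" "Dyz (Xi1 P Q) = Xi1 P (Q + 1)"
  unfolding Xi1_split[abs_def] shift_diff_minus
  by (simp_all add: expand_succ_fun expand_op_succ_fun shift_diff_expand[where a = e1 and b = e3 and c = e2 and d = e3] vanish_simps)

lemma Xi2_steps: "Dxz (Xi2 P Q) = Xi2 (P + 1) Q" "Dyz (Xi2 P Q) = Xi2 P (Q + 1)"
  unfolding Xi2_split[abs_def] shift_diff_minus
  by (simp_all add: expand_succ_fun expand_op_succ_fun shift_diff_expand_op[of e1 e3 _ e2 e3] vanish_simps)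

lemma Xi'_steps: "Dxz (Xi' P Q) = Xi' (P + 1) Q" "Dyz (Xi' P Q) = Xi' P (Q + 1)"
  unfolding Xi'_def[abs_def] shift_diff_minus
  by (simp_all add: expand_succ_fun expand_op_succ_fun shift_diff_expand[where a = e2 and b = e3 and c = e1 and d = e3]
      shift_diff_expand_op[of e2 e3 _ e1 e3] vanish_simps)

lemma Theta_steps: "Dxy (Theta n r) = Theta (n + 1) r" "Dyz (Theta n r) = Theta n (r + 1)"
  unfolding Theta_def[abs_def] shift_diff_minus by (simp_all add: Th_steps)

lemma Xi_steps: "Dxz (Xi P Q) = Xi (P + 1) Q" "Dyz (Xi P Q) = Xi P (Q + 1)"
  unfolding Xi_def[abs_def] shift_diff_minus by (simp_all add: Xi1_steps Xi2_steps)

text \<open>From exponent \<open>N\<close> on, both expansions are polynomial multiples, which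
  locality makes equal. All the vanishing statements for \<open>Theta\<close>, \<open>Xi1\<close>,
  \<open>Xi2\<close> and \<open>Xi'\<close> below come from this.\<close>

lemma expand_agree:
  assumes eq: "\<And>v. (shift_diff a b ^^ N) f v = (shift_diff a b ^^ N) g v" and n: "n \<ge> int N"
    and f: "vanishes_along (b - a) f" and g: "vanishes_along (a - b) g"
  shows "expand a b n f v = expand_op a b n g v"
proof -
  have "(shift_diff a b ^^ nat n) f = (shift_diff a b ^^ nat n) g"
    using eq n by (intro shift_diff_funpow_eq_mono[of N]) auto
  then show ?thesis
    using n expand_nat[OF f, of "nat n" v] expand_op_nat[OF g, of "nat n" v] by simp
qed

lemma Theta_eq_0: "Theta n r v = 0" if n: "n \<ge> int N"
proof -
  have "exy n ABC = fxy n BAC" "exy n CAB = fxy n CBA"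
    by (rule ext, rule expand_agree[OF _ n]; simp add: AB_C C_AB vanish_simps)+
  then show ?thesis by (simp add: Theta_def Th1_def Th2_def)
qed

lemma Xi1_eq_0: "Xi1 P Q v = 0" if Q: "Q \<ge> int N"
proof -
  have "eyz Q ABC = fyz Q ACB"
    by (rule ext, rule expand_agree[OF _ Q]; simp add: A_BC vanish_simps)
  then show ?thesis by (simp add: Xi1_def expand_zero)
qed

lemma Xi2_eq_0: "Xi2 P Q v = 0" if Q: "Q \<ge> int N"
proof -
  have "eyz Q BCA = fyz Q CBA"
    by (rule ext, rule expand_agree[OF _ Q]; simp add: BC_A vanish_simps)
  then show ?thesis by (simp add: Xi2_def expand_op_zero)
qed

lemma Xi'_eq_0: "Xi' P Q v = 0" if P: "P \<ge> int N"
proof -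
  have "exz P BAC = fxz P BCA" "exz P ACB = fxz P CAB"
    by (rule ext, rule expand_agree[OF _ P]; simp add: B_AC AC_B vanish_simps)+
  then show ?thesis by (simp add: Xi'_def)
qed

text \<open>The commutator of \<open>A\<^sub>P\<close> and \<open>B\<^sub>Q\<close> on \<open>C\<close>. Multiplying it by \<open>(x - z) - (y - z) = x - y\<close> is the
  same as applying \<open>shift_diff\<close> to the indices \<open>(P, Q)\<close>, so locality passes to these operators.\<close>

definition "Zeta P Q v = Xi P Q v - Xi' P Q v"

lemma Zeta_steps: "Dxz (Zeta P Q) = Zeta (P + 1) Q" "Dyz (Zeta P Q) = Zeta P (Q + 1)"
  unfolding Zeta_def[abs_def] shift_diff_minus by (simp_all add: Xi_steps Xi'_steps)

text \<open>Of the eight terms of \<open>Xi - Xi'\<close>, those with \<open>ACB\<close> and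
  \<open>BCA\<close> occur in both and cancel because the expansions commute. The others pair up by
  exchanging A and B, ready for locality of these two.\<close>

lemma Zeta_split:
  "Zeta P Q v = (exz P (eyz Q ABC) v - exz P (eyz Q BAC) v) - (fxz P (fyz Q CAB) v - fxz P (fyz Q CBA) v)"
proof -
  have "exz P (eyz Q BAC) v = eyz Q (exz P BAC) v"
    by (rule expand_commute[OF _ _ tBAC]) (simp_all add: additive_coords)
  moreover have "eyz Q (fxz P BCA) v = fxz P (eyz Q BCA) v"
    by (rule expand_expand_op_commute[OF _ _ tBCA]) (simp_all add: additive_coords)
  moreover have "exz P (fyz Q ACB) v = fyz Q (exz P ACB) v"
    by (rule expand_expand_op_commute[OF _ _ tACB]) (simp_all add: additive_coords)
  moreover have "fyz Q (fxz P CAB) v = fxz P (fyz Q CAB) v"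
    by (rule expand_op_commute[OF _ _ tCAB]) (simp_all add: additive_coords)
  ultimately show ?thesis
    unfolding Zeta_def Xi_def Xi1_split Xi2_split Xi'_def by (simp add: algebra_simps)
qed

lemma Zeta_local: "(Dxy ^^ N) (Zeta P Q) v = 0"
proof -
  have 3: "(Dxy ^^ N) ABC = (Dxy ^^ N) BAC" "(Dxy ^^ N) CAB = (Dxy ^^ N) CBA"
    using AB_C C_AB by auto
  show ?thesis
    unfolding Zeta_split[abs_def] shift_diff_funpow_minus
    by (simp add: shift_diff_funpow_expand shift_diff_funpow_expand_op 3 vanish_simps)
qed

section \<open>Weak associativity and the Borcherds identity\<close>

lemma funpow_Dxz_agree:
  assumes "\<And>v. (Dxz ^^ N) f v = (Dxz ^^ N) g v"
    and "vanishes_along (e2 - e3) f" "vanishes_along (e2 - e3) g"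
  shows "(Dxz ^^ N) (fyz Q f) = (Dxz ^^ N) (fyz Q g)"
  using assms by (simp add: shift_diff_funpow_expand_op ext[OF assms(1)])

text \<open>Multiplication by \<open>(x - z)^N\<close> turns \<open>ACB\<close> into
  \<open>CAB\<close>, the ordering that occurs in \<open>Th1\<close>; in \<open>Xi2_N\<close> it
  likewise exchanges \<open>BCA\<close> and \<open>BAC\<close>. These are the members
  \<open>n = 0\<close> of weak associativity.\<close>

lemma Xi1_N: "Xi1 (int N) q = (Dxz ^^ N) (Th1 0 q)"
proof -
  have w: "vanishes_along (e3 - e1) (\<lambda>v. eyz q ABC v - fyz q ACB v)"
    by (intro vanishes_along_diff; simp add: vanish_simps)
  have "Xi1 (int N) q = (Dxz ^^ N) (\<lambda>v. eyz q ABC v - fyz q ACB v)"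
    by (rule ext) (simp add: Xi1_def expand_nat[OF w])
  also have "\<dots> = (\<lambda>v. (Dxz ^^ N) (eyz q ABC) v - (Dxz ^^ N) (fyz q ACB) v)"
    by (rule shift_diff_funpow_minus)
  also have "(Dxz ^^ N) (fyz q ACB) = (Dxz ^^ N) (fyz q CAB)"
    by (rule funpow_Dxz_agree) (simp_all add: AC_B vanish_simps)
  finally show ?thesis
    by (simp add: Th1_def[abs_def] expand_0 ext[OF expand_0] shift_diff_funpow_minus)
qed

lemma Xi2_N: "Xi2 (int N) q = (Dxz ^^ N) (Th2 0 q)"
proof -
  have w: "vanishes_along (e1 - e3) (\<lambda>v. eyz q BCA v - fyz q CBA v)"
    by (intro vanishes_along_diff; simp add: vanish_simps)
  have B: "(Dxz ^^ N) BAC = (Dxz ^^ N) BCA" by (rule ext) (rule B_AC)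
  have "Xi2 (int N) q = (Dxz ^^ N) (\<lambda>v. eyz q BCA v - fyz q CBA v)"
    by (rule ext) (simp add: Xi2_def expand_op_nat[OF w])
  also have "\<dots> = (\<lambda>v. (Dxz ^^ N) (eyz q BCA) v - (Dxz ^^ N) (fyz q CBA) v)"
    by (rule shift_diff_funpow_minus)
  also have "(Dxz ^^ N) (eyz q BCA) = (Dxz ^^ N) (eyz q BAC)"
    by (simp add: shift_diff_funpow_expand vanish_simps B)
  finally show ?thesis
    by (simp add: Th2_def[abs_def] ext[OF expand_op_0] shift_diff_funpow_minus)
qed

text \<open>The bound \<open>N\<close> on \<open>Q\<close> cuts off the sum at a length independent
  of \<open>v\<close>, so it is a finite combination of series that vanish along
  \<open>d\<close>.\<close>

lemma vanishes_along_expand_index: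
  fixes F :: "int \<Rightarrow> int \<Rightarrow> int \<times> int \<times> int \<Rightarrow> 'w"
  assumes F0: "\<And>P Q v. Q \<ge> int N \<Longrightarrow> F P Q v = 0" and F: "\<And>P Q. vanishes_along d (F P Q)"
  shows "vanishes_along d (\<lambda>v. expand u1 u2 n (\<lambda>(P, Q). F P Q v) (p, q))"
proof -
  have "expand u1 u2 n (\<lambda>(P, Q). F P Q v) (p, q) =
      (\<Sum>i<nat (int N - q). scale ((-1) ^ i * gbin n i) (F (p + n - int i) (q + int i) v))" for v
    by (subst expand_eq_sum[of "nat (int N - q)"]) (auto simp: F0 zmul_Pair zmul_int)
  moreover have "vanishes_along d (\<lambda>v. \<Sum>i<k. scale (c i) (F (a i) (b i) v))" for k :: nat and c a b
  proof (induction k)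
    case (Suc k)
    have "vanishes_along d (\<lambda>v. scale (c k) (F (a k) (b k) v))"
      using F[of "a k" "b k"] unfolding vanishes_along_def by (metis scale_zero_right)
    then show ?case unfolding sum.lessThan_Suc
      using Suc by (intro vanishes_along_comb[where h = "(+)"]) auto
  qed (simp add: vanishes_along_def)
  ultimately show ?thesis by simp
qed

text \<open>Since \<open>x - y = (x - z) - (y - z)\<close>, multiplying the coefficients by
  \<open>x - y\<close> amounts to a difference in the indices \<open>(P, Q)\<close>, which raises
  the exponent of the expansion in these indices.\<close>

lemma Dxy_expand_index:
  fixes F :: "int \<Rightarrow> int \<Rightarrow> int \<times> int \<times> int \<Rightarrow> 'w"
  assumes F0: "\<And>P Q v. Q \<ge> int N \<Longrightarrow> F P Q v = 0"
    and x: "\<And>P Q. Dxz (F P Q) = F (P + 1) Q" and y: "\<And>P Q. Dyz (F P Q) = F P (Q + 1)"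
  shows "Dxy (\<lambda>v. expand u1 u2 n (\<lambda>(P, Q). F P Q v) (p, q)) v =
    expand u1 u2 (n + 1) (\<lambda>(P, Q). F P Q v) (p, q)"
proof -
  have van: "vanishes_along (u2 - u1) (\<lambda>(P, Q). F P Q v)" for v
    unfolding vanishes_along_def
  proof
    fix u :: "int \<times> int"
    show "\<exists>k. \<forall>i\<ge>k. (case u + zmul (int i) (u2 - u1) of (P, Q) \<Rightarrow> F P Q v) = 0"
      by (cases u, rule exI[of _ "nat (int N - snd u)"]) (auto simp: zmul_Pair zmul_int F0)
  qed
  have d: "(\<lambda>u. (case u of (P, Q) \<Rightarrow> F P Q (v + e1)) - (case u of (P, Q) \<Rightarrow> F P Q (v + e2))) =
      shift_diff u1 u2 (\<lambda>(P, Q). F P Q v)"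
  proof (rule ext, clarify)
    fix P Q
    have "F (P + 1) Q v = F P Q (v + e1) - F P Q (v + e3)"
      unfolding x[symmetric] shift_diff_def ..
    moreover have "F P (Q + 1) v = F P Q (v + e2) - F P Q (v + e3)"
      unfolding y[symmetric] shift_diff_def ..
    ultimately show "F P Q (v + e1) - F P Q (v + e2) = shift_diff u1 u2 (\<lambda>(P, Q). F P Q v) (P, Q)"
      by (simp add: shift_diff_def)
  qed
  have "Dxy (\<lambda>v. expand u1 u2 n (\<lambda>(P, Q). F P Q v) (p, q)) v =
      expand u1 u2 n (shift_diff u1 u2 (\<lambda>(P, Q). F P Q v)) (p, q)"
    unfolding shift_diff_def[of e1 e2] d[symmetric] by (rule expand_diff[symmetric]) (rule van)+
  also have "\<dots> = expand u1 u2 (n + 1) (\<lambda>(P, Q). F P Q v) (p, q)"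
    by (subst expand_shift_diff[OF van]) (rule expand_succ[OF van])
  finally show ?thesis .
qed

text \<open>Both sides are multiplied by \<open>x - y\<close> when \<open>n\<close> grows, and they
  agree at \<open>n = 0\<close>. This part lives in the region where x dominates y, its companion
  \<open>weak_assoc_2\<close> in the opposite one, so they cannot be treated as one family.\<close>

lemma weak_assoc_1:
  "(Dxz ^^ N) (Th1 n q) v = expand u1 u2 n (\<lambda>(P, Q). Xi1 P Q v) (int N, q)"
proof (rule family_unique[where F = "\<lambda>n. (Dxz ^^ N) (Th1 n q)" and m = 0 and a = e1 and b = e2
      and d = "e2 - e1" and G = "\<lambda>n v. expand u1 u2 n (\<lambda>(P, Q). Xi1 P Q v) (int N, q)"])
  show "Dxy ((Dxz ^^ N) (Th1 n q)) v = (Dxz ^^ N) (Th1 (n + 1) q) v" for n v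
    by (simp add: shift_diff_funpow_commute Th_steps)
  show "Dxy (\<lambda>v. expand u1 u2 n (\<lambda>(P, Q). Xi1 P Q v) (int N, q)) v =
      expand u1 u2 (n + 1) (\<lambda>(P, Q). Xi1 P Q v) (int N, q)" for n v
    by (rule Dxy_expand_index[OF Xi1_eq_0]) (simp_all add: Xi1_steps)
  show "vanishes_along (e2 - e1) ((Dxz ^^ N) (Th1 n q))" for n
    unfolding Th1_def
    by (intro vanishes_along_shift_diff_funpow vanishes_along_diff; simp add: vanish_simps)
  have "weakly_truncated cy cz (\<lambda>v. eyz Q ABC v - fyz Q ACB v)" for Q
    by (intro weakly_truncated_diff truncated_weakly(1)[of cy cz "eyz Q ABC"]
        truncated_weakly(2)[of cz cy "fyz Q ACB"] truncated_closed trunc)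
  then have "vanishes_along (e2 - e1) (Xi1 P Q)" for P Q
    unfolding Xi1_def
    by (intro weakly_truncated_vanishes[of cy cz] weakly_truncated_expand additive_coords) auto
  then show "vanishes_along (e2 - e1) (\<lambda>v. expand u1 u2 n (\<lambda>(P, Q). Xi1 P Q v) (int N, q))" for n
    by (intro vanishes_along_expand_index[OF Xi1_eq_0])
  show "(Dxz ^^ N) (Th1 0 q) v = expand u1 u2 0 (\<lambda>(P, Q). Xi1 P Q v) (int N, q)" for v
    by (simp add: expand_0 Xi1_N)
qed simp

lemma weak_assoc_2:
  "(Dxz ^^ N) (Th2 n q) v = expand u1 u2 n (\<lambda>(P, Q). Xi2 P Q v) (int N, q)"
proof (rule family_unique[where F = "\<lambda>n. (Dxz ^^ N) (Th2 n q)" and m = 0 and a = e1 and b = e2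
      and d = "e1 - e2" and G = "\<lambda>n v. expand u1 u2 n (\<lambda>(P, Q). Xi2 P Q v) (int N, q)"])
  show "Dxy ((Dxz ^^ N) (Th2 n q)) v = (Dxz ^^ N) (Th2 (n + 1) q) v" for n v
    by (simp add: shift_diff_funpow_commute Th_steps)
  show "Dxy (\<lambda>v. expand u1 u2 n (\<lambda>(P, Q). Xi2 P Q v) (int N, q)) v =
      expand u1 u2 (n + 1) (\<lambda>(P, Q). Xi2 P Q v) (int N, q)" for n v
    by (rule Dxy_expand_index[OF Xi2_eq_0]) (simp_all add: Xi2_steps)
  show "vanishes_along (e1 - e2) ((Dxz ^^ N) (Th2 n q))" for n
    unfolding Th2_def
    by (intro vanishes_along_shift_diff_funpow vanishes_along_diff; simp add: vanish_simps)
  have "vanishes_along (e1 - e2) (Xi2 P Q)" for P Q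
    unfolding Xi2_split[abs_def] by (intro vanishes_along_diff; simp add: vanish_simps)
  then show "vanishes_along (e1 - e2) (\<lambda>v. expand u1 u2 n (\<lambda>(P, Q). Xi2 P Q v) (int N, q))" for n
    by (intro vanishes_along_expand_index[OF Xi2_eq_0])
  show "(Dxz ^^ N) (Th2 0 q) v = expand u1 u2 0 (\<lambda>(P, Q). Xi2 P Q v) (int N, q)" for v
    by (simp add: expand_0 Xi2_N)
qed simp

text \<open>The binomial theorem for \<open>x - z = (x - y) + (y - z)\<close>, whose summands raise
  \<open>n\<close> and \<open>r\<close> respectively.\<close>

lemma iterate_Theta_nat: "iterate_sum (\<lambda>n r. Theta n r v) (int p) q n = (Dxz ^^ p) (Theta n q) v"
proof (induction p arbitrary: q n)
  case (Suc p)
  have "Theta (n + 1) q = (\<lambda>v. Dxz (Theta n q) v - Theta n (q + 1) v)"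
    using Theta_steps[of n q] by (simp add: shift_diff_telescope[of e1 e3 _ _ e2])
  then have "(Dxz ^^ p) (Theta (n + 1) q) v =
      (Dxz ^^ Suc p) (Theta n q) v - (Dxz ^^ p) (Theta n (q + 1)) v"
    by (simp only: funpow_Suc_right o_apply shift_diff_funpow_minus)
  moreover have "iterate_sum (\<lambda>n r. Theta n r v) (int p + 1) q n =
      iterate_sum (\<lambda>n r. Theta n r v) (int p) (q + 1) n + iterate_sum (\<lambda>n r. Theta n r v) (int p) q (n + 1)"
    using iterate_sum_pascal[of "int N" "\<lambda>n r. Theta n r v" "int p" q n] Theta_eq_0
    by (simp add: algebra_simps)
  ultimately show ?case by (simp add: Suc add.commute)
qed (simp add: iterate_sum_zero_left)

lemma Xi_vanishes_index: "vanishes_along (u2 - u1) (\<lambda>(P, Q). Xi P Q v)"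
  unfolding vanishes_along_def
proof
  fix u :: "int \<times> int"
  show "\<exists>k. \<forall>i\<ge>k. (case u + zmul (int i) (u2 - u1) of (P, Q) \<Rightarrow> Xi P Q v) = 0"
    by (cases u, rule exI[of _ "nat (int N - snd u)"])
       (auto simp: zmul_Pair zmul_int Xi_def Xi1_eq_0 Xi2_eq_0)
qed

lemma Xi'_vanishes_index: "vanishes_along (u1 - u2) (\<lambda>(P, Q). Xi' P Q v)"
  unfolding vanishes_along_def
proof
  fix u :: "int \<times> int"
  show "\<exists>k. \<forall>i\<ge>k. (case u + zmul (int i) (u1 - u2) of (P, Q) \<Rightarrow> Xi' P Q v) = 0"
    by (cases u, rule exI[of _ "nat (int N - fst u)"])
       (auto simp: zmul_Pair zmul_int Xi'_eq_0)
qed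

lemma Zeta_index: "(shift_diff u1 u2 ^^ n) (\<lambda>(P, Q). Zeta P Q v) (p, q) = (Dxy ^^ n) (Zeta p q) v"
proof (induction n arbitrary: p q)
  case (Suc n)
  have "Dxy (Zeta p q) = (\<lambda>v. Zeta (p + 1) q v - Zeta p (q + 1) v)"
    using Zeta_steps[of p q] shift_diff_telescope[of e1 e3 "Zeta p q" _ e2] by (auto simp: algebra_simps)
  then have "(Dxy ^^ Suc n) (Zeta p q) v = (Dxy ^^ n) (Zeta (p + 1) q) v - (Dxy ^^ n) (Zeta p (q + 1)) v"
    by (simp only: funpow_Suc_right o_apply shift_diff_funpow_minus)
  then show ?case by (simp add: shift_diff_def[of u1 u2] Suc[symmetric])
qed simp

theorem Theta_borcherds:
  "iterate_sum (\<lambda>n r. Theta n r v) p q n =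
     expand u1 u2 n (\<lambda>(P, Q). Xi P Q v) (p, q) - expand_op u1 u2 n (\<lambda>(P, Q). Xi' P Q v) (p, q)"
proof -
  define L where "L p q n = iterate_sum (\<lambda>n r. Theta n r v) p q n" for p q n
  define R where "R p q n = expand u1 u2 n (\<lambda>(P, Q). Xi P Q v) (p, q)
     - expand_op u1 u2 n (\<lambda>(P, Q). Xi' P Q v) (p, q)" for p q n
  have "L p q n - R p q n = 0"
  proof (rule descent_zero[where K = "\<lambda>p q n. L p q n - R p q n" and N = "int N" and ?p0.0 = "int N"])
    fix p q n
    have "L (p + 1) q n - L p (q + 1) n = L p q (n + 1)"
      unfolding L_def by (rule iterate_sum_pascal[of "int N"]) (simp add: Theta_eq_0)
    moreover have "R (p + 1) q n - R p (q + 1) n = R p q (n + 1)"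
      using expand_succ[OF Xi_vanishes_index, of n v "(p, q)"]
        expand_op_succ[OF Xi'_vanishes_index, of n v "(p, q)"]
      unfolding R_def shift_diff_def by (subst diff_cross) simp
    ultimately show "L (p + 1) q n - R (p + 1) q n - (L p (q + 1) n - R p (q + 1) n) =
        L p q (n + 1) - R p q (n + 1)" by (subst diff_cross) simp
  next
    \<comment> \<open>For large \<open>n\<close> the left side vanishes termwise, and the right side
      is \<open>(x - y)^n\<close> applied to the commutator \<open>Zeta\<close>.\<close>
    fix p q n assume n: "n \<ge> int N"
    have "L p q n = 0" unfolding L_def by (rule iterate_sum_eq_0[OF _ n]) (simp add: Theta_eq_0)
    moreover have "R p q n = (shift_diff u1 u2 ^^ nat n) (\<lambda>(P, Q). Xi P Q v) (p, q)
        - (shift_diff u1 u2 ^^ nat n) (\<lambda>(P, Q). Xi' P Q v) (p, q)"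
      using expand_nat[OF Xi_vanishes_index, of "nat n" v "(p, q)"]
        expand_op_nat[OF Xi'_vanishes_index, of "nat n" v "(p, q)"] n by (simp add: R_def)
    moreover have "(\<lambda>(P, Q). Zeta P Q v) = (\<lambda>u. (\<lambda>(P, Q). Xi P Q v) u - (\<lambda>(P, Q). Xi' P Q v) u)"
      by (auto simp: Zeta_def)
    then have "(shift_diff u1 u2 ^^ nat n) (\<lambda>(P, Q). Xi P Q v) (p, q)
        - (shift_diff u1 u2 ^^ nat n) (\<lambda>(P, Q). Xi' P Q v) (p, q) = (Dxy ^^ nat n) (Zeta p q) v"
      by (simp only: Zeta_index[symmetric] shift_diff_funpow_minus)
    moreover have "(Dxy ^^ nat n) (Zeta p q) v = 0"
      by (rule shift_diff_funpow_eq_0_mono[OF Zeta_local]) (use n in simp)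
    ultimately show "L p q n - R p q n = 0" by simp
  next
    fix q n
    have "L (int N) q n = (Dxz ^^ N) (Th1 n q) v - (Dxz ^^ N) (Th2 n q) v"
      unfolding L_def iterate_Theta_nat unfolding Theta_def[abs_def] shift_diff_funpow_minus ..
    also have "\<dots> = expand u1 u2 n (\<lambda>(P, Q). Xi P Q v) (int N, q)"
    proof -
      have van: "vanishes_along (u2 - u1) (\<lambda>(P, Q). F P Q v)"
        if "\<And>P Q. Q \<ge> int N \<Longrightarrow> F P Q v = 0" for F :: "_ \<Rightarrow> _ \<Rightarrow> _ \<Rightarrow> 'w"
        unfolding vanishes_along_def
      proof
        fix u :: "int \<times> int"
        show "\<exists>k. \<forall>i\<ge>k. (case u + zmul (int i) (u2 - u1) of (P, Q) \<Rightarrow> F P Q v) = 0"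
          by (cases u, rule exI[of _ "nat (int N - snd u)"])
             (auto simp: zmul_Pair zmul_int that)
      qed
      have e: "(\<lambda>(P, Q). Xi P Q v) = (\<lambda>u. (\<lambda>(P, Q). Xi1 P Q v) u - (\<lambda>(P, Q). Xi2 P Q v) u)"
        by (auto simp: Xi_def)
      show ?thesis
        unfolding weak_assoc_1 weak_assoc_2 e
        by (rule expand_diff[OF van van, OF Xi1_eq_0 Xi2_eq_0, symmetric])
    qed
    also have "\<dots> = R (int N) q n"
    proof -
      \<comment> \<open>This expansion only raises the first index, and from \<open>N\<close> on
        \<open>Xi'\<close> is zero.\<close>
      have "expand_op u1 u2 n (\<lambda>(P, Q). Xi' P Q v) (int N, q) = 0"
        unfolding expand_op_def
        by (subst expand_eq_0) (auto simp: zmul_Pair zmul_int Xi'_eq_0)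
      then show ?thesis by (simp add: R_def)
    qed
    finally show "L (int N) q n - R (int N) q n = 0" by simp
  qed
  then show ?thesis by (simp add: L_def R_def)
qed

section \<open>Locality of a product with a third field\<close>

lemma Dxz_Theta_local: "(Dxz ^^ N) (Theta n (int N)) v = 0"
proof -
  have "(Dxz ^^ N) (Th1 n (int N)) v = (\<lambda>_. 0) v"
  proof (rule family_unique[where F = "\<lambda>n. (Dxz ^^ N) (Th1 n (int N))" and m = 0 and a = e1 and b = e2
      and d = "e2 - e1" and G = "\<lambda>n v. 0"])
    show "Dxy ((Dxz ^^ N) (Th1 n (int N))) v = (Dxz ^^ N) (Th1 (n + 1) (int N)) v" for n v
      by (simp add: shift_diff_funpow_commute Th_steps)
    show "vanishes_along (e2 - e1) ((Dxz ^^ N) (Th1 n (int N)))" for n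
      unfolding Th1_def
      by (intro vanishes_along_shift_diff_funpow vanishes_along_diff; simp add: vanish_simps)
    \<comment> \<open>At exponent \<open>N\<close> locality of B and C replaces \<open>ABC\<close>
      by \<open>ACB\<close>, after which the polynomial multiple may be read as the opposite
      expansion.\<close>
    have "eyz (int N) ABC = (Dyz ^^ N) ACB"
      using expand_nat[OF truncated_vanish(3)[OF tABC], of N] A_BC by auto
    also have "\<dots> = fyz (int N) ACB"
      using expand_op_nat[OF truncated_vanish(6)[OF tACB], of N] by auto
    finally have 1: "eyz (int N) ABC = fyz (int N) ACB" .
    have "(Dxz ^^ N) (fyz (int N) ACB) = (Dxz ^^ N) (fyz (int N) CAB)"
      by (rule funpow_Dxz_agree) (simp_all add: AC_B vanish_simps)
    then show "(Dxz ^^ N) (Th1 0 (int N)) v = 0" for v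
      by (simp add: Th1_def[abs_def] ext[OF expand_0] shift_diff_funpow_minus 1)
  qed (auto simp: shift_diff_def vanishes_along_def)
  moreover have "(Dxz ^^ N) (Th2 n (int N)) v = (\<lambda>_. 0) v"
  proof (rule family_unique[where F = "\<lambda>n. (Dxz ^^ N) (Th2 n (int N))" and m = 0 and a = e1 and b = e2
      and d = "e1 - e2" and G = "\<lambda>n v. 0"])
    show "Dxy ((Dxz ^^ N) (Th2 n (int N))) v = (Dxz ^^ N) (Th2 (n + 1) (int N)) v" for n v
      by (simp add: shift_diff_funpow_commute Th_steps)
    show "vanishes_along (e1 - e2) ((Dxz ^^ N) (Th2 n (int N)))" for n
      unfolding Th2_def
      by (intro vanishes_along_shift_diff_funpow vanishes_along_diff; simp add: vanish_simps)
    have "eyz (int N) BCA = (Dyz ^^ N) CBA"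
      using expand_nat[OF truncated_vanish(12)[OF tBCA], of N] BC_A by auto
    also have "\<dots> = fyz (int N) CBA"
      using expand_op_nat[OF truncated_vanish(18)[OF tCBA], of N] by auto
    finally have 1: "eyz (int N) BCA = fyz (int N) CBA" .
    have B: "(Dxz ^^ N) BAC = (Dxz ^^ N) BCA" by (rule ext) (rule B_AC)
    have "(Dxz ^^ N) (eyz (int N) BAC) = (Dxz ^^ N) (eyz (int N) BCA)"
      by (simp add: shift_diff_funpow_expand vanish_simps B)
    then show "(Dxz ^^ N) (Th2 0 (int N)) v = 0" for v
      by (simp add: Th2_def[abs_def] ext[OF expand_op_0] ext[OF expand_0] shift_diff_funpow_minus 1)
  qed (auto simp: shift_diff_def vanishes_along_def)
  ultimately show ?thesis unfolding Theta_def[abs_def] shift_diff_funpow_minus by simp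
qed

text \<open>After reserving \<open>(y - z)^N\<close>, each further factor is written as
  \<open>(x - z) - (x - y)\<close>. With \<open>2 * N - n\<close> further factors every resulting
  term has either \<open>N\<close> factors \<open>x - z\<close> or an exponent of
  \<open>x - y\<close> that reached \<open>N\<close>, and both kinds vanish; this explains
  \<open>3 * N - n\<close>.\<close>

theorem Theta_dong: "Theta n r v = 0" if "r \<ge> 3 * int N - n" "r \<ge> int N"
proof -
  have *: "(Dxz ^^ k) (Theta n (int N + int j)) v = 0" if "int k + int j + n \<ge> 2 * int N" for k j n v
    using that
  proof (induction j arbitrary: k n v)
    case 0
    show ?case
    proof (cases "n \<ge> int N")
      case True
      show ?thesis
        by (rule shift_diff_funpow_eq_0_mono[where N = 0, OF _ le0]) (simp add: Theta_eq_0[OF True])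
    next
      case False
      then have "k \<ge> N" using 0 by simp
      then show ?thesis
        using shift_diff_funpow_eq_0_mono[of N e1 e3 "Theta n (int N)"] Dxz_Theta_local by simp
    qed
  next
    case (Suc j)
    have "Theta n (int N + int (Suc j)) = (\<lambda>v. Dxz (Theta n (int N + int j)) v - Theta (n + 1) (int N + int j) v)"
      using Theta_steps[of n "int N + int j"]
      by (simp add: shift_diff_telescope[of e1 e3 _ _ e2] add.assoc add.commute[of 1])
    then have "(Dxz ^^ k) (Theta n (int N + int (Suc j))) v =
        (Dxz ^^ Suc k) (Theta n (int N + int j)) v - (Dxz ^^ k) (Theta (n + 1) (int N + int j)) v"
      by (simp only: funpow_Suc_right o_apply shift_diff_funpow_minus)
    then show ?case using Suc.IH[of "Suc k" n v] Suc.IH[of k "n + 1" v] Suc.prems by simp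
  qed
  show ?thesis using *[of 0 "nat (r - int N)" n v] that by simp
qed

end

section \<open>Products of fields\<close>

lemma additive_zmul:
  fixes h :: "'i::ab_group_add \<Rightarrow> 'j::ab_group_add"
  assumes h: "\<And>u v. h (u + v) = h u + h v"
  shows "h (zmul n e) = zmul n (h e)"
proof -
  have z: "h 0 = 0" using h[of 0 0] by simp
  have "h (\<Sum>_<k. e) = (\<Sum>_<k. h e)" for k :: nat by (induction k) (auto simp: z h)
  moreover have "h (u - v) = h u - h v" for u v using h[of "u - v" v] by simp
  ultimately show ?thesis by (simp add: zmul_def)
qed

text \<open>\<open>h\<close> extracts the coordinates that are shifted and \<open>\<kappa>\<close>
  those that stay fixed, so a difference in three variables can be computed in two.\<close>

lemma shift_diff_funpow_pullback:
  fixes h :: "'i::ab_group_add \<Rightarrow> 'j::ab_group_add" and \<kappa> :: "'i \<Rightarrow> 'k"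
  assumes h: "\<And>v. h (v + a') = h v + a" "\<And>v. h (v + b') = h v + b"
    and \<kappa>: "\<And>v. \<kappa> (v + a') = \<kappa> v" "\<And>v. \<kappa> (v + b') = \<kappa> v"
  shows "(shift_diff a' b' ^^ n) (\<lambda>v. F (\<kappa> v) (h v)) v = ((shift_diff a b ^^ n) (F (\<kappa> v)) (h v) :: 'w::ab_group_add)"
proof (induction n arbitrary: v)
  case (Suc n)
  show ?case unfolding funpow.simps o_apply
    by (subst (1 2) shift_diff_def) (simp add: Suc h \<kappa>)
qed simp

lemma shift_diff_funpow_hom:
  assumes "\<And>x y. \<phi> (x - y) = \<phi> x - \<phi> y"
  shows "(shift_diff a b ^^ n) (\<lambda>v. \<phi> (f v)) = (\<lambda>v. \<phi> ((shift_diff a b ^^ n) f v))"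
  by (induction n) (auto simp: shift_diff_def assms)

lemma shift_diff_funpow_swap:
  fixes f :: "'i::ab_group_add \<Rightarrow> 'w::ab_group_add"
  shows "(shift_diff b a ^^ n) f = (\<lambda>v. if even n then (shift_diff a b ^^ n) f v else - (shift_diff a b ^^ n) f v)"
proof (induction n)
  case (Suc n)
  then show ?case by (auto simp: shift_diff_def fun_eq_iff)
qed simp

context complex_vector_space
begin

lemma expand_pullback:
  fixes h :: "'i::ab_group_add \<Rightarrow> 'j::ab_group_add" and \<kappa> :: "'i \<Rightarrow> 'k::ab_group_add"
  assumes h: "\<And>u v. h (u + v) = h u + h v" "h a' = a" "h b' = b"
    and \<kappa>: "\<And>u v. \<kappa> (u + v) = \<kappa> u + \<kappa> v" "\<kappa> a' = 0" "\<kappa> b' = 0"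
  shows "expand a' b' n (\<lambda>v. F (\<kappa> v) (h v)) v = expand a b n (F (\<kappa> v)) (h v)"
    and "expand_op a' b' n (\<lambda>v. F (\<kappa> v) (h v)) v = expand_op a b n (F (\<kappa> v)) (h v)"
proof -
  have d: "h (u - v) = h u - h v" "\<kappa> (u - v) = \<kappa> u - \<kappa> v" for u v
    using h(1)[of "u - v" v] \<kappa>(1)[of "u - v" v] by simp_all
  show "expand a' b' n (\<lambda>v. F (\<kappa> v) (h v)) v = expand a b n (F (\<kappa> v)) (h v)"
    unfolding expand_def by (simp add: h \<kappa> additive_zmul d)
  have "expand b' a' n (\<lambda>v. F (\<kappa> v) (h v)) v = expand b a n (F (\<kappa> v)) (h v)"
    unfolding expand_def by (simp add: h \<kappa> additive_zmul d)
  then show "expand_op a' b' n (\<lambda>v. F (\<kappa> v) (h v)) v = expand_op a b n (F (\<kappa> v)) (h v)"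
    by (simp add: expand_op_def)
qed

lemma expand_add:
  assumes f: "vanishes_along (b - a) f" and g: "vanishes_along (b - a) g"
  shows "expand a b n (\<lambda>v. f v + g v) v = expand a b n f v + expand a b n g v"
proof -
  obtain k l where "\<And>i. i \<ge> k \<Longrightarrow> f (v + zmul n a + zmul (int i) (b - a)) = 0"
      "\<And>i. i \<ge> l \<Longrightarrow> g (v + zmul n a + zmul (int i) (b - a)) = 0"
    using expand_bound[OF f] expand_bound[OF g] by metis
  then show ?thesis
    by (simp add: expand_eq_sum[of "max k l"] sum.distrib scale_right_distrib)
qed

lemma expand_op_add:
  assumes f: "vanishes_along (a - b) f" and g: "vanishes_along (a - b) g"
  shows "expand_op a b n (\<lambda>v. f v + g v) v = expand_op a b n f v + expand_op a b n g v"
  unfolding expand_op_def by (simp add: expand_add assms scale_right_distrib)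

lemma expand_op_scale:
  assumes f: "vanishes_along (a - b) f"
  shows "expand_op a b n (\<lambda>v. scale c (f v)) v = scale c (expand_op a b n f v)"
  unfolding expand_op_def by (simp add: expand_scale f scale_left_commute)

definition is_field :: "(int \<Rightarrow> 'w \<Rightarrow> 'w) \<Rightarrow> bool" where
  "is_field A \<longleftrightarrow> (\<forall>m x y. A m (x + y) = A m x + A m y) \<and>
     (\<forall>m c x. A m (scale c x) = scale c (A m x)) \<and> (\<forall>w. \<exists>N. \<forall>m\<ge>N. A m w = 0)"

text \<open>\<open>(x - y)^N [A(x), B(y)] = 0\<close>.\<close>

definition mode_local :: "nat \<Rightarrow> (int \<Rightarrow> 'w \<Rightarrow> 'w) \<Rightarrow> (int \<Rightarrow> 'w \<Rightarrow> 'w) \<Rightarrow> bool" where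
  "mode_local N A B \<longleftrightarrow> (\<forall>w v. (shift_diff u1 u2 ^^ N) (\<lambda>(p, q). A p (B q w)) v =
     (shift_diff u1 u2 ^^ N) (\<lambda>(p, q). B q (A p w)) v)"

text \<open>The usual residue in x of \<open>(x - y)^n A(x) B(y)\<close> minus the oppositely
  expanded \<open>B(y) A(x)\<close>: index \<open>0\<close> in the slot of \<open>A\<close> is the
  coefficient of \<open>x^(-1)\<close>.\<close>

definition nprod :: "(int \<Rightarrow> 'w \<Rightarrow> 'w) \<Rightarrow> (int \<Rightarrow> 'w \<Rightarrow> 'w) \<Rightarrow> int \<Rightarrow> int \<Rightarrow> 'w \<Rightarrow> 'w" where
  "nprod A B n q w = expand u1 u2 n (\<lambda>(p, q). A p (B q w)) (0, q)
     - expand_op u1 u2 n (\<lambda>(p, q). B q (A p w)) (0, q)"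

lemma field_add: "is_field A \<Longrightarrow> A m (x + y) = A m x + A m y"
  and field_scale: "is_field A \<Longrightarrow> A m (scale c x) = scale c (A m x)"
  and field_trunc: "is_field A \<Longrightarrow> \<exists>N. \<forall>m\<ge>N. A m w = 0"
  by (simp_all add: is_field_def)

lemma field_zero: "is_field A \<Longrightarrow> A m 0 = 0"
  using field_add[of A m 0 0] by simp

lemma field_diff: "is_field A \<Longrightarrow> A m (x - y) = A m x - A m y"
  using field_add[of A m "x - y" y] by simp

lemma field_trunc_pair:
  assumes B: "is_field B" and C: "is_field C"
  shows "\<exists>S. \<forall>q s. s \<ge> S \<longrightarrow> B q (C s w) = 0"
    and "\<exists>Q. \<forall>q s. s \<ge> s0 \<and> q \<ge> Q \<longrightarrow> B q (C s w) = 0"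
proof -
  obtain S where S: "\<And>s. s \<ge> S \<Longrightarrow> C s w = 0" using field_trunc[OF C] by blast
  then show "\<exists>S. \<forall>q s. s \<ge> S \<longrightarrow> B q (C s w) = 0"
    by (intro exI[of _ S]) (simp add: field_zero[OF B])
  have "\<forall>s. \<exists>Q. \<forall>q\<ge>Q. B q (C s w) = 0" using field_trunc[OF B] by blast
  then obtain Q where Q: "\<And>s q. q \<ge> Q s \<Longrightarrow> B q (C s w) = 0" by metis
  show "\<exists>Q. \<forall>q s. s \<ge> s0 \<and> q \<ge> Q \<longrightarrow> B q (C s w) = 0"
  \<comment> \<open>Only the values of \<open>s\<close> from \<open>s0\<close> up to
    \<open>S\<close> can give a nonzero inner vector, and a finite maximum of their bounds serves
    them all.\<close>
  proof (intro exI[of _ "Max (insert 0 (Q ` {s0..<S}))"] allI impI)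
    fix q s assume *: "s \<ge> s0 \<and> q \<ge> Max (insert 0 (Q ` {s0..<S}))"
    show "B q (C s w) = 0"
    proof (cases "s \<ge> S")
      case False
      then have "Q s \<le> q" using * by auto
      then show ?thesis by (rule Q)
    qed (simp add: S field_zero[OF B])
  qed
qed

lemma field_pair_vanishes:
  assumes A: "is_field A" and B: "is_field B"
  shows "vanishes_along (u2 - u1) (\<lambda>(p, q). A p (B q w))"
    and "vanishes_along (u1 - u2) (\<lambda>(p, q). B q (A p w))"
proof -
  obtain N where N: "\<And>m. m \<ge> N \<Longrightarrow> B m w = 0" using field_trunc[OF B] by blast
  show "vanishes_along (u2 - u1) (\<lambda>(p, q). A p (B q w))"
    unfolding vanishes_along_def
  proof
    fix v :: "int \<times> int"
    show "\<exists>k. \<forall>i\<ge>k. (case v + zmul (int i) (u2 - u1) of (p, q) \<Rightarrow> A p (B q w)) = 0"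
      by (cases v, rule exI[of _ "nat (N - snd v)"])
         (auto simp: zmul_Pair zmul_int N field_zero[OF A])
  qed
  obtain M where M: "\<And>m. m \<ge> M \<Longrightarrow> A m w = 0" using field_trunc[OF A] by blast
  show "vanishes_along (u1 - u2) (\<lambda>(p, q). B q (A p w))"
    unfolding vanishes_along_def
  proof
    fix v :: "int \<times> int"
    show "\<exists>k. \<forall>i\<ge>k. (case v + zmul (int i) (u1 - u2) of (p, q) \<Rightarrow> B q (A p w)) = 0"
      by (cases v, rule exI[of _ "nat (M - fst v)"])
         (auto simp: zmul_Pair zmul_int M field_zero[OF B])
  qed
qed

lemma mode_local_mono: "mode_local N A B \<Longrightarrow> N \<le> M \<Longrightarrow> mode_local M A B"
  unfolding mode_local_def by (intro allI, rule fun_cong, rule shift_diff_funpow_eq_mono) blast+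

lemma mode_local_sym:
  assumes "mode_local N A B"
  shows "mode_local N B A"
  unfolding mode_local_def
proof (intro allI)
  fix w v
  have p: "(shift_diff u1 u2 ^^ N) (\<lambda>(p, q). F q p) v = (shift_diff u2 u1 ^^ N) (\<lambda>(p, q). F p q) (snd v, fst v)"
    for F :: "int \<Rightarrow> int \<Rightarrow> 'w" and v
    using shift_diff_funpow_pullback[of "\<lambda>v. (snd v, fst v)" u1 u2 u2 u1 "\<lambda>_. ()" N "\<lambda>_. \<lambda>(p, q). F p q" v]
    by (simp add: case_prod_unfold)
  have "(shift_diff u2 u1 ^^ N) (\<lambda>(p, q). A p (B q w)) = (shift_diff u2 u1 ^^ N) (\<lambda>(p, q). B q (A p w))"
    using assms by (simp add: mode_local_def shift_diff_funpow_swap[where b = u2 and a = u1] fun_eq_iff)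
  then show "(shift_diff u1 u2 ^^ N) (\<lambda>(p, q). B p (A q w)) v =
      (shift_diff u1 u2 ^^ N) (\<lambda>(p, q). A q (B p w)) v"
    using p[of "\<lambda>p q. A p (B q w)"] p[of "\<lambda>p q. B q (A p w)"] by simp
qed

lemma nprod_eq_0:
  assumes A: "is_field A" and B: "is_field B" and AB: "mode_local N A B" and n: "n \<ge> int N"
  shows "nprod A B n q w = 0"
proof -
  have "(shift_diff u1 u2 ^^ nat n) (\<lambda>(p, q). A p (B q w)) =
      (shift_diff u1 u2 ^^ nat n) (\<lambda>(p, q). B q (A p w))"
    using AB n by (intro shift_diff_funpow_eq_mono[of N]) (auto simp: mode_local_def)
  then show ?thesis
    using n expand_nat[OF field_pair_vanishes(1)[OF A B], of "nat n" w "(0, q)"]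
      expand_op_nat[OF field_pair_vanishes(2)[OF A B], of "nat n" w "(0, q)"]
    by (simp add: nprod_def)
qed

text \<open>The descent now starts at \<open>p = 0\<close>, where the identity is the definition of
  \<open>nprod\<close>; for large \<open>n\<close> both sides vanish by locality.\<close>

theorem nprod_modes:
  assumes A: "is_field A" and B: "is_field B" and AB: "mode_local N A B"
  shows "iterate_sum (\<lambda>n r. nprod A B n r w) p q n =
    expand u1 u2 n (\<lambda>(p, q). A p (B q w)) (p, q) - expand_op u1 u2 n (\<lambda>(p, q). B q (A p w)) (p, q)"
proof -
  note van = field_pair_vanishes[OF A B, of w]
  define L where "L p q n = iterate_sum (\<lambda>n r. nprod A B n r w) p q n" for p q n
  define R where "R p q n = expand u1 u2 n (\<lambda>(p, q). A p (B q w)) (p, q)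
    - expand_op u1 u2 n (\<lambda>(p, q). B q (A p w)) (p, q)" for p q n
  have "L p q n - R p q n = 0"
  proof (rule descent_zero[where K = "\<lambda>p q n. L p q n - R p q n" and N = "int N" and ?p0.0 = 0])
    fix p q n
    have "L (p + 1) q n - L p (q + 1) n = L p q (n + 1)"
      unfolding L_def by (rule iterate_sum_pascal[of "int N"]) (rule nprod_eq_0[OF A B AB])
    moreover have "R (p + 1) q n - R p (q + 1) n = R p q (n + 1)"
      using expand_succ[OF van(1), of n "(p, q)"] expand_op_succ[OF van(2), of n "(p, q)"]
      unfolding R_def shift_diff_def by (subst diff_cross) simp
    ultimately show "L (p + 1) q n - R (p + 1) q n - (L p (q + 1) n - R p (q + 1) n) =
        L p q (n + 1) - R p q (n + 1)" by (subst diff_cross) simp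
  next
    fix p q n assume n: "n \<ge> int N"
    have "L p q n = 0" unfolding L_def
      by (rule iterate_sum_eq_0[OF _ n]) (rule nprod_eq_0[OF A B AB])
    moreover have "(shift_diff u1 u2 ^^ nat n) (\<lambda>(p, q). A p (B q w)) =
        (shift_diff u1 u2 ^^ nat n) (\<lambda>(p, q). B q (A p w))"
      using AB n by (intro shift_diff_funpow_eq_mono[of N]) (auto simp: mode_local_def)
    then have "R p q n = 0"
      using expand_nat[OF van(1), of "nat n" "(p, q)"] expand_op_nat[OF van(2), of "nat n" "(p, q)"] n
      by (simp add: R_def)
    ultimately show "L p q n - R p q n = 0" by simp
  next
    show "L 0 q n - R 0 q n = 0" for q n
      by (simp add: L_def R_def iterate_sum_zero_left nprod_def)
  qed
  then show ?thesis by (simp add: L_def R_def)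
qed

lemma nprod_linear:
  assumes A: "is_field A" and B: "is_field B"
  shows "nprod A B n q (x + y) = nprod A B n q x + nprod A B n q y"
    and "nprod A B n q (scale c x) = scale c (nprod A B n q x)"
proof -
  note van = field_pair_vanishes[OF A B]
  have "(\<lambda>(p, q). A p (B q (x + y))) = (\<lambda>v. (\<lambda>(p, q). A p (B q x)) v + (\<lambda>(p, q). A p (B q y)) v)"
    "(\<lambda>(p, q). B q (A p (x + y))) = (\<lambda>v. (\<lambda>(p, q). B q (A p x)) v + (\<lambda>(p, q). B q (A p y)) v)"
    "(\<lambda>(p, q). A p (B q (scale c x))) = (\<lambda>v. scale c ((\<lambda>(p, q). A p (B q x)) v))"
    "(\<lambda>(p, q). B q (A p (scale c x))) = (\<lambda>v. scale c ((\<lambda>(p, q). B q (A p x)) v))"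
    by (auto simp: field_add[OF A] field_add[OF B] field_scale[OF A] field_scale[OF B])
  then show "nprod A B n q (x + y) = nprod A B n q x + nprod A B n q y"
    and "nprod A B n q (scale c x) = scale c (nprod A B n q x)"
    by (simp_all only: nprod_def expand_add[OF van(1) van(1)] expand_op_add[OF van(2) van(2)]
        expand_scale[OF van(1)] expand_op_scale[OF van(2)])
       (simp_all add: scale_right_diff_distrib algebra_simps)
qed

text \<open>Modules demand a truncation bound valid for all torus degrees at once, here the
  parameter \<open>K\<close>. In the reversed order only the finitely many vectors
  \<open>A i w\<close> with \<open>i < I\<close> matter, so uniformity survives the product.\<close>

lemma nprod_truncated_uniform:
  assumes A: "is_field A" and B: "\<And>K. is_field (B K)"
    and u: "\<And>w. \<exists>N. \<forall>K m. m \<ge> N \<longrightarrow> B K m w = 0"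
  shows "\<exists>N. \<forall>K m. m \<ge> N \<longrightarrow> nprod A (B K) n m w = 0"
proof -
  obtain I where I: "\<And>m. m \<ge> I \<Longrightarrow> A m w = 0" using field_trunc[OF A] by blast
  obtain N0 where N0: "\<And>K m. m \<ge> N0 \<Longrightarrow> B K m w = 0" using u by blast
  obtain N where N: "\<And>x K m. m \<ge> N x \<Longrightarrow> B K m x = 0" using u by metis
  define M where "M = Max (insert N0 ((\<lambda>i. N (A i w) - n + i) ` {0..<I}))"
  have "nprod A (B K) n m w = 0" if m: "m \<ge> M" for K m
  proof -
    have "B K (m + n - int i) (A (int i) w) = 0" for i
    proof (cases "int i \<ge> I")
      case False
      then have "N (A (int i) w) - n + int i \<le> M" unfolding M_def by (intro Max_ge) auto
      then show ?thesis using m by (intro N) simp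
    qed (simp add: I field_zero[OF B])
    then have "expand u2 u1 n (\<lambda>(p, q). B K q (A p w)) (0, m) = 0"
      by (intro expand_eq_0) (simp add: zmul_Pair zmul_int)
    moreover have "N0 \<le> M" unfolding M_def by simp
    then have "expand u1 u2 n (\<lambda>(p, q). A p (B K q w)) (0, m) = 0"
      using m by (intro expand_eq_0) (simp add: zmul_Pair zmul_int N0 field_zero[OF A])
    ultimately show ?thesis by (simp add: nprod_def expand_op_def)
  qed
  then show ?thesis by blast
qed

lemma nprod_field:
  assumes "is_field A" "is_field B"
  shows "is_field (nprod A B n)"
  using nprod_linear[OF assms] nprod_truncated_uniform[of A "\<lambda>_::unit. B" n] assms
  unfolding is_field_def by auto

lemma field_comb:
  assumes "is_field A" "is_field B"
  shows "is_field (\<lambda>m w. A m w + B m w)" and "is_field (\<lambda>m w. scale c (A m w))"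
proof -
  have "\<exists>N. \<forall>m\<ge>N. A m w + B m w = 0" for w
  proof -
    obtain N M where "\<forall>m\<ge>N. A m w = 0" "\<forall>m\<ge>M. B m w = 0" using assms field_trunc by meson
    then show ?thesis by (intro exI[of _ "max N M"]) simp
  qed
  then show "is_field (\<lambda>m w. A m w + B m w)"
    using assms by (simp add: is_field_def scale_right_distrib algebra_simps)
  have "\<exists>N. \<forall>m\<ge>N. scale c (A m w) = 0" for w using assms(1) field_trunc by (metis scale_zero_right)
  then show "is_field (\<lambda>m w. scale c (A m w))"
    using assms by (simp add: is_field_def scale_right_distrib scale_left_commute)
qed

lemma nprod_bilinear:
  assumes A: "is_field A" and A': "is_field A'" and B: "is_field B" and B': "is_field B'"
  shows "nprod A (\<lambda>m w. B m w + B' m w) n q w = nprod A B n q w + nprod A B' n q w"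
    and "nprod A (\<lambda>m w. scale c (B m w)) n q w = scale c (nprod A B n q w)"
    and "nprod (\<lambda>m w. A m w + A' m w) B n q w = nprod A B n q w + nprod A' B n q w"
    and "nprod (\<lambda>m w. scale c (A m w)) B n q w = scale c (nprod A B n q w)"
proof -
  note van = field_pair_vanishes
  have 1: "(\<lambda>(p, q). A p (B q w + B' q w)) = (\<lambda>v. (\<lambda>(p, q). A p (B q w)) v + (\<lambda>(p, q). A p (B' q w)) v)"
    "(\<lambda>(p, q). B q (A p w) + B' q (A p w)) = (\<lambda>v. (\<lambda>(p, q). B q (A p w)) v + (\<lambda>(p, q). B' q (A p w)) v)"
    "(\<lambda>(p, q). A p (scale c (B q w))) = (\<lambda>v. scale c ((\<lambda>(p, q). A p (B q w)) v))"
    "(\<lambda>(p, q). scale c (B q (A p w))) = (\<lambda>v. scale c ((\<lambda>(p, q). B q (A p w)) v))"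
    "(\<lambda>(p, q). A p (B q w) + A' p (B q w)) = (\<lambda>v. (\<lambda>(p, q). A p (B q w)) v + (\<lambda>(p, q). A' p (B q w)) v)"
    "(\<lambda>(p, q). B q (A p w + A' p w)) = (\<lambda>v. (\<lambda>(p, q). B q (A p w)) v + (\<lambda>(p, q). B q (A' p w)) v)"
    "(\<lambda>(p, q). scale c (A p (B q w))) = (\<lambda>v. scale c ((\<lambda>(p, q). A p (B q w)) v))"
    "(\<lambda>(p, q). B q (scale c (A p w))) = (\<lambda>v. scale c ((\<lambda>(p, q). B q (A p w)) v))"
    by (auto simp: field_add[OF A] field_add[OF B] field_scale[OF A] field_scale[OF B])
  show "nprod A (\<lambda>m w. B m w + B' m w) n q w = nprod A B n q w + nprod A B' n q w"
    unfolding nprod_def 1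
    by (simp add: expand_add[OF van(1)[OF A B] van(1)[OF A B']]
        expand_op_add[OF van(2)[OF A B] van(2)[OF A B']])
  show "nprod (\<lambda>m w. A m w + A' m w) B n q w = nprod A B n q w + nprod A' B n q w"
    unfolding nprod_def 1
    by (simp add: expand_add[OF van(1)[OF A B] van(1)[OF A' B]]
        expand_op_add[OF van(2)[OF A B] van(2)[OF A' B]])
  show "nprod A (\<lambda>m w. scale c (B m w)) n q w = scale c (nprod A B n q w)"
    "nprod (\<lambda>m w. scale c (A m w)) B n q w = scale c (nprod A B n q w)"
    unfolding nprod_def 1
    by (simp_all add: expand_scale[OF van(1)[OF A B]] expand_op_scale[OF van(2)[OF A B]]
        scale_right_diff_distrib)
qed

lemma gbin_nat_Suc: "gbin (int n) (Suc n) = 0"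
  unfolding gbin_def using binomial_gbinomial[of n "Suc n", where 'a = complex] by (simp add: binomial_eq_0)

text \<open>A field constant in its variable has only the mode \<open>-1\<close>, so just the term
  \<open>i = n + 1\<close> can contribute. Its coefficient binom(n, n + 1) is zero for
  \<open>n \<ge> 0\<close>, and for \<open>n < -1\<close> there is no such \<open>i\<close>. This
  covers the vacuum and the central field.\<close>

lemma nprod_constant:
  assumes B: "is_field B"
  shows "nprod (\<lambda>m x. if m = -1 then c x else 0) B n q w = (if n = -1 then c (B q w) else 0)"
proof -
  have op: "expand u2 u1 n (\<lambda>(p, q). B q (if p = -1 then c w else 0)) (0, q) = 0"
    by (rule expand_eq_0) (simp add: zmul_Pair zmul_int field_zero[OF B])
  have "scale ((-1) ^ i * gbin n i) (if n - int i = -1 then c (B (q + int i) w) else 0) =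
      (if n = -1 \<and> i = 0 then c (B q w) else 0)" for i
  proof (cases "n \<ge> 0 \<and> i = Suc (nat n)")
    case True
    then show ?thesis using gbin_nat_Suc[of "nat n"] by simp
  qed (auto simp: algebra_simps)
  note terms = this
  have "expand u1 u2 n (\<lambda>(p, q). if p = -1 then c (B q w) else 0) (0, q) =
      fsum (\<lambda>i. scale ((-1) ^ i * gbin n i) (if n - int i = -1 then c (B (q + int i) w) else 0))"
    unfolding expand_def by (simp add: zmul_Pair zmul_int)
  also have "\<dots> = (if n = -1 then c (B q w) else 0)"
    unfolding terms by (subst fsum_first) auto
  finally have "expand u1 u2 n (\<lambda>(p, q). if p = -1 then c (B q w) else 0) (0, q) =
      (if n = -1 then c (B q w) else 0)" .
  with op show ?thesis by (simp add: nprod_def expand_op_def)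
qed

section \<open>Three fields as a triple product\<close>

lemma truncated_triple:
  assumes A: "is_field A" and B: "is_field B" and C: "is_field C"
  shows "truncated y z (\<lambda>v. A (x v) (B (y v) (C (z v) w)))"
  unfolding truncated_def
proof (intro conjI allI)
  obtain S where "\<And>q s. s \<ge> S \<Longrightarrow> B q (C s w) = 0" using field_trunc_pair(1)[OF B C] by blast
  then show "\<exists>S. \<forall>v. z v \<ge> S \<longrightarrow> A (x v) (B (y v) (C (z v) w)) = 0"
    by (intro exI[of _ S]) (simp add: field_zero[OF A])
  fix s
  obtain Q where "\<And>q t. t \<ge> s \<Longrightarrow> q \<ge> Q \<Longrightarrow> B q (C t w) = 0"
    using field_trunc_pair(2)[OF B C] by blast
  then show "\<exists>Q. \<forall>v. z v \<ge> s \<and> y v \<ge> Q \<longrightarrow> A (x v) (B (y v) (C (z v) w)) = 0"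
    by (intro exI[of _ Q]) (simp add: field_zero[OF A])
qed

lemma mode_local_pullback:
  fixes \<phi> :: "'k \<Rightarrow> 'w \<Rightarrow> 'w"
  assumes AB: "mode_local N A B"
    and h: "\<And>v. x (v + a) = x v + 1" "\<And>v. x (v + b) = x v" "\<And>v. y (v + a) = y v" "\<And>v. y (v + b) = y v + 1"
    and \<kappa>: "\<And>v. \<kappa> (v + a) = \<kappa> v" "\<And>v. \<kappa> (v + b) = \<kappa> v"
    and \<phi>: "\<And>k x y. \<phi> k (x - y) = \<phi> k x - \<phi> k y"
  shows "(shift_diff a b ^^ N) (\<lambda>v. \<phi> (\<kappa> v) (A (x v) (B (y v) (W (\<kappa> v))))) (v :: 'i::ab_group_add) =
    (shift_diff a b ^^ N) (\<lambda>v. \<phi> (\<kappa> v) (B (y v) (A (x v) (W (\<kappa> v))))) v"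
proof -
  have *: "(shift_diff a b ^^ N) (\<lambda>v. \<phi> (\<kappa> v) (G (x v) (y v) (\<kappa> v))) v =
      \<phi> (\<kappa> v) ((shift_diff u1 u2 ^^ N) (\<lambda>(p, q). G p q (\<kappa> v)) (x v, y v))" for G
  proof -
    have "(shift_diff a b ^^ N) (\<lambda>v. (\<lambda>k u. \<phi> k (G (fst u) (snd u) k)) (\<kappa> v) (x v, y v)) v =
      (shift_diff u1 u2 ^^ N) ((\<lambda>k u. \<phi> k (G (fst u) (snd u) k)) (\<kappa> v)) (x v, y v)"
      by (rule shift_diff_funpow_pullback[where h = "\<lambda>v. (x v, y v)" and \<kappa> = \<kappa>
            and F = "\<lambda>k u. \<phi> k (G (fst u) (snd u) k)"]) (simp_all add: h \<kappa>)
    then show ?thesis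
      by (simp add: shift_diff_funpow_hom[where \<phi> = "\<phi> (\<kappa> v)"] \<phi> case_prod_unfold)
  qed
  show ?thesis
    using AB *[of "\<lambda>p q k. A p (B q (W k))"] *[of "\<lambda>p q k. B q (A p (W k))"]
    by (simp add: mode_local_def)
qed

lemma triple_products_fields:
  assumes A: "is_field A" and B: "is_field B" and C: "is_field C"
    and AB: "mode_local N A B" and BC: "mode_local N B C" and AC: "mode_local N A C"
  shows "triple_products scale
    (\<lambda>v. A (cx v) (B (cy v) (C (cz v) w))) (\<lambda>v. A (cx v) (C (cz v) (B (cy v) w)))
    (\<lambda>v. B (cy v) (A (cx v) (C (cz v) w))) (\<lambda>v. B (cy v) (C (cz v) (A (cx v) w)))
    (\<lambda>v. C (cz v) (A (cx v) (B (cy v) w))) (\<lambda>v. C (cz v) (B (cy v) (A (cx v) w))) N"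
proof (unfold_locales, goal_cases)
  \<comment> \<open>The locality goals: \<open>W\<close> contains what acts before the exchanged
    pair, \<open>\<phi>\<close> what acts after it, and \<open>\<kappa>\<close> is the index of the
    third field.\<close>
  case (7 v)
  show ?case by (rule mode_local_pullback[OF AB, where \<phi> = "\<lambda>_ x. x" and \<kappa> = cz and W = "\<lambda>s. C s w"]) simp_all
next
  case (8 v)
  show ?case by (rule mode_local_pullback[OF AB, where \<phi> = C and \<kappa> = cz and W = "\<lambda>s. w"])
    (simp_all add: field_diff[OF C])
next
  case (9 v)
  show ?case by (rule mode_local_pullback[OF BC, where \<phi> = A and \<kappa> = cx and W = "\<lambda>s. w"])
    (simp_all add: field_diff[OF A])
next
  case (10 v)
  show ?case by (rule mode_local_pullback[OF BC, where \<phi> = "\<lambda>_ x. x" and \<kappa> = cx and W = "\<lambda>s. A s w"]) simp_all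
next
  case (11 v)
  show ?case by (rule mode_local_pullback[OF AC, where \<phi> = "\<lambda>_ x. x" and \<kappa> = cy and W = "\<lambda>s. B s w"]) simp_all
next
  case (12 v)
  show ?case by (rule mode_local_pullback[OF AC, where \<phi> = B and \<kappa> = cy and W = "\<lambda>s. w"])
    (simp_all add: field_diff[OF B])
qed (intro truncated_triple assms)+

lemma expand_pullback_coords:
  fixes x y :: "int \<times> int \<times> int \<Rightarrow> int"
  assumes "\<And>u v. x (u + v) = x u + x v" "\<And>u v. y (u + v) = y u + y v" "\<And>u v. k (u + v) = k u + k v"
    and "x a = 1" "x b = 0" "y a = 0" "y b = 1" "k a = (0 :: 'k::ab_group_add)" "k b = 0"
  shows "expand a b n (\<lambda>v. G (x v) (y v) (k v)) v = expand u1 u2 n (\<lambda>(p, q). G p q (k v)) (x v, y v)"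
    and "expand_op a b n (\<lambda>v. G (x v) (y v) (k v)) v = expand_op u1 u2 n (\<lambda>(p, q). G p q (k v)) (x v, y v)"
  using expand_pullback[of "\<lambda>v. (x v, y v)" a u1 b u2 k n "\<lambda>k (p, q). G p q k" v] assms
  by simp_all

lemma expand_triple:
  "expand e1 e2 n (\<lambda>v. G (cx v) (cy v) (cz v)) (p, q, s) = expand u1 u2 n (\<lambda>(p, q). G p q s) (p, q)"
  "expand_op e1 e2 n (\<lambda>v. G (cx v) (cy v) (cz v)) (p, q, s) = expand_op u1 u2 n (\<lambda>(p, q). G p q s) (p, q)"
  "expand e2 e3 n (\<lambda>v. G (cx v) (cy v) (cz v)) (p, q, s) = expand u1 u2 n (\<lambda>(q, s). G p q s) (q, s)"
  "expand_op e2 e3 n (\<lambda>v. G (cx v) (cy v) (cz v)) (p, q, s) = expand_op u1 u2 n (\<lambda>(q, s). G p q s) (q, s)"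
  "expand e1 e3 n (\<lambda>v. G (cx v) (cy v) (cz v)) (p, q, s) = expand u1 u2 n (\<lambda>(p, s). G p q s) (p, s)"
  "expand_op e1 e3 n (\<lambda>v. G (cx v) (cy v) (cz v)) (p, q, s) = expand_op u1 u2 n (\<lambda>(p, s). G p q s) (p, s)"
  using expand_pullback_coords[of cx cy cz e1 e2 n G "(p, q, s)"]
    expand_pullback_coords[of cy cz cx e2 e3 n "\<lambda>q s p. G p q s" "(p, q, s)"]
    expand_pullback_coords[of cx cz cy e1 e3 n "\<lambda>p s q. G p q s" "(p, q, s)"]
  by simp_all

lemma expand_triple_fun:
  "expand e1 e2 n (\<lambda>v. G (cx v) (cy v) (cz v)) =
     (\<lambda>v. expand u1 u2 n (\<lambda>(p, q). G p q (cz v)) (cx v, cy v))"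
  "expand_op e1 e2 n (\<lambda>v. G (cx v) (cy v) (cz v)) =
     (\<lambda>v. expand_op u1 u2 n (\<lambda>(p, q). G p q (cz v)) (cx v, cy v))"
  "expand e2 e3 n (\<lambda>v. G (cx v) (cy v) (cz v)) =
     (\<lambda>v. expand u1 u2 n (\<lambda>(q, s). G (cx v) q s) (cy v, cz v))"
  "expand_op e2 e3 n (\<lambda>v. G (cx v) (cy v) (cz v)) =
     (\<lambda>v. expand_op u1 u2 n (\<lambda>(q, s). G (cx v) q s) (cy v, cz v))"
  "expand e1 e3 n (\<lambda>v. G (cx v) (cy v) (cz v)) =
     (\<lambda>v. expand u1 u2 n (\<lambda>(p, s). G p (cy v) s) (cx v, cz v))"
  "expand_op e1 e3 n (\<lambda>v. G (cx v) (cy v) (cz v)) =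
     (\<lambda>v. expand_op u1 u2 n (\<lambda>(p, s). G p (cy v) s) (cx v, cz v))"
  using expand_triple[of n G "cx v" "cy v" "cz v" for v] by (auto simp: fun_eq_iff)

lemma field_expand:
  assumes "is_field D" and van: "vanishes_along (u2 - u1) f" "vanishes_along (u1 - u2) g"
  shows "D m (expand u1 u2 n f v - expand_op u1 u2 n g v) =
    expand u1 u2 n (\<lambda>v. D m (f v)) v - expand_op u1 u2 n (\<lambda>v. D m (g v)) v"
  using assms(1) expand_hom[OF van(1), of "D m"] expand_op_hom[OF van(2), of "D m"]
  by (simp add: field_diff field_add field_scale)

lemma field_expand_pair:
  assumes D: "is_field D" and A: "is_field A" and B: "is_field B"
  shows "D m (expand u1 u2 n (\<lambda>(p, q). A p (B q w)) v - expand_op u1 u2 n (\<lambda>(p, q). B q (A p w)) v) =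
    expand u1 u2 n (\<lambda>(p, q). D m (A p (B q w))) v - expand_op u1 u2 n (\<lambda>(p, q). D m (B q (A p w))) v"
  using field_expand[OF D field_pair_vanishes[OF A B]] by (simp add: case_prod_unfold)

context
  fixes A B C :: "int \<Rightarrow> 'w \<Rightarrow> 'w" and N :: nat and w :: 'w
  assumes A: "is_field A" and B: "is_field B" and C: "is_field C"
    and AB: "mode_local N A B" and BC: "mode_local N B C" and AC: "mode_local N A C"
begin

interpretation T: triple_products scale
    "\<lambda>v. A (cx v) (B (cy v) (C (cz v) w))" "\<lambda>v. A (cx v) (C (cz v) (B (cy v) w))"
    "\<lambda>v. B (cy v) (A (cx v) (C (cz v) w))" "\<lambda>v. B (cy v) (C (cz v) (A (cx v) w))"
    "\<lambda>v. C (cz v) (A (cx v) (B (cy v) w))" "\<lambda>v. C (cz v) (B (cy v) (A (cx v) w))" N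
  by (rule triple_products_fields[OF A B C AB BC AC])

text \<open>The four terms are regrouped by the position of C, so that the inner difference of
  expansions is a product of A and B, applied after C or before it.\<close>

lemma Theta_fun: "T.Theta n r v =
    expand e2 e3 r (\<lambda>v. expand u1 u2 n (\<lambda>(p, q). A p (B q (C (cz v) w))) (cx v, cy v)
      - expand_op u1 u2 n (\<lambda>(p, q). B q (A p (C (cz v) w))) (cx v, cy v)) v
    - expand_op e2 e3 r (\<lambda>v. C (cz v) (expand u1 u2 n (\<lambda>(p, q). A p (B q w)) (cx v, cy v)
      - expand_op u1 u2 n (\<lambda>(p, q). B q (A p w)) (cx v, cy v))) v"
proof -
  have e0: "T.Theta n r v =
    expand e2 e3 r (\<lambda>v. expand e1 e2 n (\<lambda>v. A (cx v) (B (cy v) (C (cz v) w))) v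
      - expand_op e1 e2 n (\<lambda>v. B (cy v) (A (cx v) (C (cz v) w))) v) v
    - expand_op e2 e3 r (\<lambda>v. expand e1 e2 n (\<lambda>v. C (cz v) (A (cx v) (B (cy v) w))) v
      - expand_op e1 e2 n (\<lambda>v. C (cz v) (B (cy v) (A (cx v) w))) v) v"
    unfolding T.Theta_def T.Th1_def T.Th2_def
    by (subst expand_diff expand_op_diff, (intro T.truncated_vanish T.truncated_closed T.trunc; fail)+)+
      (simp add: algebra_simps)
  have e1: "(\<lambda>v. expand e1 e2 n (\<lambda>v. C (cz v) (A (cx v) (B (cy v) w))) v
      - expand_op e1 e2 n (\<lambda>v. C (cz v) (B (cy v) (A (cx v) w))) v) =
    (\<lambda>v. C (cz v) (expand u1 u2 n (\<lambda>(p, q). A p (B q w)) (cx v, cy v)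
      - expand_op u1 u2 n (\<lambda>(p, q). B q (A p w)) (cx v, cy v)))"
    by (simp add: expand_triple_fun[where G = "\<lambda>p q s. C s (A p (B q w))"]
        expand_triple_fun[where G = "\<lambda>p q s. C s (B q (A p w))"]
        field_expand_pair[OF C A B])
  show ?thesis
    unfolding e0 e1 by (simp add: expand_triple_fun[where G = "\<lambda>p q s. A p (B q (C s w))"]
        expand_triple_fun[where G = "\<lambda>p q s. B q (A p (C s w))"])
qed

text \<open>The zeros in the index take the residue in x for the inner product and in y for the
  outer one.\<close>

lemma Theta_nprod: "T.Theta n r (0, 0, s) = nprod (nprod A B n) C r s w"
  unfolding Theta_fun nprod_def[of _ C]
  by (simp add: expand_triple[where G = "\<lambda>p q s. expand u1 u2 n (\<lambda>(p, q). A p (B q (C s w))) (p, q)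
      - expand_op u1 u2 n (\<lambda>(p, q). B q (A p (C s w))) (p, q)"]
    expand_triple[where G = "\<lambda>p q s. C s (expand u1 u2 n (\<lambda>(p, q). A p (B q w)) (p, q)
      - expand_op u1 u2 n (\<lambda>(p, q). B q (A p w)) (p, q))"] nprod_def del: prod.collapse)

text \<open>At \<open>r = 0\<close> the outer expansion is trivial, so \<open>q\<close> remains free
  and both modes of the commutator are visible. This is the form needed for locality.\<close>

lemma Theta_commutator: "T.Theta n 0 (0, q, s) = nprod A B n q (C s w) - C s (nprod A B n q w)"
  unfolding Theta_fun by (simp add: expand_0 expand_op_0 nprod_def)

lemma Xi_nprod: "T.Xi P Q (0, 0, s) = nprod A (nprod B C Q) P s w"
proof -
  have 1: "(\<lambda>v. expand e2 e3 Q (\<lambda>v. A (cx v) (B (cy v) (C (cz v) w))) v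
      - expand_op e2 e3 Q (\<lambda>v. A (cx v) (C (cz v) (B (cy v) w))) v) =
    (\<lambda>v. A (cx v) (expand u1 u2 Q (\<lambda>(q, s). B q (C s w)) (cy v, cz v)
      - expand_op u1 u2 Q (\<lambda>(q, s). C s (B q w)) (cy v, cz v)))"
    by (simp add: expand_triple_fun[where G = "\<lambda>p q s. A p (B q (C s w))"]
        expand_triple_fun[where G = "\<lambda>p q s. A p (C s (B q w))"]
        field_expand_pair[OF A B C])
  have 2: "(\<lambda>v. expand e2 e3 Q (\<lambda>v. B (cy v) (C (cz v) (A (cx v) w))) v
      - expand_op e2 e3 Q (\<lambda>v. C (cz v) (B (cy v) (A (cx v) w))) v) =
    (\<lambda>v. expand u1 u2 Q (\<lambda>(q, s). B q (C s (A (cx v) w))) (cy v, cz v)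
      - expand_op u1 u2 Q (\<lambda>(q, s). C s (B q (A (cx v) w))) (cy v, cz v))"
    by (simp add: expand_triple_fun[where G = "\<lambda>p q s. B q (C s (A p w))"]
        expand_triple_fun[where G = "\<lambda>p q s. C s (B q (A p w))"])
  show ?thesis
    unfolding T.Xi_def T.Xi1_def T.Xi2_def 1 2 nprod_def[of A]
    by (simp add: expand_triple[where G = "\<lambda>p q s. A p (expand u1 u2 Q (\<lambda>(q, s). B q (C s w)) (q, s)
        - expand_op u1 u2 Q (\<lambda>(q, s). C s (B q w)) (q, s))"]
      expand_triple[where G = "\<lambda>p q s. expand u1 u2 Q (\<lambda>(q, s). B q (C s (A p w))) (q, s)
        - expand_op u1 u2 Q (\<lambda>(q, s). C s (B q (A p w))) (q, s)"] nprod_def del: prod.collapse)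
qed

lemma Xi'_nprod: "T.Xi' P Q (0, 0, s) = nprod B (nprod A C P) Q s w"
proof -
  have e0: "T.Xi' P Q v =
    expand e2 e3 Q (\<lambda>v. expand e1 e3 P (\<lambda>v. B (cy v) (A (cx v) (C (cz v) w))) v
      - expand_op e1 e3 P (\<lambda>v. B (cy v) (C (cz v) (A (cx v) w))) v) v
    - expand_op e2 e3 Q (\<lambda>v. expand e1 e3 P (\<lambda>v. A (cx v) (C (cz v) (B (cy v) w))) v
      - expand_op e1 e3 P (\<lambda>v. C (cz v) (A (cx v) (B (cy v) w))) v) v" for v
    unfolding T.Xi'_def
    by (subst expand_diff expand_op_diff, (intro T.truncated_vanish T.truncated_closed T.trunc; fail)+)+
      (simp add: algebra_simps)
  have e1: "(\<lambda>v. expand e1 e3 P (\<lambda>v. B (cy v) (A (cx v) (C (cz v) w))) v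
      - expand_op e1 e3 P (\<lambda>v. B (cy v) (C (cz v) (A (cx v) w))) v) =
    (\<lambda>v. B (cy v) (expand u1 u2 P (\<lambda>(p, s). A p (C s w)) (cx v, cz v)
      - expand_op u1 u2 P (\<lambda>(p, s). C s (A p w)) (cx v, cz v)))"
    by (simp add: expand_triple_fun[where G = "\<lambda>p q s. B q (A p (C s w))"]
        expand_triple_fun[where G = "\<lambda>p q s. B q (C s (A p w))"]
        field_expand_pair[OF B A C])
  have e2: "(\<lambda>v. expand e1 e3 P (\<lambda>v. A (cx v) (C (cz v) (B (cy v) w))) v
      - expand_op e1 e3 P (\<lambda>v. C (cz v) (A (cx v) (B (cy v) w))) v) =
    (\<lambda>v. expand u1 u2 P (\<lambda>(p, s). A p (C s (B (cy v) w))) (cx v, cz v)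
      - expand_op u1 u2 P (\<lambda>(p, s). C s (A p (B (cy v) w))) (cx v, cz v))"
    by (simp add: expand_triple_fun[where G = "\<lambda>p q s. A p (C s (B q w))"]
        expand_triple_fun[where G = "\<lambda>p q s. C s (A p (B q w))"])
  show ?thesis
    unfolding e0 e1 e2 nprod_def[of B]
    by (simp add: expand_triple[where G = "\<lambda>p q s. B q (expand u1 u2 P (\<lambda>(p, s). A p (C s w)) (p, s)
        - expand_op u1 u2 P (\<lambda>(p, s). C s (A p w)) (p, s))"]
      expand_triple[where G = "\<lambda>p q s. expand u1 u2 P (\<lambda>(p, s). A p (C s (B q w))) (p, s)
        - expand_op u1 u2 P (\<lambda>(p, s). C s (A p (B q w))) (p, s)"] nprod_def del: prod.collapse)
qed

theorem nprod_borcherds: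
  "iterate_sum (\<lambda>n r. nprod (nprod A B n) C r s w) p q n =
     expand u1 u2 n (\<lambda>(P, Q). nprod A (nprod B C Q) P s w) (p, q)
     - expand_op u1 u2 n (\<lambda>(P, Q). nprod B (nprod A C P) Q s w) (p, q)"
  using T.Theta_borcherds[of "(0, 0, s)" p q n] by (simp only: Theta_nprod Xi_nprod Xi'_nprod)

lemma nprod_dong_vector:
  assumes r: "int r \<ge> 3 * int N - n" "r \<ge> N"
  shows "(shift_diff u1 u2 ^^ r) (\<lambda>(q, s). nprod A B n q (C s w)) (q, s) =
    (shift_diff u1 u2 ^^ r) (\<lambda>(q, s). C s (nprod A B n q w)) (q, s)"
proof -
  \<comment> \<open>Multiplying the commutator by \<open>(y - z)^r\<close> gives the member
    \<open>r\<close> of the family, to which \<open>Theta_dong\<close> applies.\<close>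
  have "(shift_diff e2 e3 ^^ r) (T.Theta n 0) = T.Theta n (int r)"
    by (induction r) (auto simp: T.Theta_steps add.commute)
  then have "(shift_diff e2 e3 ^^ r) (T.Theta n 0) (0, q, s) = 0"
    using T.Theta_dong[of n "int r"] r by simp
  moreover have "(shift_diff e2 e3 ^^ r) (T.Theta n 0) (0, q, s) =
      (shift_diff u1 u2 ^^ r) (\<lambda>(q, s). T.Theta n 0 (0, q, s)) (q, s)"
    using shift_diff_funpow_pullback[where h = snd and a' = e2 and b' = e3 and a = u1 and b = u2
        and \<kappa> = fst and F = "\<lambda>p u. T.Theta n 0 (p, u)" and v = "(0, q, s)" and n = r]
    by (simp add: case_prod_unfold)
  ultimately have "(shift_diff u1 u2 ^^ r) (\<lambda>u. (\<lambda>(q, s). nprod A B n q (C s w)) u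
      - (\<lambda>(q, s). C s (nprod A B n q w)) u) (q, s) = 0"
    by (simp add: Theta_commutator case_prod_unfold)
  then show ?thesis by (simp only: shift_diff_funpow_minus) simp
qed

end

lemma nprod_dong:
  assumes "is_field A" "is_field B" "is_field C"
    and "mode_local N A B" "mode_local N B C" "mode_local N A C"
  shows "\<exists>M. mode_local M (nprod A B n) C"
  \<comment> \<open>The exponent exceeds both \<open>3 * N - n\<close> and \<open>N\<close>,
    whatever the sign of \<open>n\<close>.\<close>
  using nprod_dong_vector[OF assms, of n "nat (3 * int N + \<bar>n\<bar>)"]
  unfolding mode_local_def by (intro exI[of _ "nat (3 * int N + \<bar>n\<bar>)"]) auto

end

section \<open>The space V(T,0)\<close>

lemma lookup_fscale: "Poly_Mapping.lookup (fscale c p) k = c * Poly_Mapping.lookup p k"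
  by (simp add: fscale_def map.rep_eq when_def)

lemma complex_vector_space_fscale: "complex_vector_space fscale"
  unfolding complex_vector_space_def
  by unfold_locales (auto intro!: poly_mapping_eqI simp: lookup_fscale lookup_add algebra_simps)

context complex_vector_space
begin

definition lin_ext :: "('k \<Rightarrow> 'w) \<Rightarrow> ('k \<Rightarrow>\<^sub>0 complex) \<Rightarrow> 'w" where
  "lin_ext F p = (\<Sum>k\<in>Poly_Mapping.keys p. scale (Poly_Mapping.lookup p k) (F k))"

lemma lin_ext_superset:
  "finite S \<Longrightarrow> Poly_Mapping.keys p \<subseteq> S \<Longrightarrow>
    lin_ext F p = (\<Sum>k\<in>S. scale (Poly_Mapping.lookup p k) (F k))"
  unfolding lin_ext_def by (intro sum.mono_neutral_left) (auto simp: in_keys_iff)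

lemma lin_ext_add: "lin_ext F (p + q) = lin_ext F p + lin_ext F q"
  by (simp add: lin_ext_superset[of "Poly_Mapping.keys p \<union> Poly_Mapping.keys q"] keys_add
      lookup_add scale_left_distrib sum.distrib)

lemma lin_ext_0 [simp]: "lin_ext F 0 = 0"
  by (simp add: lin_ext_def)

lemma lin_ext_uminus: "lin_ext F (- p) = - lin_ext F p"
  using lin_ext_add[of F p "- p"] by (simp add: eq_neg_iff_add_eq_0 add.commute)

lemma lin_ext_diff: "lin_ext F (p - q) = lin_ext F p - lin_ext F q"
  using lin_ext_add[of F p "- q"] by (simp add: lin_ext_uminus)

lemma lin_ext_fscale: "lin_ext F (fscale c p) = scale c (lin_ext F p)"
proof -
  have "Poly_Mapping.keys (fscale c p) \<subseteq> Poly_Mapping.keys p"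
    by (auto simp: in_keys_iff lookup_fscale)
  then show ?thesis
    by (simp add: lin_ext_superset[of "Poly_Mapping.keys p"] lookup_fscale scale_sum_right)
qed

lemma lin_ext_single: "lin_ext F (Poly_Mapping.single k c) = scale c (F k)"
  by (simp add: lin_ext_def lookup_single)

lemma lin_ext_bv: "lin_ext F (bv u t) = F (u, t)"
  by (simp add: bv_def lin_ext_single)

lemmas lin_ext_simps = lin_ext_add lin_ext_uminus lin_ext_diff lin_ext_fscale lin_ext_bv

end

interpretation fs: complex_vector_space fscale
  by (rule complex_vector_space_fscale)

lemma lmul_lin_ext: "lmul x = fs.lin_ext (\<lambda>k. bv (x # fst k) (snd k))"
  by (rule ext) (simp add: lmul_def fs.lin_ext_def bv_def fscale_def)

text \<open>Every relation is stated with an arbitrary word to its left, so prefixing a letter gives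
  a relation of the same kind.\<close>

lemma lmul_vrel: "p \<in> vrel \<Longrightarrow> lmul x p \<in> vrel"
proof (induction rule: vrel.induct)
  case (lin_add u a b m M v t)
  then show ?case using vrel.lin_add[of "x # u" a b m M v t]
    by (simp add: lmul_lin_ext fs.lin_ext_simps)
next
  case (lin_scale u c a m M v t)
  then show ?case using vrel.lin_scale[of "x # u" c a m M v t]
    by (simp add: lmul_lin_ext fs.lin_ext_simps)
next
  case (comm_GG u a m M b n N v t)
  then show ?case using vrel.comm_GG[of "x # u" a m M b n N v t]
    by (simp add: lmul_lin_ext fs.lin_ext_simps split: if_splits)
next
  case (comm_GC u a m M N v t)
  then show ?case using vrel.comm_GC[of "x # u" a m M N v t]
    by (simp add: lmul_lin_ext fs.lin_ext_simps)
next
  case (comm_CC u M N v t)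
  then show ?case using vrel.comm_CC[of "x # u" M N v t]
    by (simp add: lmul_lin_ext fs.lin_ext_simps)
next
  case (ind_0 w a M b)
  then show ?case using vrel.ind_0[of "x # w" a M b]
    by (simp add: lmul_lin_ext fs.lin_ext_simps)
next
  case (ind_1 w a M b)
  then show ?case using vrel.ind_1[of "x # w" a M b]
    by (simp add: lmul_lin_ext fs.lin_ext_simps)
next
  case (ind_ge2 k w a M b)
  then show ?case using vrel.ind_ge2[of k "x # w" a M b]
    by (simp add: lmul_lin_ext fs.lin_ext_simps)
next
  case (ind_c k w a M)
  then show ?case using vrel.ind_c[of k "x # w" a M]
    by (simp add: lmul_lin_ext fs.lin_ext_simps)
next
  case (ind_unit k w a M)
  then show ?case using vrel.ind_unit[of k "x # w" a M]
    by (simp add: lmul_lin_ext fs.lin_ext_simps)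
next
  case (tlin_add w a b)
  then show ?case using vrel.tlin_add[of "x # w" a b]
    by (simp add: lmul_lin_ext fs.lin_ext_simps)
next
  case (tlin_scale w c a)
  then show ?case using vrel.tlin_scale[of "x # w" c a]
    by (simp add: lmul_lin_ext fs.lin_ext_simps)
qed (simp_all add: lmul_lin_ext fs.lin_ext_simps vrel.zero vrel.add vrel.neg vrel.scale)

lemma abs_rep_vt0: "abs_vt0 (rep_vt0 v) = v"
  by (rule Quotient3_abs_rep[OF Quotient3_vt0])

lemma rep_abs_vt0: "rep_vt0 (abs_vt0 p) - p \<in> vrel"
  using abs_rep_vt0[of "abs_vt0 p"] by (simp add: vt0.abs_eq_iff)

lemma vscale_abs: "vscale c (abs_vt0 p) = abs_vt0 (fscale c p)"
  using vrel.scale[OF rep_abs_vt0[of p], of c]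
  by (simp add: vscale_def vt0.abs_eq_iff fs.scale_right_diff_distrib)

lemma vact_abs: "vact x (abs_vt0 p) = abs_vt0 (lmul x p)"
  using lmul_vrel[OF rep_abs_vt0[of p], of x]
  by (simp add: vact_def vt0.abs_eq_iff lmul_lin_ext fs.lin_ext_diff)

lemma vact_bv: "vact x (abs_vt0 (bv u t)) = abs_vt0 (bv (x # u) t)"
  by (simp add: vact_abs lmul_lin_ext fs.lin_ext_bv)

lemma complex_vector_space_vscale: "complex_vector_space (vscale :: complex \<Rightarrow> ('g::lie_data, 'r::finite) vt0 \<Rightarrow> _)"
  unfolding complex_vector_space_def
proof unfold_locales
  fix a b :: complex and x y :: "('g, 'r) vt0"
  obtain p q where x: "x = abs_vt0 p" "y = abs_vt0 q" by (metis abs_rep_vt0)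
  show "vscale a (x + y) = vscale a x + vscale a y"
    by (simp add: x vscale_abs plus_vt0.abs_eq fs.scale_right_distrib)
  show "vscale (a + b) x = vscale a x + vscale b x"
    by (simp add: x vscale_abs plus_vt0.abs_eq fs.scale_left_distrib)
  show "vscale a (vscale b x) = vscale (a * b) x" "vscale 1 x = x"
    by (simp_all add: x vscale_abs)
qed

lemma vact_add: "vact x (u + v) = vact x u + vact x v"
proof -
  obtain p q where "u = abs_vt0 p" "v = abs_vt0 q" by (metis abs_rep_vt0)
  then show ?thesis by (simp add: vact_abs plus_vt0.abs_eq lmul_lin_ext fs.lin_ext_add)
qed

lemma vact_scale: "vact x (vscale c v) = vscale c (vact x v)"
proof -
  obtain p where "v = abs_vt0 p" by (metis abs_rep_vt0)
  then show ?thesis by (simp add: vact_abs vscale_abs lmul_lin_ext fs.lin_ext_fscale)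
qed

lemma vt0_bv_induct [case_names bv add scale]:
  fixes v :: "('a::lie_data, 'b::finite) vt0"
  assumes bv: "\<And>u t. P (abs_vt0 (bv u t))" and add: "\<And>u v. P u \<Longrightarrow> P v \<Longrightarrow> P (u + v)"
    and sc: "\<And>c v. P v \<Longrightarrow> P (vscale c v)"
  shows "P v"
proof -
  interpret vs: complex_vector_space "vscale :: complex \<Rightarrow> ('a, 'b) vt0 \<Rightarrow> _"
    by (rule complex_vector_space_vscale)
  have z: "P 0" using sc[OF bv, of 0] by simp
  have s: "P (abs_vt0 (\<Sum>k\<in>S. fscale (c k) (bv (fst k) (snd k))))" if "finite S" for S c
    using that
  proof (induction S)
    case empty
    then show ?case using z by (simp add: zero_vt0.abs_eq)
  next
    case (insert k S)
    then show ?case by (simp add: plus_vt0.abs_eq[symmetric] vscale_abs[symmetric] add sc bv)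
  qed
  have eq: "rep_vt0 v = (\<Sum>k\<in>Poly_Mapping.keys (rep_vt0 v).
      fscale (Poly_Mapping.lookup (rep_vt0 v) k) (bv (fst k) (snd k)))" (is "?p = ?q")
  proof (rule poly_mapping_eqI)
    fix i
    have "Poly_Mapping.lookup ?q i =
        (\<Sum>k\<in>Poly_Mapping.keys ?p. if i = k then Poly_Mapping.lookup ?p k else 0)"
      unfolding lookup_sum by (rule sum.cong) (auto simp: lookup_fscale bv_def lookup_single when_def)
    then show "Poly_Mapping.lookup ?p i = Poly_Mapping.lookup ?q i"
      by (simp add: in_keys_iff)
  qed
  have "P (abs_vt0 ?q)" by (rule s[OF finite_keys])
  then have "P (abs_vt0 ?p)" by (subst eq)
  then show ?thesis by (simp only: abs_rep_vt0)
qed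

lemma vt0_induct [case_names tinc act add scale]:
  assumes "\<And>t. P (tinc t)" "\<And>x v. P v \<Longrightarrow> P (vact x v)" "\<And>u v. P u \<Longrightarrow> P v \<Longrightarrow> P (u + v)"
    and "\<And>c v. P v \<Longrightarrow> P (vscale c v)"
  shows "P v"
proof (induction v rule: vt0_bv_induct)
  case (bv u t)
  show ?case
  proof (induction u)
    case Nil
    then show ?case using assms(1)[of t] by (simp add: tinc_def)
  next
    case (Cons x u)
    then show ?case using assms(2)[of "abs_vt0 (bv u t)" x] by (simp add: vact_bv)
  qed
qed (use assms in auto)

lemma abs_vt0_eqI: "p - q \<in> vrel \<Longrightarrow> abs_vt0 p = abs_vt0 q"
  by (simp add: vt0.abs_eq_iff)

lemma tinc_add: "tinc (Tg (a + b)) = tinc (Tg a) + tinc (Tg b)"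
  unfolding tinc_def plus_vt0.abs_eq
  by (rule abs_vt0_eqI) (use vrel.tlin_add[of "[]" a b] in \<open>simp add: diff_diff_eq\<close>)

lemma tinc_scale: "tinc (Tg (lscale c a)) = vscale c (tinc (Tg a))"
  unfolding tinc_def vscale_abs by (rule abs_vt0_eqI) (rule vrel.tlin_scale)

lemma vact_TG_0: "vact (TG a 0 M) (tinc (Tg b)) = tinc (Tg (lbr a b))"
  unfolding tinc_def vact_bv by (rule abs_vt0_eqI) (use vrel.ind_0[of "[]" a M b] in simp)

lemma vact_TG_1: "vact (TG a 1 M) (tinc (Tg b)) = vscale (lform a b) (tinc Tc)"
  unfolding tinc_def vact_bv vscale_abs
  by (rule abs_vt0_eqI) (use vrel.ind_1[of "[]" a M b] in simp)

lemma vact_TG_ge2: "k \<ge> 2 \<Longrightarrow> vact (TG a k M) (tinc (Tg b)) = 0"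
  unfolding tinc_def vact_bv zero_vt0.abs_eq
  by (rule abs_vt0_eqI) (use vrel.ind_ge2[of k "[]" a M b] in simp)

lemma vact_TG_Tc: "k \<ge> 0 \<Longrightarrow> vact (TG a k M) (tinc Tc) = 0"
  unfolding tinc_def vact_bv zero_vt0.abs_eq
  by (rule abs_vt0_eqI) (use vrel.ind_c[of k "[]" a M] in simp)

section \<open>Fields on a restricted module\<close>

context complex_vector_space
begin

text \<open>With the degrees \<open>M\<close> and \<open>K\<close> frozen, the coefficientwise
  Jacobi identity is the one-variable Borcherds identity in the indices
  \<open>(p, q)\<close>.\<close>

lemma jacobi_iff:
  "jacobi Y scale YW \<longleftrightarrow> (\<forall>u v w p q n M K.
    iterate_sum (\<lambda>n r. YW (Y u n M v) r K w) p q n =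
    expand u1 u2 n (\<lambda>(p, q). YW u p M (YW v q (K - M) w)) (p, q)
    - expand_op u1 u2 n (\<lambda>(p, q). YW v q (K - M) (YW u p M w)) (p, q))"
  unfolding jacobi_def iterate_sum_def expand_def expand_op_def
  by (simp add: zmul_Pair zmul_int algebra_simps)

text \<open>The two spaces may differ: this carries an expansion formed in V(T,0) to W along
  \<open>x \<mapsto> ind_Y x r K w\<close>, or along a module homomorphism.\<close>

lemma expand_hom_from:
  assumes "complex_vector_space sc" and f: "vanishes_along (b - a) f"
    and add: "\<And>x y. \<phi> (x + y) = \<phi> x + \<phi> y" and s: "\<And>c x. \<phi> (sc c x) = scale c (\<phi> x)"
  shows "\<phi> (complex_vector_space.expand sc a b n f v) = expand a b n (\<lambda>v. \<phi> (f v)) v"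
proof -
  interpret V: complex_vector_space sc by fact
  obtain k where k: "\<And>i. i \<ge> k \<Longrightarrow> f (v + zmul n a + zmul (int i) (b - a)) = 0"
    using expand_bound[OF f] by metis
  show ?thesis unfolding expand_def V.expand_def
    by (subst fsum_hom[where k = k and \<phi> = \<phi>]) (auto simp: add s k)
qed

lemma expand_op_hom_from:
  assumes V: "complex_vector_space sc" and f: "vanishes_along (a - b) f"
    and add: "\<And>x y. \<phi> (x + y) = \<phi> x + \<phi> y" and s: "\<And>c x. \<phi> (sc c x) = scale c (\<phi> x)"
  shows "\<phi> (complex_vector_space.expand_op sc a b n f v) = expand_op a b n (\<lambda>v. \<phi> (f v)) v"
  using expand_hom_from[OF V f add s] by (simp add: expand_op_def complex_vector_space.expand_op_def[OF V] s)

definition mutually_local :: "(int \<Rightarrow> 'w \<Rightarrow> 'w) \<Rightarrow> (int \<Rightarrow> 'w \<Rightarrow> 'w) \<Rightarrow> bool" where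
  "mutually_local A B \<longleftrightarrow> (\<exists>N. mode_local N A B)"

lemma mutually_local_sym: "mutually_local A B \<Longrightarrow> mutually_local B A"
  unfolding mutually_local_def using mode_local_sym by blast

lemma mutually_local_triple:
  assumes "mutually_local A B" "mutually_local B C" "mutually_local A C"
  obtains N where "mode_local N A B" "mode_local N B C" "mode_local N A C"
proof -
  obtain i j k where l: "mode_local i A B" "mode_local j B C" "mode_local k A C"
    using assms unfolding mutually_local_def by blast
  then show ?thesis
    using that[of "max i (max j k)"] l[THEN mode_local_mono, of "max i (max j k)"] by simp
qed

lemma mutually_local_nprod:
  assumes "is_field A" "is_field B" "is_field C"
    and "mutually_local A B" "mutually_local B C" "mutually_local A C"
  shows "mutually_local (nprod A B n) C"
proof -
  obtain N where "mode_local N A B" "mode_local N B C" "mode_local N A C"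
    using mutually_local_triple[OF assms(4-6)] .
  then show ?thesis unfolding mutually_local_def by (rule nprod_dong[OF assms(1-3)])
qed

text \<open>The case \<open>p = 0\<close> of the Borcherds identity; \<open>nprod_commutator\<close>
  is the case of exponent \<open>0\<close>.\<close>

lemma nprod_associator:
  assumes "is_field A" "is_field B" "is_field C"
    and "mutually_local A B" "mutually_local B C" "mutually_local A C"
  shows "nprod (nprod A B m) C n s w =
     expand u1 u2 m (\<lambda>(P, Q). nprod A (nprod B C Q) P s w) (0, n)
     - expand_op u1 u2 m (\<lambda>(P, Q). nprod B (nprod A C P) Q s w) (0, n)"
proof -
  obtain N where "mode_local N A B" "mode_local N B C" "mode_local N A C"
    using mutually_local_triple[OF assms(4-6)] .
  from nprod_borcherds[OF assms(1-3) this, of s w 0 n m] show ?thesis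
    by (simp only: iterate_sum_zero_left)
qed

lemma nprod_commutator:
  assumes "is_field A" "is_field B" "is_field C"
    and "mutually_local A B" "mutually_local B C" "mutually_local A C"
  shows "nprod A (nprod B C n) m s w - nprod B (nprod A C m) n s w =
    iterate_sum (\<lambda>n r. nprod (nprod A B n) C r s w) m n 0"
proof -
  obtain N where "mode_local N A B" "mode_local N B C" "mode_local N A C"
    using mutually_local_triple[OF assms(4-6)] .
  from nprod_borcherds[OF assms(1-3) this, of s w m n 0] show ?thesis
    by (simp add: expand_0 expand_op_0)
qed

lemma mode_local_commuting:
  "(\<And>p q w. A p (B q w) = B q (A p w)) \<Longrightarrow> mode_local 0 A B"
  by (simp add: mode_local_def)

lemma zero_field: "is_field (\<lambda>m w. 0)"
  by (simp add: is_field_def)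

lemma nprod_zero_left: "nprod (\<lambda>m w. 0) B n q w = 0" if "is_field B"
  using nprod_bilinear(4)[OF zero_field zero_field that that, of 0 n q w] by simp

text \<open>For commuting fields all products of index \<open>\<ge> 0\<close> vanish, and these are
  the only ones in the commutator formula.\<close>

lemma nprod_swap:
  assumes F: "is_field A" "is_field B" "is_field C" and c: "\<And>p q w. A p (B q w) = B q (A p w)"
    and "mutually_local B C" "mutually_local A C"
  shows "nprod A (nprod B C n) m s w = nprod B (nprod A C m) n s w"
proof -
  have l: "mode_local 0 A B" by (rule mode_local_commuting) (rule c)
  have z: "nprod A B j = (\<lambda>q w. 0)" if "j \<ge> 0" for j
    by (intro ext nprod_eq_0[OF F(1,2) l]) (simp add: that)
  have "iterate_sum (\<lambda>n r. nprod (nprod A B n) C r s w) m n 0 = 0"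
  proof (rule iterate_sum_eq_0[of 0])
    show "nprod (nprod A B n) C r s w = 0" if "n \<ge> 0" for n r
      unfolding z[OF that] by (rule nprod_zero_left[OF F(3)])
  qed simp
  moreover have "mutually_local A B" using l unfolding mutually_local_def by blast
  ultimately show ?thesis
    using nprod_commutator[OF F _ assms(5,6), of n m s w] by simp
qed

lemma mutually_local_add:
  assumes "mutually_local A C" "mutually_local B C" "is_field A" "is_field B" "is_field C"
  shows "mutually_local (\<lambda>m w. A m w + B m w) C"
proof -
  obtain N M where "mode_local N A C" "mode_local M B C" using assms unfolding mutually_local_def by blast
  then have l: "mode_local (max N M) A C" "mode_local (max N M) B C"
    using mode_local_mono[of N A C "max N M"] mode_local_mono[of M B C "max N M"] by simp_all
  have e: "(\<lambda>(p, q). f p q + g p q) = (\<lambda>v. (\<lambda>(p, q). f p q) v - - (\<lambda>(p, q). g p q) v)"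
    for f g :: "int \<Rightarrow> int \<Rightarrow> 'w" by auto
  have m: "(shift_diff a b ^^ n) (\<lambda>v. - f v) = (\<lambda>v. - (shift_diff a b ^^ n) f v)"
    for a b :: "int \<times> int" and f :: "_ \<Rightarrow> 'w" and n
    by (rule shift_diff_funpow_hom) simp
  have "mode_local (max N M) (\<lambda>m w. A m w + B m w) C"
    using l unfolding mode_local_def
    by (simp only: field_add[OF assms(5)] e shift_diff_funpow_minus m) simp
  then show ?thesis by (auto simp: mutually_local_def)
qed

lemma mutually_local_scale:
  assumes "mutually_local A C" "is_field C"
  shows "mutually_local (\<lambda>m w. scale c (A m w)) C"
proof -
  obtain N where l: "mode_local N A C" using assms unfolding mutually_local_def by blast
  have e: "(\<lambda>(p, q). scale c (f p q)) = (\<lambda>v. scale c ((\<lambda>(p, q). f p q) v))"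
    for f :: "int \<Rightarrow> int \<Rightarrow> 'w" by auto
  have m: "(shift_diff a b ^^ n) (\<lambda>v. scale c (f v)) = (\<lambda>v. scale c ((shift_diff a b ^^ n) f v))"
    for a b :: "int \<times> int" and f :: "_ \<Rightarrow> 'w" and n
    by (rule shift_diff_funpow_hom) (simp add: scale_right_diff_distrib)
  have "mode_local N (\<lambda>m w. scale c (A m w)) C"
    using l unfolding mode_local_def
    by (simp only: field_scale[OF assms(2)] e m) simp
  then show ?thesis by (auto simp: mutually_local_def)
qed

end

text \<open>Left multiplication by a spanning element \<open>x\<close> of \<open>tau\<close> on \<open>V(T,0)\<close> is the mode \<open>tg_mode x\<close>, of
  degree \<open>tg_deg x\<close>, of the vector \<open>tg_vec x\<close> of \<open>T\<close>.\<close>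

fun tg_vec :: "('g, 'r::finite) tgen \<Rightarrow> 'g tvec" where
  "tg_vec (TG a n M) = Tg a"
| "tg_vec (TC M) = Tc"

fun tg_mode :: "('g, 'r::finite) tgen \<Rightarrow> int" where
  "tg_mode (TG a n M) = n"
| "tg_mode (TC M) = -1"

fun tg_deg :: "('g, 'r::finite) tgen \<Rightarrow> int^'r" where
  "tg_deg (TG a n M) = M"
| "tg_deg (TC M) = M"

locale restricted_tau_module = complex_vector_space scale
  for scale :: "complex \<Rightarrow> 'w::ab_group_add \<Rightarrow> 'w" +
  fixes act :: "'g::lie_data \<Rightarrow> int \<Rightarrow> int^'r::finite \<Rightarrow> 'w \<Rightarrow> 'w" and cact :: "int^'r \<Rightarrow> 'w \<Rightarrow> 'w"
  assumes tau: "tau_module scale act cact" and restr: "restricted act"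
begin

lemma act_simps:
  "act a m M (x + y) = act a m M x + act a m M y"
  "act a m M (scale c x) = scale c (act a m M x)"
  "cact M (x + y) = cact M x + cact M y"
  "cact M (scale c x) = scale c (cact M x)"
  "act (a + b) m M w = act a m M w + act b m M w"
  "act (lscale c a) m M w = scale c (act a m M w)"
  using tau unfolding tau_module_def by (auto simp: Vector_Spaces.linear_iff)

lemma act_bracket: "act a m M (act b n L w) - act b n L (act a m M w) =
    act (lbr a b) (m + n) (M + L) w +
    (if m + n = 0 then scale (of_int m * lform a b) (cact (M + L) w) else 0)"
  and cact_act: "cact M (act a n L w) = act a n L (cact M w)"
  and cact_cact: "cact M (cact L w) = cact L (cact M w)"
  using tau unfolding tau_module_def by blast+

lemma act_zero: "act a m M 0 = 0" "cact M 0 = 0"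
  using act_simps(1)[of a m M 0 0] act_simps(3)[of M 0 0] by simp_all

section \<open>Generating fields and their products\<close>

definition gen :: "'g tvec \<Rightarrow> int^'r \<Rightarrow> int \<Rightarrow> 'w \<Rightarrow> 'w" where
  "gen t M m w = (case t of Tg a \<Rightarrow> act a m M w | Tc \<Rightarrow> if m = -1 then cact M w else 0
     | T1 \<Rightarrow> if m = -1 then if M = 0 then w else 0 else 0)"

lemma gen_truncated: "\<exists>N. \<forall>M m. m \<ge> N \<longrightarrow> gen t M m w = 0"
proof (cases t)
  case (Tg a)
  then show ?thesis using restr by (simp add: gen_def restricted_def) blast
qed (rule exI[of _ 0], simp add: gen_def)+

lemma gen_field: "is_field (gen t M)"
  unfolding is_field_def
proof (intro conjI allI)
  fix m c x y
  show "gen t M m (x + y) = gen t M m x + gen t M m y" "gen t M m (scale c x) = scale c (gen t M m x)"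
    by (simp_all add: gen_def act_simps split: tvec.split)
  show "\<exists>N. \<forall>m\<ge>N. gen t M m x = 0" using gen_truncated by blast
qed

lemma gen_commute:
  assumes "\<forall>a b. t = Tg a \<longrightarrow> t' \<noteq> Tg b"
  shows "gen t M p (gen t' L q w) = gen t' L q (gen t M p w)"
  using assms by (auto simp: gen_def act_zero cact_act cact_cact split: tvec.splits)

lemma gen_bracket: "gen (Tg a) M p (gen (Tg b) L q w) - gen (Tg b) L q (gen (Tg a) M p w) =
    gen (Tg (lbr a b)) (M + L) (p + q) w + scale (of_int p * lform a b) (gen Tc (M + L) (p + q - 1) w)"
  using act_bracket[of a p M b q L w] by (simp add: gen_def)

text \<open>At fixed \<open>p + q\<close> the commutator of modes is an affine function of
  \<open>p\<close>, and \<open>(x - y)^2\<close> takes its second difference.\<close>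

lemma gen_mode_local: "mode_local 2 (gen (Tg a) M) (gen (Tg b) L)"
proof -
  have "(shift_diff u1 u2 ^^ 2) (\<lambda>u. (\<lambda>(p, q). gen (Tg a) M p (gen (Tg b) L q w)) u
      - (\<lambda>(p, q). gen (Tg b) L q (gen (Tg a) M p w)) u) (p, q) = 0" for w p q
  proof -
    define f where "f p q = gen (Tg a) M p (gen (Tg b) L q w) - gen (Tg b) L q (gen (Tg a) M p w)" for p q
    have "f (p + 1 + 1) q - f (p + 1) (q + 1) - (f (p + 1) (q + 1) - f p (q + 1 + 1)) = 0"
    proof -
      have e: "p + 1 + 1 + q = p + q + 2" "p + 1 + (q + 1) = p + q + 2" "p + (q + 1 + 1) = p + q + 2" by auto
      have s: "scale (of_int (k + 1) * l) y = scale (of_int k * l) y + scale l y" for k l y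
        by (simp add: distrib_right scale_left_distrib)
      show ?thesis unfolding f_def gen_bracket e s by simp
    qed
    then show ?thesis by (simp add: numeral_2_eq_2 shift_diff_def f_def add.commute)
  qed
  then show ?thesis unfolding mode_local_def shift_diff_funpow_minus by (auto simp: fun_eq_iff)
qed

lemma gen_mutually_local: "mutually_local (gen t M) (gen t' L)"
proof (cases "\<exists>a b. t = Tg a \<and> t' = Tg b")
  case True
  then show ?thesis using gen_mode_local unfolding mutually_local_def by blast
next
  case False
  then have "mode_local 0 (gen t M) (gen t' L)" by (intro mode_local_commuting gen_commute) auto
  then show ?thesis unfolding mutually_local_def by blast
qed

text \<open>The nonnegative products of generating fields reproduce the action of
  \<open>L_r(b)\<close> on \<open>T\<close>; this is what makes the balancing relations hold for
  fields.\<close>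

lemma nprod_gen:
  "nprod (gen (Tg a) M) (gen (Tg b) L) 0 = gen (Tg (lbr a b)) (M + L)"
  "nprod (gen (Tg a) M) (gen (Tg b) L) 1 = (\<lambda>q w. scale (lform a b) (gen Tc (M + L) q w))"
  "n \<ge> 2 \<Longrightarrow> nprod (gen (Tg a) M) (gen (Tg b) L) n = (\<lambda>q w. 0)"
proof -
  note van = field_pair_vanishes[OF gen_field[of "Tg a" M] gen_field[of "Tg b" L]]
  show "nprod (gen (Tg a) M) (gen (Tg b) L) 0 = gen (Tg (lbr a b)) (M + L)"
    using gen_bracket[of a M 0 b L] by (auto simp: fun_eq_iff nprod_def expand_0 expand_op_0)
  have "nprod (gen (Tg a) M) (gen (Tg b) L) 1 q w = scale (lform a b) (gen Tc (M + L) q w)" for q w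
  proof -
    have "nprod (gen (Tg a) M) (gen (Tg b) L) 1 q w =
      (gen (Tg a) M 1 (gen (Tg b) L q w) - gen (Tg b) L q (gen (Tg a) M 1 w)) -
      (gen (Tg a) M 0 (gen (Tg b) L (q + 1) w) - gen (Tg b) L (q + 1) (gen (Tg a) M 0 w))"
      using expand_nat[OF van(1), of 1 w "(0, q)"] expand_op_nat[OF van(2), of 1 w "(0, q)"]
      by (simp add: nprod_def shift_diff_def)
    then show ?thesis unfolding gen_bracket by (simp add: add.commute)
  qed
  then show "nprod (gen (Tg a) M) (gen (Tg b) L) 1 = (\<lambda>q w. scale (lform a b) (gen Tc (M + L) q w))"
    by blast
  show "n \<ge> 2 \<Longrightarrow> nprod (gen (Tg a) M) (gen (Tg b) L) n = (\<lambda>q w. 0)"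
    using nprod_eq_0[OF gen_field gen_field gen_mode_local] by (auto simp: fun_eq_iff)
qed

lemma nprod_gen_commuting:
  assumes "\<forall>a b. t = Tg a \<longrightarrow> t' \<noteq> Tg b" "n \<ge> 0"
  shows "nprod (gen t M) (gen t' L) n = (\<lambda>q w. 0)"
  using nprod_eq_0[OF gen_field gen_field mode_local_commuting, of t M t' L n, OF gen_commute[OF assms(1)]] assms(2)
  by (auto simp: fun_eq_iff)

lemma nprod_gen_Tc: "is_field B \<Longrightarrow> nprod (gen Tc M) B n q w = (if n = -1 then cact M (B q w) else 0)"
  using nprod_constant[of B "cact M" n q w] by (simp add: gen_def[abs_def])

text \<open>The counterpart of left multiplication by \<open>x\<close> on V(T,0), as the Jacobi
  identity at \<open>p = 0\<close> dictates it.\<close>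

definition app :: "('g, 'r) tgen \<Rightarrow> (int^'r \<Rightarrow> int \<Rightarrow> 'w \<Rightarrow> 'w) \<Rightarrow> int^'r \<Rightarrow> int \<Rightarrow> 'w \<Rightarrow> 'w" where
  "app x G K = nprod (gen (tg_vec x) (tg_deg x)) (G (K - tg_deg x)) (tg_mode x)"

text \<open>The invariant under which all product identities with generators apply. Locality with
  generators suffices for its preservation, since Dong's lemma is then used with a generator as
  third field.\<close>

definition good :: "(int^'r \<Rightarrow> int \<Rightarrow> 'w \<Rightarrow> 'w) \<Rightarrow> bool" where
  "good G \<longleftrightarrow> (\<forall>K. is_field (G K)) \<and> (\<forall>t M K. mutually_local (gen t M) (G K))"

lemma goodD: "good G \<Longrightarrow> is_field (G K)" "good G \<Longrightarrow> mutually_local (gen t M) (G K)"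
  by (simp_all add: good_def)

lemma good_gen: "good (gen t)"
  by (simp add: good_def gen_field gen_mutually_local)

lemma goodI:
  "(\<And>K. is_field (G K)) \<Longrightarrow> (\<And>t M K. mutually_local (G K) (gen t M)) \<Longrightarrow> good G"
  unfolding good_def using mutually_local_sym by blast

lemma good_app:
  assumes G: "good G"
  shows "good (app x G)"
proof (rule goodI)
  fix K t M
  have l: "mutually_local (G L) (gen t M)" for L by (rule mutually_local_sym[OF goodD(2)[OF G]])
  show "is_field (app x G K)" unfolding app_def by (intro nprod_field gen_field goodD(1)[OF G])
  show "mutually_local (app x G K) (gen t M)" unfolding app_def
    by (rule mutually_local_nprod[OF gen_field goodD(1)[OF G] gen_field goodD(2)[OF G] l gen_mutually_local])
qed

lemma good_apps: "good G \<Longrightarrow> good (foldr app u G)"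
  by (induction u) (auto intro: good_app)

lemma good_add:
  assumes G: "good G" and H: "good H"
  shows "good (\<lambda>K m w. G K m w + H K m w)"
proof (rule goodI)
  fix K t M
  show "is_field (\<lambda>m w. G K m w + H K m w)" by (intro field_comb(1) goodD(1)[OF G] goodD(1)[OF H])
  show "mutually_local (\<lambda>m w. G K m w + H K m w) (gen t M)"
    by (rule mutually_local_add[OF mutually_local_sym[OF goodD(2)[OF G]] mutually_local_sym[OF goodD(2)[OF H]]
          goodD(1)[OF G] goodD(1)[OF H] gen_field])
qed

lemma good_scale:
  assumes G: "good G"
  shows "good (\<lambda>K m w. scale c (G K m w))"
proof (rule goodI)
  fix K t M
  show "is_field (\<lambda>m w. scale c (G K m w))" by (rule field_comb(2)[OF goodD(1)[OF G] goodD(1)[OF G]])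
  show "mutually_local (\<lambda>m w. scale c (G K m w)) (gen t M)"
    by (rule mutually_local_scale[OF mutually_local_sym[OF goodD(2)[OF G]] gen_field])
qed

lemma app_add: "good G \<Longrightarrow> good H \<Longrightarrow>
    app x (\<lambda>K m w. G K m w + H K m w) = (\<lambda>K m w. app x G K m w + app x H K m w)"
  by (auto simp: fun_eq_iff app_def intro!: nprod_bilinear(1) gen_field goodD(1))

lemma app_scale: "good G \<Longrightarrow>
    app x (\<lambda>K m w. scale c (G K m w)) = (\<lambda>K m w. scale c (app x G K m w))"
  by (auto simp: fun_eq_iff app_def intro!: nprod_bilinear(2) gen_field goodD(1))

lemma apps_add: "good G \<Longrightarrow> good H \<Longrightarrow>
    foldr app u (\<lambda>K m w. G K m w + H K m w) = (\<lambda>K m w. foldr app u G K m w + foldr app u H K m w)"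
  by (induction u) (auto simp: app_add good_apps)

lemma apps_scale: "good G \<Longrightarrow>
    foldr app u (\<lambda>K m w. scale c (G K m w)) = (\<lambda>K m w. scale c (foldr app u G K m w))"
  by (induction u) (auto simp: app_scale good_apps)

lemma app_TG_add: "good G \<Longrightarrow> app (TG (a + b) m M) G = (\<lambda>K q w. app (TG a m M) G K q w + app (TG b m M) G K q w)"
proof -
  assume G: "good G"
  have "gen (Tg (a + b)) M = (\<lambda>m w. gen (Tg a) M m w + gen (Tg b) M m w)"
    by (simp add: gen_def act_simps fun_eq_iff)
  then show ?thesis
    by (intro ext) (simp only: app_def tg_vec.simps tg_deg.simps tg_mode.simps
        nprod_bilinear(3)[OF gen_field gen_field goodD(1)[OF G] goodD(1)[OF G]])
qed

lemma app_TG_scale: "good G \<Longrightarrow> app (TG (lscale c a) m M) G = (\<lambda>K q w. scale c (app (TG a m M) G K q w))"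
proof -
  assume G: "good G"
  have "gen (Tg (lscale c a)) M = (\<lambda>m w. scale c (gen (Tg a) M m w))"
    by (simp add: gen_def act_simps fun_eq_iff)
  then show ?thesis
    by (intro ext) (simp only: app_def tg_vec.simps tg_deg.simps tg_mode.simps
        nprod_bilinear(4)[OF gen_field gen_field goodD(1)[OF G] goodD(1)[OF G]])
qed

lemma app_commute:
  assumes G: "good G" and xy: "\<forall>a b. tg_vec x = Tg a \<longrightarrow> tg_vec y \<noteq> Tg b"
  shows "app x (app y G) = app y (app x G)"
proof (intro ext)
  fix K q w
  have e: "K - tg_deg x - tg_deg y = K - tg_deg y - tg_deg x" by simp
  show "app x (app y G) K q w = app y (app x G) K q w"
    unfolding app_def e
    by (rule nprod_swap[OF gen_field gen_field goodD(1)[OF G] gen_commute[OF xy] goodD(2)[OF G] goodD(2)[OF G]])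
qed

lemma app_bracket:
  assumes G: "good G"
  shows "app (TG a m M) (app (TG b n L) G) = (\<lambda>K q w. app (TG b n L) (app (TG a m M) G) K q w +
    (app (TG (lbr a b) (m + n) (M + L)) G K q w +
     scale (if m + n = 0 then of_int m * lform a b else 0) (app (TC (M + L)) G K q w)))"
proof (intro ext)
  fix K q w
  define C where "C = G (K - (M + L))"
  have KC: "G (K - M - L) = C" "G (K - L - M) = C" by (simp_all add: C_def algebra_simps)
  have C: "is_field C" "mutually_local (gen t N) C" for t N by (simp_all add: C_def goodD[OF G])
  define H where "H k r = nprod (nprod (gen (Tg a) M) (gen (Tg b) L) k) C r q w" for k r
  have H: "H 0 r = nprod (gen (Tg (lbr a b)) (M + L)) C r q w"
      "H 1 r = scale (lform a b) (nprod (gen Tc (M + L)) C r q w)"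
      "k \<ge> 2 \<Longrightarrow> H k r = 0" for k r
    unfolding H_def
    by (simp_all add: nprod_gen nprod_zero_left[OF C(1)] nprod_bilinear(4)[OF gen_field gen_field C(1) C(1)])
  have "iterate_sum H m n 0 = (\<Sum>j<2. scale (gbin m j) (H (int j) (m + n - int j)))"
    unfolding iterate_sum_def by (subst fsum_eq_sum[of 2]) (auto simp: H(3))
  also have "\<dots> = H 0 (m + n) + scale (of_int m) (H 1 (m + n - 1))"
    using gbin_1[of m] by (simp add: numeral_2_eq_2)
  \<comment> \<open>The central field has only the mode \<open>-1\<close>, so its product of index
    \<open>m + n - 1\<close> survives only for \<open>m + n = 0\<close>.\<close>
  also have "\<dots> = nprod (gen (Tg (lbr a b)) (M + L)) C (m + n) q w +
     scale (if m + n = 0 then of_int m * lform a b else 0) (nprod (gen Tc (M + L)) C (-1) q w)"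
    by (auto simp: H nprod_gen_Tc[OF C(1)])
  finally have "iterate_sum H m n 0 = \<dots>" .
  moreover have "nprod (gen (Tg a) M) (nprod (gen (Tg b) L) C n) m q w -
      nprod (gen (Tg b) L) (nprod (gen (Tg a) M) C m) n q w = iterate_sum H m n 0"
    unfolding H_def[abs_def]
    by (rule nprod_commutator[OF gen_field gen_field C(1) gen_mutually_local C(2) C(2)])
  ultimately show "app (TG a m M) (app (TG b n L) G) K q w = app (TG b n L) (app (TG a m M) G) K q w +
    (app (TG (lbr a b) (m + n) (M + L)) G K q w +
     scale (if m + n = 0 then of_int m * lform a b else 0) (app (TC (M + L)) G K q w))"
    unfolding app_def tg_vec.simps tg_deg.simps tg_mode.simps KC C_def[symmetric]
    by (simp add: diff_eq_eq add.commute)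
qed

section \<open>Fields of words, descending to V(T,0)\<close>

definition fld :: "('g, 'r) tgen list \<times> 'g tvec \<Rightarrow> int^'r \<Rightarrow> int \<Rightarrow> 'w \<Rightarrow> 'w" where
  "fld k = foldr app (fst k) (gen (snd k))"

lemma good_fld: "good (fld k)"
  unfolding fld_def by (intro good_apps good_gen)

lemma fld_append: "fld (u @ v, t) = foldr app u (fld (v, t))"
  by (simp add: fld_def)

lemma fld_Cons: "fld (x # v, t) = app x (fld (v, t))"
  by (simp add: fld_def)

lemma fld_Nil: "fld ([], t) = gen t"
  by (simp add: fld_def)

lemma apps_zero: "foldr app u (\<lambda>K m w. 0) = (\<lambda>K m w. 0)"
proof -
  have "good (\<lambda>K m w. 0)" using good_scale[OF good_gen, of 0] by simp
  from apps_scale[OF this, of u 0] show ?thesis by simp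
qed

lemma app_TG_gen:
  "app (TG a 0 M) (gen (Tg b)) = gen (Tg (lbr a b))"
  "app (TG a 1 M) (gen (Tg b)) = (\<lambda>K q w. scale (lform a b) (gen Tc K q w))"
  "k \<ge> 2 \<Longrightarrow> app (TG a k M) (gen (Tg b)) = (\<lambda>K q w. 0)"
  "k \<ge> 0 \<Longrightarrow> app (TG a k M) (gen Tc) = (\<lambda>K q w. 0)"
  "k \<ge> 0 \<Longrightarrow> app (TG a k M) (gen T1) = (\<lambda>K q w. 0)"
  by (simp_all add: app_def fun_eq_iff nprod_gen nprod_gen_commuting)

text \<open>Linearity relations follow from bilinearity of products, commutation relations from the
  commutator formula, and balancing relations from the nonnegative products of generators. Letters
  to the left are harmless because \<open>foldr app\<close> is linear on good families.\<close>

lemma fld_vrel: "p \<in> vrel \<Longrightarrow> lin_ext (\<lambda>k. fld k K m w) p = 0"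
proof (induction rule: vrel.induct)
  case (lin_add u a b m M v t)
  show ?case
    by (simp add: lin_ext_simps fld_append fld_Cons app_TG_add apps_add good_app good_fld)
next
  case (lin_scale u c a m M v t)
  show ?case
    by (simp add: lin_ext_simps fld_append fld_Cons app_TG_scale apps_scale good_app good_fld)
next
  case (tlin_add u a b)
  have "gen (Tg (a + b)) = (\<lambda>K m w. gen (Tg a) K m w + gen (Tg b) K m w)"
    by (simp add: gen_def act_simps fun_eq_iff)
  then show ?case by (simp add: lin_ext_simps fld_def apps_add good_gen)
next
  case (tlin_scale u c a)
  have "gen (Tg (lscale c a)) = (\<lambda>K m w. scale c (gen (Tg a) K m w))"
    by (simp add: gen_def act_simps fun_eq_iff)
  then show ?case by (simp add: lin_ext_simps fld_def apps_scale good_gen)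
next
  case (comm_GG u a m M b n L v t)
  show ?case
    by (simp add: lin_ext_simps fld_append fld_Cons
        app_bracket[where a = a and m = m and M = M and b = b and n = n and L = L] apps_add apps_scale good_app good_fld
        good_add good_scale)
next
  case (comm_GC u a m M L v t)
  show ?case
    by (simp add: lin_ext_simps fld_append fld_Cons app_commute[OF good_fld, of "TG a m M" "TC L"])
next
  case (comm_CC u M L v t)
  show ?case
    by (simp add: lin_ext_simps fld_append fld_Cons app_commute[OF good_fld, of "TC M" "TC L"])
next
  case (ind_1 u a M b)
  show ?case
    by (simp add: lin_ext_simps fld_def app_TG_gen apps_scale good_gen)
qed (simp_all add: lin_ext_simps fld_def app_TG_gen apps_zero)

definition ind_Y :: "('g, 'r) vt0 \<Rightarrow> int \<Rightarrow> int^'r \<Rightarrow> 'w \<Rightarrow> 'w" where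
  "ind_Y v m K w = lin_ext (\<lambda>k. fld k K m w) (rep_vt0 v)"

abbreviation "ind_field v \<equiv> (\<lambda>K m w. ind_Y v m K w)"

lemma ind_Y_abs: "ind_Y (abs_vt0 p) m K w = lin_ext (\<lambda>k. fld k K m w) p"
  using fld_vrel[OF rep_abs_vt0[of p], of K m w] by (simp add: ind_Y_def lin_ext_diff)

lemma ind_Y_bv: "ind_Y (abs_vt0 (bv u t)) m K w = fld (u, t) K m w"
  by (simp add: ind_Y_abs lin_ext_bv)

lemma ind_Y_tinc: "ind_Y (tinc t) m K w = gen t K m w"
  by (simp add: tinc_def ind_Y_bv fld_Nil)

lemma ind_Y_add: "ind_Y (u + v) m K w = ind_Y u m K w + ind_Y v m K w"
  using ind_Y_abs[of "rep_vt0 u + rep_vt0 v" m K w]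
  by (simp add: plus_vt0.abs_eq[symmetric] abs_rep_vt0 lin_ext_add ind_Y_def[symmetric])

lemma ind_Y_scale: "ind_Y (vscale c v) m K w = scale c (ind_Y v m K w)"
  using ind_Y_abs[of "fscale c (rep_vt0 v)" m K w]
  by (simp add: vscale_abs[symmetric] abs_rep_vt0 lin_ext_fscale ind_Y_def[symmetric])

lemma good_ind: "good (ind_field v)"
  by (induction v rule: vt0_bv_induct) (simp_all add: ind_Y_bv good_fld ind_Y_add ind_Y_scale good_add good_scale)

lemma ind_field_simps:
  "ind_field (abs_vt0 (bv u t)) = fld (u, t)"
  "ind_field (v + v') = (\<lambda>K m w. ind_field v K m w + ind_field v' K m w)"
  "ind_field (vscale c v) = (\<lambda>K m w. scale c (ind_field v K m w))"
  by (simp_all add: fun_eq_iff ind_Y_bv ind_Y_add ind_Y_scale)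

lemma ind_Y_vact: "ind_Y (vact x v) m K w = app x (ind_field v) K m w"
proof (induction v arbitrary: m K w rule: vt0_bv_induct)
  case (bv u t)
  show ?case by (simp only: ind_field_simps vact_bv ind_Y_bv fld_Cons)
next
  case (add u v)
  then show ?case by (simp only: ind_field_simps vact_add ind_Y_add app_add[OF good_ind good_ind])
next
  case (scale c v)
  then show ?case by (simp only: ind_field_simps vact_scale ind_Y_scale app_scale[OF good_ind])
qed

lemma fld_truncated: "\<exists>N. \<forall>K m. m \<ge> N \<longrightarrow> fld (u, t) K m w = 0"
proof (induction u arbitrary: w)
  case Nil
  then show ?case using gen_truncated by (simp add: fld_Nil)
next
  case (Cons x u)
  show ?case unfolding fld_Cons app_def
    by (rule nprod_truncated_uniform[OF gen_field goodD(1)[OF good_fld]]) (use Cons in blast)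
qed

lemma ind_Y_truncated: "\<exists>N. \<forall>m\<ge>N. \<forall>K. ind_Y v m K w = 0"
proof (induction v rule: vt0_bv_induct)
  case (bv u t)
  then show ?case using fld_truncated[of u t w] unfolding ind_Y_bv by blast
next
  case (add u v)
  then obtain i j where "\<forall>m\<ge>i. \<forall>K. ind_Y u m K w = 0" "\<forall>m\<ge>j. \<forall>K. ind_Y v m K w = 0" by blast
  then show ?case unfolding ind_Y_add by (intro exI[of _ "max i j"]) simp
next
  case (scale c v)
  then show ?case unfolding ind_Y_scale by (metis scale_zero_right)
qed

text \<open>Induction on \<open>u\<close> alone: locality of \<open>v\<close> with generators is
  already part of \<open>good_ind\<close>, and Dong's lemma then passes letter by letter through
  \<open>u\<close>.\<close>

lemma ind_Y_mutually_local: "mutually_local (\<lambda>m. ind_Y u m M) (\<lambda>m. ind_Y v m K)"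
proof (induction u arbitrary: M rule: vt0_induct)
  case (tinc t)
  have "(\<lambda>m. ind_Y (tinc t) m M) = gen t M" by (simp add: fun_eq_iff ind_Y_tinc)
  then show ?case using goodD(2)[OF good_ind[of v]] by simp
next
  case (act x u)
  have "(\<lambda>m. ind_Y (vact x u) m M) = nprod (gen (tg_vec x) (tg_deg x)) (\<lambda>m. ind_Y u m (M - tg_deg x)) (tg_mode x)"
    by (simp add: fun_eq_iff ind_Y_vact app_def)
  then show ?case
    using mutually_local_nprod[OF gen_field goodD(1)[OF good_ind] goodD(1)[OF good_ind]
          goodD(2)[OF good_ind] act goodD(2)[OF good_ind]] by simp
next
  case (add u v')
  have "(\<lambda>m. ind_Y (u + v') m M) = (\<lambda>m w. ind_Y u m M w + ind_Y v' m M w)"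
    by (simp add: fun_eq_iff ind_Y_add)
  then show ?case using mutually_local_add[OF add goodD(1)[OF good_ind] goodD(1)[OF good_ind] goodD(1)[OF good_ind]]
    by simp
next
  case (scale c u)
  have "(\<lambda>m. ind_Y (vscale c u) m M) = (\<lambda>m w. scale c (ind_Y u m M w))"
    by (simp add: fun_eq_iff ind_Y_scale)
  then show ?case using mutually_local_scale[OF scale goodD(1)[OF good_ind]] by simp
qed

end

section \<open>Modules for V(T,0)\<close>

context complex_vector_space
begin

lemma jacobi_nprod:
  assumes "jacobi Y scale YW"
  shows "YW (Y u n M v) r K w = nprod (\<lambda>m. YW u m M) (\<lambda>m. YW v m (K - M)) n r w"
proof -
  have "iterate_sum (\<lambda>n r. YW (Y u n M v) r K w) 0 r n =
    expand u1 u2 n (\<lambda>(p, q). YW u p M (YW v q (K - M) w)) (0, r)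
    - expand_op u1 u2 n (\<lambda>(p, q). YW v q (K - M) (YW u p M w)) (0, r)"
    using assms unfolding jacobi_iff by blast
  then show ?thesis by (simp only: iterate_sum_zero_left nprod_def)
qed

lemma jacobi_commutator:
  assumes "jacobi Y scale YW"
  shows "iterate_sum (\<lambda>n r. YW (Y u n M v) r K w) p q 0 =
    YW u p M (YW v q (K - M) w) - YW v q (K - M) (YW u p M w)"
proof -
  have "iterate_sum (\<lambda>n r. YW (Y u n M v) r K w) p q 0 =
    expand u1 u2 0 (\<lambda>(p, q). YW u p M (YW v q (K - M) w)) (p, q)
    - expand_op u1 u2 0 (\<lambda>(p, q). YW v q (K - M) (YW u p M w)) (p, q)"
    using assms unfolding jacobi_iff by blast
  then show ?thesis by (simp add: expand_0 expand_op_0)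
qed

text \<open>For mutually local fields the whole Jacobi identity follows from its case
  \<open>p = 0\<close>, through \<open>nprod_modes\<close>.\<close>

lemma jacobiI:
  assumes f: "\<And>u M. is_field (\<lambda>m. YW u m M)"
    and l: "\<And>u v M K. mutually_local (\<lambda>m. YW u m M) (\<lambda>m. YW v m K)"
    and n: "\<And>u v n M K r w. YW (Y u n M v) r K w = nprod (\<lambda>m. YW u m M) (\<lambda>m. YW v m (K - M)) n r w"
  shows "jacobi Y scale YW"
  unfolding jacobi_iff
proof (intro allI)
  fix u v w p q n M K
  obtain N where "mode_local N (\<lambda>m. YW u m M) (\<lambda>m. YW v m (K - M))"
    using l unfolding mutually_local_def by blast
  from nprod_modes[OF f f this]
  show "iterate_sum (\<lambda>n r. YW (Y u n M v) r K w) p q n =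
    expand u1 u2 n (\<lambda>(p, q). YW u p M (YW v q (K - M) w)) (p, q)
    - expand_op u1 u2 n (\<lambda>(p, q). YW v q (K - M) (YW u p M w)) (p, q)"
    unfolding n .
qed

end

lemma
  assumes "vt_module scV Y vac sc YW"
  shows vt_module_space: "complex_vector_space sc"
    and vt_module_add: "YW (u + v) m M w = YW u m M w + YW v m M w"
    and vt_module_scale: "YW (scV c u) m M w = sc c (YW u m M w)"
    and vt_module_linear: "YW u m M (x + y) = YW u m M x + YW u m M y"
      "YW u m M (sc c x) = sc c (YW u m M x)"
    and vt_module_trunc: "\<exists>N. \<forall>m\<ge>N. \<forall>M. YW u m M w = 0"
    and vt_module_vac: "YW vac m M w = (if m = -1 \<and> M = 0 then w else 0)"
    and vt_module_jacobi: "jacobi Y sc YW"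
  using assms unfolding vt_module_def complex_vector_space_def
  by (simp_all add: Vector_Spaces.linear_iff)

lemma vt_module_field:
  assumes "vt_module scV Y vac sc YW"
  shows "complex_vector_space.is_field sc (\<lambda>m. YW u m M)"
  unfolding complex_vector_space.is_field_def[OF vt_module_space[OF assms]]
proof (intro conjI allI)
  show "\<exists>N. \<forall>m\<ge>N. YW u m M w = 0" for w
    using vt_module_trunc[OF assms, of u w] by blast
qed (simp_all add: vt_module_linear[OF assms])

lemma nprod_hom:
  assumes V1: "complex_vector_space sc1" and V2: "complex_vector_space sc2"
    and A: "complex_vector_space.is_field sc1 A" and B: "complex_vector_space.is_field sc1 B"
    and f: "\<And>x y. f (x + y) = f x + f y" "\<And>c x. f (sc1 c x) = sc2 c (f x)"
    and fA: "\<And>m w. f (A m w) = A' m (f w)" and fB: "\<And>m w. f (B m w) = B' m (f w)"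
  shows "f (complex_vector_space.nprod sc1 A B n q w) = complex_vector_space.nprod sc2 A' B' n q (f w)"
proof -
  interpret V1: complex_vector_space sc1 by fact
  interpret V2: complex_vector_space sc2 by fact
  have "f (x - y) = f x - f y" for x y
    using f(1)[of "x - y" y] by simp
  then show ?thesis
    unfolding V1.nprod_def V2.nprod_def
    using V2.expand_hom_from[OF V1 V1.field_pair_vanishes(1)[OF A B] f, where v = "(0, q)"]
      V2.expand_op_hom_from[OF V1 V1.field_pair_vanishes(2)[OF A B] f, where v = "(0, q)"]
    by (simp add: fA fB case_prod_unfold)
qed

section \<open>Modules determined by their generating fields\<close>

locale affine_toroidal_VA =
  fixes Y :: "('g::lie_data, 'r::finite) vt0 \<Rightarrow> int \<Rightarrow> int^'r \<Rightarrow> ('g, 'r) vt0 \<Rightarrow> ('g, 'r) vt0"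
  assumes VA: "toroidal_VA vscale Y (tinc T1)"
    and Y_Tc: "\<And>m M. Y (tinc Tc) m M = (if m = -1 then vact (TC M) else (\<lambda>_. 0))"
    and Y_Tg: "\<And>a m M. Y (tinc (Tg a)) m M = vact (TG a m M)"
begin

lemma Y_module: "vt_module vscale Y (tinc T1) vscale Y"
  using VA by (simp add: toroidal_VA_def)

lemma Y_letter: "Y (tinc (tg_vec x)) (tg_mode x) (tg_deg x) = vact x"
  by (cases x) (simp_all add: Y_Tc Y_Tg)

lemma module_vact:
  assumes W: "vt_module vscale Y (tinc T1) sc YW"
  shows "YW (vact x v) r K w = complex_vector_space.nprod sc
    (\<lambda>m. YW (tinc (tg_vec x)) m (tg_deg x)) (\<lambda>m. YW v m (K - tg_deg x)) (tg_mode x) r w"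
  using complex_vector_space.jacobi_nprod[OF vt_module_space[OF W] vt_module_jacobi[OF W],
      of "tinc (tg_vec x)" "tg_mode x" "tg_deg x" v r K w]
  by (simp add: Y_letter)

lemma module_hom_generators:
  assumes W1: "vt_module vscale Y (tinc T1) sc1 YW1" and W2: "vt_module vscale Y (tinc T1) sc2 YW2"
    and f: "\<And>x y. f (x + y) = f x + f y" "\<And>c x. f (sc1 c x) = sc2 c (f x)"
    and gen: "\<And>t m M w. f (YW1 (tinc t) m M w) = YW2 (tinc t) m M (f w)"
  shows "f (YW1 v m M w) = YW2 v m M (f w)"
proof (induction v arbitrary: m M w rule: vt0_induct)
  case (tinc t)
  then show ?case by (rule gen)
next
  case (act x v)
  show ?case unfolding module_vact[OF W1, of x v] module_vact[OF W2, of x v]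
    by (rule nprod_hom[OF vt_module_space[OF W1] vt_module_space[OF W2],
          where A' = "\<lambda>m. YW2 (tinc (tg_vec x)) m (tg_deg x)"
            and B' = "\<lambda>m. YW2 v m (M - tg_deg x)" and f = f])
       (rule vt_module_field[OF W1] f gen act)+
next
  case (add u v)
  then show ?case by (simp add: vt_module_add[OF W1] vt_module_add[OF W2] f)
next
  case (scale c v)
  then show ?case by (simp add: vt_module_scale[OF W1] vt_module_scale[OF W2] f)
qed

lemma module_unique:
  assumes W1: "vt_module vscale Y (tinc T1) sc YW1" and W2: "vt_module vscale Y (tinc T1) sc YW2"
    and Tc: "\<And>m M. YW1 (tinc Tc) m M = YW2 (tinc Tc) m M"
    and Tg: "\<And>a m M. YW1 (tinc (Tg a)) m M = YW2 (tinc (Tg a)) m M"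
  shows "YW1 = YW2"
proof (intro ext)
  fix v m M w
  have g: "YW1 (tinc t) m M w = YW2 (tinc t) m M w" for t m M w
    by (cases t) (simp_all add: Tc Tg vt_module_vac[OF W1] vt_module_vac[OF W2])
  \<comment> \<open>Uniqueness is the case of the identity map, a homomorphism between two
    structures on the same space.\<close>
  show "YW1 v m M w = YW2 v m M w"
    by (rule module_hom_generators[OF W1 W2, where f = "\<lambda>x. x"]) (simp_all only: g)
qed

end

section \<open>The module structure induced on a restricted module\<close>

locale affine_VA_restricted_module = affine_toroidal_VA Y + restricted_tau_module scale act cact
  for Y :: "('g::lie_data, 'r::finite) vt0 \<Rightarrow> int \<Rightarrow> int^'r \<Rightarrow> ('g, 'r) vt0 \<Rightarrow> ('g, 'r) vt0"
    and scale :: "complex \<Rightarrow> 'w::ab_group_add \<Rightarrow> 'w"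
    and act :: "'g \<Rightarrow> int \<Rightarrow> int^'r \<Rightarrow> 'w \<Rightarrow> 'w" and cact :: "int^'r \<Rightarrow> 'w \<Rightarrow> 'w"
begin

lemma ind_Y_zero: "ind_Y 0 m K w = 0"
  using ind_Y_add[of 0 0 m K w] by simp

lemma ind_Y_diff: "ind_Y (u - v) m K w = ind_Y u m K w - ind_Y v m K w"
  using ind_Y_add[of "u - v" v m K w] by simp

lemma ind_field_field: "is_field (\<lambda>m. ind_Y v m K)"
  using goodD(1)[OF good_ind[of v], of K] .

lemma ind_Y_iterate_tinc:
  "ind_Y (Y (tinc t) n M v) r K w = nprod (\<lambda>m. ind_Y (tinc t) m M) (\<lambda>m. ind_Y v m (K - M)) n r w"
proof -
  have g: "(\<lambda>m. ind_Y (tinc t) m M) = gen t M" for t by (simp add: fun_eq_iff ind_Y_tinc)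
  show ?thesis
  proof (cases t)
    case (Tg a)
    then show ?thesis by (simp add: g Y_Tg ind_Y_vact app_def)
  next
    case Tc
    then show ?thesis
      by (simp add: g Y_Tc ind_Y_vact app_def ind_Y_zero nprod_gen_Tc[OF ind_field_field])
  next
    case T1
    have "gen T1 M = (\<lambda>m x. if m = -1 then (if M = 0 then x else 0) else 0)"
      by (simp add: gen_def fun_eq_iff)
    then show ?thesis
      using T1 by (simp add: g vt_module_vac[OF Y_module] ind_Y_zero nprod_constant[OF ind_field_field])
  qed
qed

text \<open>The mode of \<open>vact x u\<close> on V(T,0) expands into modes of the letter and of
  \<open>u\<close>, because V(T,0) is a module over itself. By induction these become products of
  fields on W, and the associator formula there folds them back into the field of
  \<open>vact x u\<close>.\<close>

lemma ind_Y_iterate: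
  "ind_Y (Y u n M v) r K w = nprod (\<lambda>m. ind_Y u m M) (\<lambda>m. ind_Y v m (K - M)) n r w"
proof (induction u arbitrary: n M v r K w rule: vt0_induct)
  case (tinc t)
  show ?case by (rule ind_Y_iterate_tinc)
next
  case (act x u)
  interpret V: complex_vector_space "vscale :: complex \<Rightarrow> ('g, 'r) vt0 \<Rightarrow> _"
    by (rule complex_vector_space_vscale)
  let ?a = "tinc (tg_vec x)" and ?m = "tg_mode x" and ?L = "tg_deg x"
  let ?A = "\<lambda>m. ind_Y ?a m ?L" and ?B = "\<lambda>m. ind_Y u m (M - ?L)" and ?C = "\<lambda>m. ind_Y v m (K - M)"
  have Yf: "V.is_field (\<lambda>m. Y u m M)" for u M by (rule vt_module_field[OF Y_module])
  note van = V.field_pair_vanishes[OF Yf[of ?a ?L] Yf[of u "M - ?L"], of v]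
  have "ind_Y (Y (vact x u) n M v) r K w =
      ind_Y (V.nprod (\<lambda>m. Y ?a m ?L) (\<lambda>m. Y u m (M - ?L)) ?m n v) r K w"
    unfolding module_vact[OF Y_module] ..
  also have "\<dots> = ind_Y (V.expand u1 u2 ?m (\<lambda>(p, q). Y ?a p ?L (Y u q (M - ?L) v)) (0, n)) r K w
      - ind_Y (V.expand_op u1 u2 ?m (\<lambda>(p, q). Y u q (M - ?L) (Y ?a p ?L v)) (0, n)) r K w"
    unfolding V.nprod_def ind_Y_diff ..
  also have "ind_Y (V.expand u1 u2 ?m (\<lambda>(p, q). Y ?a p ?L (Y u q (M - ?L) v)) (0, n)) r K w =
      expand u1 u2 ?m (\<lambda>(p, q). nprod ?A (nprod ?B ?C q) p r w) (0, n)"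
  proof -
    have "ind_Y (Y ?a p ?L (Y u q (M - ?L) v)) r K w = nprod ?A (nprod ?B ?C q) p r w" for p q
    proof -
      have "(\<lambda>m. ind_Y (Y u q (M - ?L) v) m (K - ?L)) = nprod ?B ?C q"
        by (intro ext) (simp add: act)
      then show ?thesis unfolding ind_Y_iterate_tinc by simp
    qed
    then show ?thesis
      using expand_hom_from[OF complex_vector_space_vscale van(1), of "\<lambda>x. ind_Y x r K w" ?m "(0, n)"]
      by (simp add: ind_Y_add ind_Y_scale case_prod_unfold)
  qed
  also have "ind_Y (V.expand_op u1 u2 ?m (\<lambda>(p, q). Y u q (M - ?L) (Y ?a p ?L v)) (0, n)) r K w =
      expand_op u1 u2 ?m (\<lambda>(p, q). nprod ?B (nprod ?A ?C p) q r w) (0, n)"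
  proof -
    \<comment> \<open>Here the induction hypothesis is applied with \<open>Y ?a p ?L v\<close> in
      place of \<open>v\<close>, so \<open>v\<close> must be arbitrary in the induction.\<close>
    have "ind_Y (Y u q (M - ?L) (Y ?a p ?L v)) r K w = nprod ?B (nprod ?A ?C p) q r w" for p q
    proof -
      have "(\<lambda>m. ind_Y (Y ?a p ?L v) m (K - (M - ?L))) = nprod ?A ?C p"
        by (intro ext) (simp add: ind_Y_iterate_tinc)
      then show ?thesis unfolding act by simp
    qed
    then show ?thesis
      using expand_op_hom_from[OF complex_vector_space_vscale van(2), of "\<lambda>x. ind_Y x r K w" ?m "(0, n)"]
      by (simp add: ind_Y_add ind_Y_scale case_prod_unfold)
  qed
  also have "expand u1 u2 ?m (\<lambda>(p, q). nprod ?A (nprod ?B ?C q) p r w) (0, n)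
      - expand_op u1 u2 ?m (\<lambda>(p, q). nprod ?B (nprod ?A ?C p) q r w) (0, n) =
      nprod (nprod ?A ?B ?m) ?C n r w"
    by (rule nprod_associator[symmetric]) (intro ind_field_field ind_Y_mutually_local)+
  also have "nprod ?A ?B ?m = (\<lambda>m. ind_Y (vact x u) m M)"
    by (simp add: fun_eq_iff ind_Y_vact app_def ind_Y_tinc[abs_def])
  finally show ?case .
next
  case (add u u')
  have Y: "Y (u + u') n M v = Y u n M v + Y u' n M v" by (rule vt_module_add[OF Y_module])
  show ?case unfolding Y ind_Y_add
    using add nprod_bilinear(3)[OF ind_field_field ind_field_field ind_field_field ind_field_field]
    by simp
next
  case (scale c u)
  have Y: "Y (vscale c u) n M v = vscale c (Y u n M v)" by (rule vt_module_scale[OF Y_module])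
  show ?case unfolding Y ind_Y_scale
    using scale nprod_bilinear(4)[OF ind_field_field ind_field_field ind_field_field ind_field_field]
    by simp
qed

theorem ind_Y_module: "vt_module vscale Y (tinc T1) scale ind_Y"
proof -
  have "jacobi Y scale ind_Y"
    by (rule jacobiI[OF ind_field_field ind_Y_mutually_local ind_Y_iterate])
  moreover have "Vector_Spaces.linear scale scale (ind_Y v m M)" for v m M
    using field_add[OF ind_field_field] field_scale[OF ind_field_field] vector_space_axioms
    by (simp add: Vector_Spaces.linear_iff)
  ultimately show ?thesis
    unfolding vt_module_def using vector_space_axioms ind_Y_truncated
    by (simp add: ind_Y_add ind_Y_scale ind_Y_tinc gen_def)
qed

end

section \<open>The action of tau on a module\<close>

context affine_toroidal_VA
begin

text \<open>In the commutator formula only the products of index \<open>0\<close> and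
  \<open>1\<close> of two elements of g survive in \<open>T\<close>; they give the bracket and the
  central term.\<close>

lemma module_bracket:
  assumes W: "vt_module vscale Y (tinc T1) sc YW"
  shows "YW (tinc (Tg a)) p M (YW (tinc (Tg b)) q L w) - YW (tinc (Tg b)) q L (YW (tinc (Tg a)) p M w) =
    YW (tinc (Tg (lbr a b))) (p + q) (M + L) w
    + sc (of_int p * lform a b) (YW (tinc Tc) (p + q - 1) (M + L) w)"
proof -
  interpret complex_vector_space sc by (rule vt_module_space[OF W])
  define H where "H n r = YW (Y (tinc (Tg a)) n M (tinc (Tg b))) r (M + L) w" for n r
  have z: "YW 0 m K w = 0" for m K using vt_module_add[OF W, of 0 0 m K w] by simp
  have H: "H 0 r = YW (tinc (Tg (lbr a b))) r (M + L) w"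
      "H 1 r = sc (lform a b) (YW (tinc Tc) r (M + L) w)" "k \<ge> 2 \<Longrightarrow> H k r = 0" for k r
    by (simp_all add: H_def Y_Tg vact_TG_0 vact_TG_1 vact_TG_ge2 vt_module_scale[OF W] z)
  have "iterate_sum H p q 0 = (\<Sum>j<2. sc (gbin p j) (H (int j) (p + q - int j)))"
    unfolding iterate_sum_def by (subst fsum_eq_sum[of 2]) (auto simp: H(3))
  also have "\<dots> = H 0 (p + q) + sc (of_int p) (H 1 (p + q - 1))"
    using gbin_1[of p] by (simp add: numeral_2_eq_2)
  finally show ?thesis
    using jacobi_commutator[OF vt_module_jacobi[OF W], of "tinc (Tg a)" M "tinc (Tg b)" "M + L" w p q]
    by (simp add: H_def[symmetric] H(1,2))
qed

lemma module_commute: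
  assumes W: "vt_module vscale Y (tinc T1) sc YW" and z: "\<And>n. n \<ge> 0 \<Longrightarrow> Y u n M v = 0"
  shows "YW u p M (YW v q L w) = YW v q L (YW u p M w)"
proof -
  interpret complex_vector_space sc by (rule vt_module_space[OF W])
  have z0: "YW 0 m K w = 0" for m K using vt_module_add[OF W, of 0 0 m K w] by simp
  have "iterate_sum (\<lambda>n r. YW (Y u n M v) r (M + L) w) p q 0 = 0"
    by (rule iterate_sum_eq_0[of 0]) (simp_all add: z z0)
  then show ?thesis
    using jacobi_commutator[OF vt_module_jacobi[OF W], of u M v "M + L" w p q] by simp
qed

lemma module_Tc_mode:
  assumes W: "vt_module vscale Y (tinc T1) sc YW"
    and h: "lform (h::'g) h \<noteq> 0" "lbr h h = 0" and m: "m \<noteq> -1"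
  shows "YW (tinc Tc) m K w = 0"
proof -
  interpret complex_vector_space sc by (rule vt_module_space[OF W])
  have "tinc (Tg 0) = (0 :: ('g, 'r) vt0)" using tinc_add[of "0::'g" 0] by simp
  then have z: "YW (tinc (Tg (lbr h h))) p L w = 0" for p L
    using vt_module_add[OF W, of 0 0 p L w] h(2) by simp
  \<comment> \<open>The two brackets are negatives of each other, and the second has central
    coefficient \<open>0\<close>. Giving the partner \<open>h\<close> torus degree \<open>0\<close>
    places the central term in the arbitrary degree \<open>K\<close>.\<close>
  have "sc (of_int (m + 1) * lform h h) (YW (tinc Tc) m K w) = 0"
    using module_bracket[OF W, of h "m + 1" K h 0 0 w] module_bracket[OF W, of h 0 0 h "m + 1" K w]
    by (simp add: z)
  moreover have "of_int (m + 1) * lform h h \<noteq> 0" using h m by (simp add: add_eq_0_iff flip: of_int_add)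
  ultimately show ?thesis by simp
qed

lemma module_tau:
  assumes W: "vt_module vscale Y (tinc T1) sc YW"
    and Tc: "\<And>m M w. m \<noteq> -1 \<Longrightarrow> YW (tinc Tc) m M w = 0"
  shows "tau_module sc (\<lambda>a m M. YW (tinc (Tg a)) m M) (\<lambda>M. YW (tinc Tc) (-1) M)"
proof -
  interpret complex_vector_space sc by (rule vt_module_space[OF W])
  have "YW (tinc (Tg a)) m M (YW (tinc (Tg b)) n L w) - YW (tinc (Tg b)) n L (YW (tinc (Tg a)) m M w) =
      YW (tinc (Tg (lbr a b))) (m + n) (M + L) w +
      (if m + n = 0 then sc (of_int m * lform a b) (YW (tinc Tc) (-1) (M + L) w) else 0)" for a b m n M L w
    unfolding module_bracket[OF W] by (simp add: Tc)
  moreover have "YW (tinc Tc) (-1) M (YW (tinc (Tg a)) n L w) = YW (tinc (Tg a)) n L (YW (tinc Tc) (-1) M w)"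
    for M a n L w
    by (rule module_commute[OF W, symmetric]) (simp add: Y_Tg vact_TG_Tc)
  moreover have "YW (tinc Tc) (-1) M (YW (tinc Tc) (-1) L w) = YW (tinc Tc) (-1) L (YW (tinc Tc) (-1) M w)"
    for M L w
    by (rule module_commute[OF W]) (simp add: Y_Tc)
  ultimately show ?thesis
    unfolding tau_module_def using vector_space_axioms
    by (simp add: Vector_Spaces.linear_iff vt_module_linear[OF W] tinc_add tinc_scale
        vt_module_add[OF W] vt_module_scale[OF W])
qed

end

text \<open>Both passages keep the underlying space. The first two parts make them mutually inverse
  on objects: uniqueness recovers the module structure, and the mode condition on the central field
  matches the data given to it. The third part says that the same linear maps are morphisms on both
  sides.\<close>

theorem theorem4p4:
  fixes Y :: "('g::lie_data, 'r::finite) vt0 \<Rightarrow> int \<Rightarrow> int^'r \<Rightarrow> ('g, 'r) vt0 \<Rightarrow> ('g, 'r) vt0"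
  assumes "simple_lie_algebra TYPE('g)"
    and "normalized_killing_form TYPE('g)"
    and "toroidal_VA vscale Y (tinc T1)"
    and "\<forall>m M. Y (tinc Tc) m M = (if m = -1 then vact (TC M) else (\<lambda>_. 0))"
    and "\<forall>a m M. Y (tinc (Tg a)) m M = vact (TG a m M)"
  shows
    "(\<forall>(scW :: complex \<Rightarrow> 'w::ab_group_add \<Rightarrow> 'w) act cact.
        tau_module scW act cact \<and> restricted act \<longrightarrow>
        (\<exists>!YW. vt_module vscale Y (tinc T1) scW YW \<and>
           (\<forall>m M. YW (tinc Tc) m M = (if m = -1 then cact M else (\<lambda>_. 0))) \<and>
           (\<forall>a m M. YW (tinc (Tg a)) m M = act a m M)))
     \<and> (\<forall>(scW :: complex \<Rightarrow> 'w \<Rightarrow> 'w) YW.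
        vt_module vscale Y (tinc T1) scW YW \<longrightarrow>
        (\<forall>m M. m \<noteq> -1 \<longrightarrow> YW (tinc Tc) m M = (\<lambda>_. 0)) \<and>
        tau_module scW (\<lambda>a m M. YW (tinc (Tg a)) m M) (\<lambda>M. YW (tinc Tc) (-1) M) \<and>
        restricted (\<lambda>a m M. YW (tinc (Tg a)) m M))
     \<and> (\<forall>(sc1 :: complex \<Rightarrow> 'w1::ab_group_add \<Rightarrow> 'w1) YW1 (sc2 :: complex \<Rightarrow> 'w2::ab_group_add \<Rightarrow> 'w2) YW2 f.
        vt_module vscale Y (tinc T1) sc1 YW1 \<and> vt_module vscale Y (tinc T1) sc2 YW2 \<and>
        Vector_Spaces.linear sc1 sc2 f \<longrightarrow>
        (vt_module_hom YW1 YW2 f \<longleftrightarrow>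
         tau_hom (\<lambda>a m M. YW1 (tinc (Tg a)) m M) (\<lambda>M. YW1 (tinc Tc) (-1) M)
                 (\<lambda>a m M. YW2 (tinc (Tg a)) m M) (\<lambda>M. YW2 (tinc Tc) (-1) M) f))"
proof -
  interpret affine_toroidal_VA Y by unfold_locales (use assms(3-5) in simp_all)
  \<comment> \<open>The middle element of an sl2-triple on which the normalized form takes the value
    2.\<close>
  obtain h :: 'g where h: "lform h h \<noteq> 0"
    using assms(2) unfolding normalized_killing_form_def by force
  have hh: "lbr h h = 0"
    using assms(1) unfolding simple_lie_algebra_def fin_dim_lie_algebra_def by blast
  note Tc_mode = module_Tc_mode[OF _ h hh]
  show ?thesis
  proof (intro conjI allI impI)
    fix scW :: "complex \<Rightarrow> 'w \<Rightarrow> 'w" and act :: "'g \<Rightarrow> int \<Rightarrow> int^'r \<Rightarrow> 'w \<Rightarrow> 'w" and cact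
    assume *: "tau_module scW act cact \<and> restricted act"
    then have "vector_space scW" by (simp add: tau_module_def)
    with * interpret affine_VA_restricted_module Y scW act cact
      by (intro affine_VA_restricted_module.intro affine_toroidal_VA_axioms restricted_tau_module.intro
          complex_vector_space.intro restricted_tau_module_axioms.intro) simp_all
    show "\<exists>!YW. vt_module vscale Y (tinc T1) scW YW \<and>
           (\<forall>m M. YW (tinc Tc) m M = (if m = -1 then cact M else (\<lambda>_. 0))) \<and>
           (\<forall>a m M. YW (tinc (Tg a)) m M = act a m M)"
    proof (rule ex1I[of _ ind_Y])
      show "vt_module vscale Y (tinc T1) scW ind_Y \<and>
           (\<forall>m M. ind_Y (tinc Tc) m M = (if m = -1 then cact M else (\<lambda>_. 0))) \<and>
           (\<forall>a m M. ind_Y (tinc (Tg a)) m M = act a m M)"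
        by (simp add: ind_Y_module ind_Y_tinc gen_def fun_eq_iff)
      show "YW = ind_Y" if "vt_module vscale Y (tinc T1) scW YW \<and>
           (\<forall>m M. YW (tinc Tc) m M = (if m = -1 then cact M else (\<lambda>_. 0))) \<and>
           (\<forall>a m M. YW (tinc (Tg a)) m M = act a m M)" for YW
        by (rule module_unique[where sc = scW]) (use that ind_Y_module in \<open>simp_all add: fun_eq_iff ind_Y_tinc gen_def\<close>)
    qed
  next
    fix scW :: "complex \<Rightarrow> 'w \<Rightarrow> 'w" and YW m M
    assume W: "vt_module vscale Y (tinc T1) scW YW"
    show "m \<noteq> -1 \<Longrightarrow> YW (tinc Tc) m M = (\<lambda>_. 0)" using Tc_mode[OF W] by (simp add: fun_eq_iff)
    show "tau_module scW (\<lambda>a m M. YW (tinc (Tg a)) m M) (\<lambda>M. YW (tinc Tc) (-1) M)"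
      by (rule module_tau[OF W]) (rule Tc_mode[OF W])
    show "restricted (\<lambda>a m M. YW (tinc (Tg a)) m M)"
      unfolding restricted_def using vt_module_trunc[OF W] by blast
  next
    fix sc1 :: "complex \<Rightarrow> 'w1 \<Rightarrow> 'w1" and YW1 and sc2 :: "complex \<Rightarrow> 'w2 \<Rightarrow> 'w2" and YW2 f
    assume *: "vt_module vscale Y (tinc T1) sc1 YW1 \<and> vt_module vscale Y (tinc T1) sc2 YW2 \<and>
        Vector_Spaces.linear sc1 sc2 f"
    then have W1: "vt_module vscale Y (tinc T1) sc1 YW1" and W2: "vt_module vscale Y (tinc T1) sc2 YW2"
      and f: "f (x + y) = f x + f y" "f (sc1 c x) = sc2 c (f x)" for x y c
      by (simp_all add: Vector_Spaces.linear_iff)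
    have f0: "f 0 = 0" using f(1)[of 0 0] by simp
    show "vt_module_hom YW1 YW2 f \<longleftrightarrow>
         tau_hom (\<lambda>a m M. YW1 (tinc (Tg a)) m M) (\<lambda>M. YW1 (tinc Tc) (-1) M)
                 (\<lambda>a m M. YW2 (tinc (Tg a)) m M) (\<lambda>M. YW2 (tinc Tc) (-1) M) f"
    proof
      assume t: "tau_hom (\<lambda>a m M. YW1 (tinc (Tg a)) m M) (\<lambda>M. YW1 (tinc Tc) (-1) M)
                 (\<lambda>a m M. YW2 (tinc (Tg a)) m M) (\<lambda>M. YW2 (tinc Tc) (-1) M) f"
      have gen: "f (YW1 (tinc t) m M w) = YW2 (tinc t) m M (f w)" for t m M w
      proof (cases t)
        case (Tg a)
        then show ?thesis using t unfolding tau_hom_def by blast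
      next
        case Tc
        show ?thesis
        proof (cases "m = -1")
          case True
          then show ?thesis using t Tc unfolding tau_hom_def by blast
        next
          case False
          show ?thesis unfolding Tc Tc_mode[OF W1 False] Tc_mode[OF W2 False] by (rule f0)
        qed
      next
        case T1
        then show ?thesis by (simp add: vt_module_vac[OF W1] vt_module_vac[OF W2] f0)
      qed
      show "vt_module_hom YW1 YW2 f"
        unfolding vt_module_hom_def
      proof (intro allI)
        show "f (YW1 v m M w) = YW2 v m M (f w)" for v m M w
          by (rule module_hom_generators[OF W1 W2]) (rule f gen)+
      qed
    next
      assume "vt_module_hom YW1 YW2 f"
      then show "tau_hom (\<lambda>a m M. YW1 (tinc (Tg a)) m M) (\<lambda>M. YW1 (tinc Tc) (-1) M)
                 (\<lambda>a m M. YW2 (tinc (Tg a)) m M) (\<lambda>M. YW2 (tinc Tc) (-1) M) f"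
        unfolding vt_module_hom_def tau_hom_def by blast
    qed
  qed
qed

end
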